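(* Let $P$ be a finite nonempty connected $\Gamma$-colored $d$-complete poset. Fix $m\ge1$ and a linear extension of $P$. Suppose that $c^q,a_i^{n_i},\dots,a_2^{n_2},a_1^{n_1}$ has augmented stackwise form, where $c\in\Gamma$, $q\ge1$, $i\ge0$, and $n_t>0$ for $1\le t\le i$. Then: If $i=0$: (a) if $c$ is not the color of a minimal element of $P$, or if $q>m$, then $\langle c^q\rangle.\{\emptyset,\dots,\emptyset\}=0$; (b) if $c$ is the color of a minimal element $z$ of $P$ and $q\le m$, then $\langle c^q\rangle.\{\emptyset,\dots,\emptyset\}=\binom{m}{q}\{z,\dots,z,\emptyset,\dots,\emptyset\}$ (with $q$ copies of the ideal $\{z\}$ and $m-q$ copies of $\emptyset$), and this is an $m$-stackwise vector. If $i\ge1$: (c) if $c=a_i$ and $q+n_i>m$, then $\langle c^q,a_i^{n_i},\dots,a_1^{n_1}\rangle.\{\emptyset,\dots,\emptyset\}=0$; (d) if $c^q,a_i^{n_i},\dots,a_1^{n_1}$ is an $m$-stackwise word, then (i) if $c=a_i$, $\langle c^q,a_i^{n_i},\dots,a_1^{n_1}\rangle.\{\emptyset,\dots,\emptyset\}=\binom{q+n_i}{q}\langle a_i^{q+n_i},\dots,a_2^{n_2},a_1^{n_1}\rangle.\{\emptyset,\dots,\emptyset\}$, and (ii) if $c\ne a_i$, $\langle c^q,a_i^{n_i},\dots,a_1^{n_1}\rangle.\{\emptyset,\dots,\emptyset\}$ is an $m$-stackwise vector; in both cases the result is an integer multiple of an $m$-stackwise vector; (e) otherwise, $\langle c^q,a_i^{n_i},\dots,a_1^{n_1}\rangle.\{\emptyset,\dots,\emptyset\}$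 is a (possibly zero) integer linear combination of $m$-stackwise vectors $\langle d_h^{o_h},\dots,d_1^{o_1}\rangle.\{\emptyset,\dots,\emptyset\}$ whose words $d_h^{o_h},\dots,d_1^{o_1}$ have the same length as and are less than $c^q,a_i^{n_i},\dots,a_1^{n_1}$ in the total word order. In all cases the result either vanishes or is an integer linear combination of $m$-stackwise vectors whose words have the same length as and are less than or equal to $c^q,a_i^{n_i},\dots,a_1^{n_1}$ in the total word order.
   Context: Colored posets: $\kappa:P\to\Gamma$ is a surjective coloring by vertices of a finite simple graph $\Gamma$; $a\sim b$ means adjacent. $P$ is $\Gamma$-colored $d$-complete if: (EC) equal-colored elements are comparable; (NA) elements in a covering relation have adjacent colors; (AC) elements with adjacent colors are comparable; (ICE2) if $x<y$ both have color $a$ and no element of color $a$ lies strictly between them, then $(x,y)$ contains exactly two elements whose colors are adjacent to $a$; (UCB1) if $x$ is maximal among elements of color $a$, at most one element greater than $x$ has color adjacent to $a$. Operators: $X_a.I=\sum I\cup\{x\}$ over minimal elements $x$ of $P-I$ of color $a$, for an order ideal $I$. On the complex vector space with basis the $m$-multisets $\{I_1,\dots,I_m\}$ of order ideals, $X_a.\{I_1,\dots,I_m\}=\sum_j\{I_1,\dots,X_a.I_j,\dots,I_m\}$, $\langle a^k\rangle=\frac1{k!}X_a^k$ ($\langle a^0\rangle$ is the identity and is omitted), and $\langle b_k^{n_k},\dots,b_1^{n_1}\rangle=\langle b_k^{n_k}\rangle\circ\cdots\circ\langle b_1^{n_1}\rangle$. A word is a finite sequence of colors, written right to left in order of application; $b^n$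 denotes $b$ repeated $n$ times; its length counts repetitions. Stackwise words: given an order-reversing $\psi:P\to\{0,\dots,m\}$, let $x_1<\dots<x_i$ be the elements with $\psi(x)>0$ in the fixed linear extension order, $a_t=\kappa(x_t)$, $n_t=\psi(x_t)$; the word $a_i^{n_i},\dots,a_1^{n_1}$ is an $m$-stackwise word and $\langle a_i^{n_i},\dots,a_1^{n_1}\rangle.\{\emptyset,\dots,\emptyset\}$ is an $m$-stackwise vector. A word $c^q,a_i^{n_i},\dots,a_1^{n_1}$ with $a_i^{n_i},\dots,a_1^{n_1}$ an $m$-stackwise word ($i=0$ allowed, meaning the empty word) has augmented stackwise form. Total word order: extend the linear extension of $P$ to a total order on $P\cup\Gamma$ in which every element of $P$ exceeds every element of $\Gamma$. Gravity order on ideals: $I<J$ if $|I|>|J|$, or if $|I|=|J|$ and at the first position where their elements (listed in linear extension order) differ, $I$'s element is earlier; $m$-multisets are listed $I_1\le\dots\le I_m$. $X_a^{\min}.\{I_1,\dots,I_m\}=\{I_1,\dots,X_a.I_g,\dots,I_m\}$ with $g$ least such that $X_a.I_g\ne0$ (else $0$). A word $b_k,\dots,b_1$ grows well for $m$ if $X_{b_k}^{\min}\cdots X_{b_1}^{\min}.\{\emptyset,\dots,\emptyset\}\ne0$. For a word $\mathbf{a}=a_k,\dots,a_1$ let $R_h(\mathbf{a})=a_h,\dots,a_1$; let $\ell$ be maximal with $R_\ell(\mathbf{a})$ growing well, and let $[\mathbf{a}]$ be obtained from $\mathbf{a}$ by replacing each $a_h$ ($h\le\ell$) by the element of $P$ added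 by $X_{a_h}^{\min}$ at step $h$. For words $\mathbf{a},\mathbf{b}$: $\mathbf{a}<\mathbf{b}$ if $\mathbf{a}$ is shorter; if they have equal length, $\mathbf{a}<\mathbf{b}$ if at the first position from the right where $[\mathbf{a}]$ and $[\mathbf{b}]$ differ, the entry of $[\mathbf{a}]$ is smaller in the total order on $P\cup\Gamma$. *)

theory Defs
  imports Complex_Main "HOL-Library.Multiset" "HOL-Library.Poly_Mapping"
begin

text \<open>
  The poset \<open>P\<close> is a type \<open>'p\<close> of class \<open>{finite, order}\<close> (hence nonempty), the vertices of the
  graph \<open>\<Gamma>\<close> are the elements of a type \<open>'c\<close> of class \<open>finite\<close>, and \<open>adj\<close> is its adjacency
  relation.
\<close>

section \<open>Colored d-complete posets\<close>

definition simple_graph :: "('c \<Rightarrow> 'c \<Rightarrow> bool) \<Rightarrow> bool" where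
  "simple_graph adj \<longleftrightarrow> (\<forall>a. \<not> adj a a) \<and> (\<forall>a b. adj a b \<longrightarrow> adj b a)"

definition comparable :: "'p::order \<Rightarrow> 'p \<Rightarrow> bool" where
  "comparable x y \<longleftrightarrow> x \<le> y \<or> y \<le> x"

definition covered_by :: "'p::order \<Rightarrow> 'p \<Rightarrow> bool" where
  "covered_by x y \<longleftrightarrow> x < y \<and> (\<nexists>z. x < z \<and> z < y)"

definition minimal_element :: "'p::order \<Rightarrow> bool" where
  "minimal_element z \<longleftrightarrow> (\<nexists>y. y < z)"

definition EC :: "('p::order \<Rightarrow> 'c) \<Rightarrow> bool" where
  "EC \<kappa> \<longleftrightarrow> (\<forall>x y. \<kappa> x = \<kappa> y \<longrightarrow> comparable x y)"

definition NA :: "('c \<Rightarrow> 'c \<Rightarrow> bool) \<Rightarrow> ('p::order \<Rightarrow> 'c) \<Rightarrow> bool" where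
  "NA adj \<kappa> \<longleftrightarrow> (\<forall>x y. covered_by x y \<longrightarrow> adj (\<kappa> x) (\<kappa> y))"

definition AC :: "('c \<Rightarrow> 'c \<Rightarrow> bool) \<Rightarrow> ('p::order \<Rightarrow> 'c) \<Rightarrow> bool" where
  "AC adj \<kappa> \<longleftrightarrow> (\<forall>x y. adj (\<kappa> x) (\<kappa> y) \<longrightarrow> comparable x y)"

definition ICE2 :: "('c \<Rightarrow> 'c \<Rightarrow> bool) \<Rightarrow> ('p::order \<Rightarrow> 'c) \<Rightarrow> bool" where
  "ICE2 adj \<kappa> \<longleftrightarrow>
     (\<forall>a x y. x < y \<and> \<kappa> x = a \<and> \<kappa> y = a \<and> (\<nexists>z. x < z \<and> z < y \<and> \<kappa> z = a) \<longrightarrow>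
        card {z. x < z \<and> z < y \<and> adj (\<kappa> z) a} = 2)"

definition UCB1 :: "('c \<Rightarrow> 'c \<Rightarrow> bool) \<Rightarrow> ('p::order \<Rightarrow> 'c) \<Rightarrow> bool" where
  "UCB1 adj \<kappa> \<longleftrightarrow>
     (\<forall>a x. \<kappa> x = a \<and> (\<nexists>y. x < y \<and> \<kappa> y = a) \<longrightarrow> card {y. x < y \<and> adj (\<kappa> y) a} \<le> 1)"

definition colored_d_complete :: "('c::finite \<Rightarrow> 'c \<Rightarrow> bool) \<Rightarrow> ('p::{finite,order} \<Rightarrow> 'c) \<Rightarrow> bool" where
  "colored_d_complete adj \<kappa> \<longleftrightarrow>
     simple_graph adj \<and> surj \<kappa> \<and> EC \<kappa> \<and> NA adj \<kappa> \<and> AC adj \<kappa> \<and> ICE2 adj \<kappa> \<and> UCB1 adj \<kappa>"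

text \<open>Connectedness of a poset: its Hasse diagram is a connected graph.\<close>

definition connected_poset :: "'p::order itself \<Rightarrow> bool" where
  "connected_poset _ \<longleftrightarrow> (\<forall>x y :: 'p. (\<lambda>u v. covered_by u v \<or> covered_by v u)\<^sup>*\<^sup>* x y)"


section \<open>Total orders given by enumerations\<close>

definition enum_less :: "'a list \<Rightarrow> ('a \<times> 'a) set" where
  "enum_less xs = {(xs ! i, xs ! j) | i j. i < j \<and> j < length xs}"

definition total_enum :: "'a list \<Rightarrow> bool" where
  "total_enum xs \<longleftrightarrow> distinct xs \<and> set xs = UNIV"

definition linear_extension :: "'p::order list \<Rightarrow> bool" where
  "linear_extension ext \<longleftrightarrow> total_enum ext \<and> (\<forall>x y. x < y \<longrightarrow> (x, y) \<in> enum_less ext)"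


section \<open>The operators\<close>

text \<open>
  Vectors are finitely supported complex functions on multisets of subsets of \<open>P\<close>; the space with
  basis the \<open>m\<close>-multisets of order ideals is an invariant subspace of the operators below.
\<close>

type_synonym 'p vec = "'p set multiset \<Rightarrow>\<^sub>0 complex"

definition scale :: "complex \<Rightarrow> 'p vec \<Rightarrow> 'p vec" where
  "scale r v = Poly_Mapping.map ((*) r) v"

definition basis :: "'p set multiset \<Rightarrow> 'p vec" where
  "basis M = Poly_Mapping.single M 1"

text \<open>The minimal elements of \<open>P - I\<close> of color \<open>a\<close>; so \<open>X\<^sub>a.I \<noteq> 0\<close> iff this set is nonempty.\<close>

definition addable :: "('p::order \<Rightarrow> 'c) \<Rightarrow> 'c \<Rightarrow> 'p set \<Rightarrow> 'p set" where
  "addable \<kappa> a I = {x. x \<notin> I \<and> \<kappa> x = a \<and> (\<forall>y. y < x \<longrightarrow> y \<in> I)}"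

text \<open>
  The sum over the ideals of \<open>M\<close> is taken with multiplicity, i.e. over the index \<open>j\<close> in
  \<open>{I\<^sub>1, \<dots>, I\<^sub>m}\<close>; the sum \<open>X\<^sub>a.I\<^sub>j\<close> occurring in an entry is expanded linearly.
\<close>

definition X_basis :: "('p::{finite,order} \<Rightarrow> 'c) \<Rightarrow> 'c \<Rightarrow> 'p set multiset \<Rightarrow> 'p vec" where
  "X_basis \<kappa> a M =
     (\<Sum>I\<in>#M. \<Sum>x\<in>addable \<kappa> a I. basis (add_mset (I \<union> {x}) (M - {#I#})))"

definition X :: "('p::{finite,order} \<Rightarrow> 'c) \<Rightarrow> 'c \<Rightarrow> 'p vec \<Rightarrow> 'p vec" where
  "X \<kappa> a v = (\<Sum>M\<in>Poly_Mapping.keys v. scale (Poly_Mapping.lookup v M) (X_basis \<kappa> a M))"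

definition divided_power :: "('p::{finite,order} \<Rightarrow> 'c) \<Rightarrow> 'c \<Rightarrow> nat \<Rightarrow> 'p vec \<Rightarrow> 'p vec" where
  "divided_power \<kappa> a k v = scale (1 / fact k) ((X \<kappa> a ^^ k) v)"

definition empty_ideals :: "nat \<Rightarrow> 'p set multiset" where
  "empty_ideals m = replicate_mset m {}"


section \<open>Words\<close>

text \<open>
  Words are lists in the order in which they are written, so the last entry is applied first.
  A list of blocks \<open>[(b\<^sub>k, n\<^sub>k), \<dots>, (b\<^sub>1, n\<^sub>1)]\<close> stands for the exponential notation
  \<open>b\<^sub>k^n\<^sub>k, \<dots>, b\<^sub>1^n\<^sub>1\<close>. The operator depends on the blocks; being a stackwise word, length and
  word order only depend on the underlying sequence of colors.
\<close>

type_synonym 'c blocks = "('c \<times> nat) list"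

definition word_of :: "'c blocks \<Rightarrow> 'c list" where
  "word_of bs = concat (map (\<lambda>(b, n). replicate n b) bs)"

fun block_op :: "('p::{finite,order} \<Rightarrow> 'c) \<Rightarrow> 'c blocks \<Rightarrow> 'p vec \<Rightarrow> 'p vec" where
  "block_op \<kappa> [] v = v"
| "block_op \<kappa> ((b, n) # bs) v = divided_power \<kappa> b n (block_op \<kappa> bs v)"

definition block_vector :: "('p::{finite,order} \<Rightarrow> 'c) \<Rightarrow> nat \<Rightarrow> 'c blocks \<Rightarrow> 'p vec" where
  "block_vector \<kappa> m bs = block_op \<kappa> bs (basis (empty_ideals m))"

definition stackwise_blocks_of :: "('p::{finite,order} \<Rightarrow> 'c) \<Rightarrow> 'p list \<Rightarrow> ('p \<Rightarrow> nat) \<Rightarrow> 'c blocks" where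
  "stackwise_blocks_of \<kappa> ext \<psi> =
     rev (map (\<lambda>x. (\<kappa> x, \<psi> x)) (filter (\<lambda>x. \<psi> x > 0) ext))"

definition stackwise_blocks :: "('p::{finite,order} \<Rightarrow> 'c) \<Rightarrow> 'p list \<Rightarrow> nat \<Rightarrow> 'c blocks \<Rightarrow> bool" where
  "stackwise_blocks \<kappa> ext m bs \<longleftrightarrow>
     (\<exists>\<psi>. antimono \<psi> \<and> (\<forall>x. \<psi> x \<le> m) \<and> bs = stackwise_blocks_of \<kappa> ext \<psi>)"

definition stackwise_word :: "('p::{finite,order} \<Rightarrow> 'c) \<Rightarrow> 'p list \<Rightarrow> nat \<Rightarrow> 'c list \<Rightarrow> bool" where
  "stackwise_word \<kappa> ext m w \<longleftrightarrow> (\<exists>bs. stackwise_blocks \<kappa> ext m bs \<and> w = word_of bs)"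

definition stackwise_vector :: "('p::{finite,order} \<Rightarrow> 'c) \<Rightarrow> 'p list \<Rightarrow> nat \<Rightarrow> 'p vec \<Rightarrow> bool" where
  "stackwise_vector \<kappa> ext m v \<longleftrightarrow> (\<exists>bs. stackwise_blocks \<kappa> ext m bs \<and> v = block_vector \<kappa> m bs)"

definition int_combination :: "'p vec set \<Rightarrow> 'p vec \<Rightarrow> bool" where
  "int_combination S v \<longleftrightarrow>
     (\<exists>F r. finite F \<and> F \<subseteq> S \<and> v = (\<Sum>u\<in>F. scale (of_int (r u)) u))"


section \<open>The total order on words\<close>

definition gravity_less :: "'p list \<Rightarrow> 'p set \<Rightarrow> 'p set \<Rightarrow> bool" where
  "gravity_less ext I J \<longleftrightarrow>
     card I > card J \<or>
     card I = card J \<and>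
       (filter (\<lambda>x. x \<in> I) ext, filter (\<lambda>x. x \<in> J) ext) \<in> lex (enum_less ext)"

text \<open>
  \<open>None\<close> stands for \<open>X\<^sub>a\<^sup>m\<^sup>i\<^sup>n.M = 0\<close>; otherwise the added element of \<open>P\<close> and the new multiset are
  returned. The added element is unique because of (EC). Indices \<open>g\<close> with equal ideals give the same
  result, so it suffices to choose the ideal.
\<close>

definition X_min :: "('p::{finite,order} \<Rightarrow> 'c) \<Rightarrow> 'p list \<Rightarrow> 'c \<Rightarrow> 'p set multiset
    \<Rightarrow> ('p \<times> 'p set multiset) option" where
  "X_min \<kappa> ext a M =
     (let G = {I. I \<in># M \<and> addable \<kappa> a I \<noteq> {}} in
      if G = {} then None
      else let I = (THE I. I \<in> G \<and> (\<forall>J\<in>G. J \<noteq> I \<longrightarrow> gravity_less ext I J));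
               x = (THE x. x \<in> addable \<kappa> a I)
           in Some (x, add_mset (I \<union> {x}) (M - {#I#})))"

text \<open>The elements successively added by the operators \<open>X_min\<close>, listed like the word.\<close>

fun growth :: "('p::{finite,order} \<Rightarrow> 'c) \<Rightarrow> 'p list \<Rightarrow> nat \<Rightarrow> 'c list
    \<Rightarrow> ('p list \<times> 'p set multiset) option" where
  "growth \<kappa> ext m [] = Some ([], empty_ideals m)"
| "growth \<kappa> ext m (a # w) =
     (case growth \<kappa> ext m w of
        None \<Rightarrow> None
      | Some (xs, M) \<Rightarrow>
          (case X_min \<kappa> ext a M of
             None \<Rightarrow> None
           | Some (x, M') \<Rightarrow> Some (x # xs, M')))"

definition grows_well :: "('p::{finite,order} \<Rightarrow> 'c) \<Rightarrow> 'p list \<Rightarrow> nat \<Rightarrow> 'c list \<Rightarrow> bool" where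
  "grows_well \<kappa> ext m w \<longleftrightarrow> growth \<kappa> ext m w \<noteq> None"

definition right_part :: "nat \<Rightarrow> 'c list \<Rightarrow> 'c list" where
  "right_part h w = drop (length w - h) w"

definition growth_length :: "('p::{finite,order} \<Rightarrow> 'c) \<Rightarrow> 'p list \<Rightarrow> nat \<Rightarrow> 'c list \<Rightarrow> nat" where
  "growth_length \<kappa> ext m w =
     (GREATEST h. h \<le> length w \<and> grows_well \<kappa> ext m (right_part h w))"

definition bracket :: "('p::{finite,order} \<Rightarrow> 'c) \<Rightarrow> 'p list \<Rightarrow> nat \<Rightarrow> 'c list \<Rightarrow> ('c + 'p) list" where
  "bracket \<kappa> ext m w =
     (let l = growth_length \<kappa> ext m w in
      map Inl (take (length w - l) w) @
      map Inr (fst (the (growth \<kappa> ext m (right_part l w)))))"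

text \<open>
  The total order on the disjoint union of \<open>\<Gamma>\<close> and \<open>P\<close>, where \<open>gext\<close> enumerates \<open>\<Gamma>\<close>.
\<close>

definition letter_less :: "'p list \<Rightarrow> 'c list \<Rightarrow> (('c + 'p) \<times> ('c + 'p)) set" where
  "letter_less ext gext = enum_less (map Inl gext @ map Inr ext)"

text \<open>\<open>lenlex\<close> compares from the left, words are compared from the right, hence \<open>rev\<close>.\<close>

definition word_less :: "('p::{finite,order} \<Rightarrow> 'c) \<Rightarrow> 'p list \<Rightarrow> 'c list \<Rightarrow> nat
    \<Rightarrow> 'c list \<Rightarrow> 'c list \<Rightarrow> bool" where
  "word_less \<kappa> ext gext m v w \<longleftrightarrow>
     (rev (bracket \<kappa> ext m v), rev (bracket \<kappa> ext m w)) \<in> lenlex (letter_less ext gext)"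

definition stackwise_vectors_less :: "('p::{finite,order} \<Rightarrow> 'c) \<Rightarrow> 'p list \<Rightarrow> 'c list \<Rightarrow> nat
    \<Rightarrow> 'c list \<Rightarrow> 'p vec set" where
  "stackwise_vectors_less \<kappa> ext gext m w =
     {block_vector \<kappa> m ds | ds. stackwise_blocks \<kappa> ext m ds \<and>
        length (word_of ds) = length w \<and> word_less \<kappa> ext gext m (word_of ds) w}"

definition stackwise_vectors_le :: "('p::{finite,order} \<Rightarrow> 'c) \<Rightarrow> 'p list \<Rightarrow> 'c list \<Rightarrow> nat
    \<Rightarrow> 'c list \<Rightarrow> 'p vec set" where
  "stackwise_vectors_le \<kappa> ext gext m w =
     {block_vector \<kappa> m ds | ds. stackwise_blocks \<kappa> ext m ds \<and>
        length (word_of ds) = length w \<and>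
        (word_less \<kappa> ext gext m (word_of ds) w \<or> word_of ds = w)}"

end

theory Submission
  imports Defs "HOL-Library.Function_Algebras" "HOL-Library.FuncSet"
begin

text \<open>
  The operators \<open>X\<^sub>a\<close> are lifted from multisets to ordered tuples of ideals, where coefficients of
  divided powers are integers. There they are sums of commuting one-slot operators, and (EC), (NA),
  (AC), (ICE2) give the Serre relations. For an ideal \<open>I\<close>, let \<open>D(I)\<close> be spanned by all words that
  follow a linear extension of \<open>I\<close> with arbitrary exponents (a Demazure module). The Serre relations
  and (UCB1) show that \<open>D(I)\<close> is stable under \<open>X\<^sub>c\<close> unless an element of color \<open>c\<close> can be added to \<open>I\<close>,
  and that exponents violating the stackwise condition can be lowered; hence stackwise vectors span
  \<open>D(P)\<close>, over the complex numbers. The coefficient of the vector of \<open>\<psi>\<close> at the stack of ideals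
  \<open>{x. j < \<phi> x}\<close> is \<open>1\<close> for \<open>\<phi> = \<psi>\<close> and vanishes unless all prefix sums of \<open>\<phi>\<close> along the linear
  extension are at least those of \<open>\<psi>\<close>. This unitriangularity makes the coefficients of the
  combination integers and at the same time yields the comparison of words.
\<close>

text \<open>Tuples form the \<open>m\<close>-th tensor power of the space on ideals, and multisets
  are its symmetric quotient. In the quotient leading coefficients become binomials, as in (b); on
  tuples a divided power is a sum over subsets of slots with all coefficients 1, and this is what
  gives the triangular system a unit diagonal. The exchange relations behind the spanning argument
  divide by integers and do not keep track of which stackwise vectors arise, so integrality and the
  word order have to come from elsewhere. The augmented word is compared without being grown to its
  end. Its stackwise part grows well and fixes the right end of the bracket; an exponent function
  that dominates the given one first exceeds it at some \<open>x\<close>, so its next letter is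
  \<open>x\<close> while the given word continues with a later element. The comparison fails only if
  the stackwise part has no letter after \<open>x\<close>, and then weights and (ICE2) show that the
  augmented word is itself stackwise.\<close>

definition downset :: "'p::order set \<Rightarrow> bool" where
  "downset I \<longleftrightarrow> (\<forall>x\<in>I. \<forall>y. y \<le> x \<longrightarrow> y \<in> I)"

lemma downsetD: "downset I \<Longrightarrow> x \<in> I \<Longrightarrow> y \<le> x \<Longrightarrow> y \<in> I"
  by (auto simp: downset_def)

lemma downsetD': "downset I \<Longrightarrow> x \<in> I \<Longrightarrow> y < x \<Longrightarrow> y \<in> I"
  by (auto simp: downset_def)

lemma downset_UNIV [simp]: "downset UNIV"
  by (simp add: downset_def)

lemma downset_empty [simp]: "downset {}"
  by (simp add: downset_def)

lemma downset_remove_maximal: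
  "downset I \<Longrightarrow> \<forall>x\<in>I. \<not> y < x \<Longrightarrow> downset (I - {y})"
  by (auto simp: downset_def order.order_iff_strict)

lemma finite_order_maximal_above:
  fixes I :: "'p::{finite,order} set"
  assumes "x \<in> I"
  obtains y where "y \<in> I" "x \<le> y" "\<forall>z\<in>I. \<not> y < z"
proof -
  obtain y where "y \<in> I" "x \<le> y" "\<forall>z\<in>I. y \<le> z \<longrightarrow> z = y"
    using finite_has_maximal2[of I x] assms by auto
  with that show ?thesis by (metis order.strict_implies_order order_less_irrefl)
qed

lemma covered_by_above:
  fixes x y :: "'p::{finite,order}"
  assumes "x < y"
  obtains v where "covered_by x v" "v \<le> y"
proof -
  obtain v where v: "x < v" "v \<le> y" and min: "\<And>z. x < z \<Longrightarrow> z \<le> y \<Longrightarrow> z \<le> v \<Longrightarrow> z = v"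
    using finite_has_minimal2[of "{v. x < v \<and> v \<le> y}" y] assms by auto
  have "covered_by x v"
    unfolding covered_by_def using v min by (metis order_less_imp_le order_less_irrefl order_less_le_trans)
  with v that show ?thesis by blast
qed

lemma covered_by_below:
  fixes x y :: "'p::{finite,order}"
  assumes "x < y"
  obtains u where "covered_by u y" "x \<le> u"
proof -
  obtain u where u: "x \<le> u" "u < y" and max: "\<And>z. x \<le> z \<Longrightarrow> z < y \<Longrightarrow> u \<le> z \<Longrightarrow> z = u"
    using finite_has_maximal2[of "{v. x \<le> v \<and> v < y}" x] assms by auto
  have "\<not> z < y" if "u < z" for z
    using max[of z] u that by (metis order_less_imp_le order_le_less_trans order_less_irrefl)
  then have "covered_by u y"
    unfolding covered_by_def using u by blast
  with u that show ?thesis by blast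
qed

section \<open>Order-theoretic consequences of the coloring axioms\<close>

locale colored_dc =
  fixes adj :: "'c::finite \<Rightarrow> 'c \<Rightarrow> bool"
    and \<kappa> :: "'p::{finite,order} \<Rightarrow> 'c"
    and ext :: "'p list"
    and m :: nat
  assumes dc: "colored_d_complete adj \<kappa>"
    and ext: "linear_extension ext"
begin

lemma adj_irrefl [simp]: "\<not> adj a a"
  using dc by (auto simp: colored_d_complete_def simple_graph_def)

lemma adj_sym: "adj a b \<Longrightarrow> adj b a"
  using dc by (auto simp: colored_d_complete_def simple_graph_def)

lemma same_color_comparable: "\<kappa> x = \<kappa> y \<Longrightarrow> x \<le> y \<or> y \<le> x"
  using dc by (auto simp: colored_d_complete_def EC_def comparable_def)

lemma adj_color_comparable: "adj (\<kappa> x) (\<kappa> y) \<Longrightarrow> x < y \<or> y < x"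
  using dc by (metis AC_def adj_irrefl colored_d_complete_def comparable_def order.order_iff_strict)

lemma covered_by_adj: "covered_by x y \<Longrightarrow> adj (\<kappa> x) (\<kappa> y)"
  using dc by (auto simp: colored_d_complete_def NA_def)

lemma two_between:
  "x < y \<Longrightarrow> \<kappa> x = \<kappa> y \<Longrightarrow> \<forall>z. x < z \<and> z < y \<longrightarrow> \<kappa> z \<noteq> \<kappa> y \<Longrightarrow>
     card {z. x < z \<and> z < y \<and> adj (\<kappa> z) (\<kappa> y)} = 2"
  using dc unfolding colored_d_complete_def ICE2_def by blast

lemma at_most_one_above:
  "\<forall>y. x < y \<longrightarrow> \<kappa> y \<noteq> \<kappa> x \<Longrightarrow> card {y. x < y \<and> adj (\<kappa> y) (\<kappa> x)} \<le> 1"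
  using dc unfolding colored_d_complete_def UCB1_def by blast

lemma next_same_color:
  assumes "x < y" "\<kappa> y = \<kappa> x"
  obtains z where "x < z" "z \<le> y" "\<kappa> z = \<kappa> x" "\<forall>w. x < w \<and> w < z \<longrightarrow> \<kappa> w \<noteq> \<kappa> x"
proof -
  let ?A = "{z. x < z \<and> z \<le> y \<and> \<kappa> z = \<kappa> x}"
  obtain z where z: "z \<in> ?A" "\<forall>w\<in>?A. w \<le> z \<longrightarrow> w = z"
    using finite_has_minimal2[of ?A y] assms by auto
  then have "\<forall>w. x < w \<and> w < z \<longrightarrow> \<kappa> w \<noteq> \<kappa> x"
    by (metis (mono_tags, lifting) mem_Collect_eq order.strict_iff_not order_less_le_trans)
  with z that show ?thesis by blast
qed

text \<open>(ICE2) is applied to \<open>x\<close> and the next element of its color. The witness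
  \<open>w\<close> is what blocks adding or removing two elements of one color in
  succession.\<close>

lemma adj_between:
  assumes "x < y" "\<kappa> y = \<kappa> x"
  obtains w where "x < w" "w < y" "adj (\<kappa> w) (\<kappa> x)"
proof -
  obtain z where z: "x < z" "z \<le> y" "\<kappa> z = \<kappa> x" "\<forall>w. x < w \<and> w < z \<longrightarrow> \<kappa> w \<noteq> \<kappa> x"
    using next_same_color[OF assms] by blast
  have "card {w. x < w \<and> w < z \<and> adj (\<kappa> w) (\<kappa> z)} = 2"
    using z by (intro two_between) auto
  then have "{w. x < w \<and> w < z \<and> adj (\<kappa> w) (\<kappa> z)} \<noteq> {}" by (metis card.empty zero_neq_numeral)
  then show ?thesis using z that by (auto intro: order_less_le_trans)
qed

lemma addable_unique: "x \<in> addable \<kappa> a I \<Longrightarrow> addable \<kappa> a I = {x}"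
  using same_color_comparable by (fastforce simp: addable_def order.order_iff_strict)

section \<open>Removing an element of a given color from an ideal\<close>

text \<open>Functions below live on arbitrary sets. Demanding that both \<open>I\<close> and
  \<open>I - {x}\<close> are downsets makes the values of \<open>loc\<close> vanish at sets that are
  not ideals.\<close>

definition removable :: "'c \<Rightarrow> 'p set \<Rightarrow> 'p set" where
  "removable a I = {x \<in> I. \<kappa> x = a \<and> downset I \<and> downset (I - {x})}"

lemma removable_unique:
  assumes x: "x \<in> removable a I"
  shows "removable a I = {x}"
proof -
  have "y = x" if y: "y \<in> removable a I" for y
    using x y same_color_comparable[of x y] downsetD[of "I - {x}" y x] downsetD[of "I - {y}" x y]
    by (auto simp: removable_def)
  then show ?thesis using x by blast
qed

lemma removable_cases:
  obtains "removable a I = {}" | x where "removable a I = {x}"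
  using removable_unique by blast

lemma removable_color: "x \<in> removable a I \<Longrightarrow> \<kappa> x = a"
  by (simp add: removable_def)

lemma removable_after_removal:
  assumes x: "x \<in> removable a I" and y: "y \<in> removable b (I - {x})"
  shows "\<not> x < y" and "y < x \<Longrightarrow> y < w \<Longrightarrow> \<not> w < x"
proof -
  show "\<not> x < y" using x y downsetD'[of "I - {x}" y x] by (auto simp: removable_def)
  show "\<not> w < x" if "y < x" "y < w"
  proof
    assume "w < x"
    then have "w \<in> I" using x by (auto simp: removable_def intro: downsetD)
    then have "w \<in> I - {x} - {y}" using \<open>w < x\<close> that by auto
    then show False using y downsetD'[of "I - {x} - {y}" w y] that by (auto simp: removable_def)
  qed
qed

text \<open>This is \<open>X\<^sub>a\<close> on coefficient functions, hence read backwards: the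
  coefficient of the image at \<open>I\<close> is that of \<open>g\<close> at the ideal from which
  \<open>I\<close> arises by adding an element of color \<open>a\<close>.\<close>

definition loc :: "'c \<Rightarrow> ('p set \<Rightarrow> complex) \<Rightarrow> 'p set \<Rightarrow> complex" where
  "loc a g I = (if removable a I = {} then 0 else g (I - removable a I))"

text \<open>The second element of color \<open>a\<close> would lie below the first, and
  \<open>adj_between\<close> puts a further element between them that has not been removed.\<close>

lemma loc_loc_same: "loc a (loc a g) I = 0"
proof (rule ccontr)
  assume "loc a (loc a g) I \<noteq> 0"
  then have ne: "removable a I \<noteq> {}" "removable a (I - removable a I) \<noteq> {}"
    by (auto simp: loc_def split: if_splits)
  then obtain x where x: "removable a I = {x}" using removable_cases by metis
  with ne obtain y where y: "y \<in> removable a (I - {x})" by auto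
  have *: "x \<in> removable a I" using x by simp
  have "y \<noteq> x" using y by (auto simp: removable_def)
  moreover have "\<kappa> x = \<kappa> y" using * y by (simp add: removable_color)
  ultimately have "y < x" using removable_after_removal(1)[OF * y] same_color_comparable
    by (metis order.order_iff_strict)
  then show False using adj_between removable_after_removal(2)[OF * y] \<open>\<kappa> x = \<kappa> y\<close> by metis
qed

text \<open>The two removed elements of color \<open>a\<close> would be consecutive in their color
  with only \<open>y\<close> between them, whereas (ICE2) demands two elements of adjacent color
  there.\<close>

lemma loc_loc_loc_adj:
  assumes "adj a b"
  shows "loc a (loc b (loc a g)) I = 0"
proof (rule ccontr)
  assume "loc a (loc b (loc a g)) I \<noteq> 0"
  then have ne: "removable a I \<noteq> {}" "removable b (I - removable a I) \<noteq> {}"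
      "removable a (I - removable a I - removable b (I - removable a I)) \<noteq> {}"
    by (auto simp: loc_def split: if_splits)
  then obtain x where x: "removable a I = {x}" using removable_cases by metis
  with ne obtain y where y: "removable b (I - {x}) = {y}" using removable_cases by metis
  with ne x obtain z where z: "z \<in> removable a (I - {x} - {y})" by auto
  have x': "x \<in> removable a I" and y': "y \<in> removable b (I - {x})" using x y by auto
  note d = x'[unfolded removable_def] y'[unfolded removable_def] z[unfolded removable_def]
  have col: "\<kappa> x = a" "\<kappa> z = a" "\<kappa> y = b" using d by auto
  have "z \<noteq> x" "z \<in> I - {x}" using d by auto
  then have "\<not> x < z" using d downsetD'[of "I - {x}" z x] by auto
  then have "z < x" using col \<open>z \<noteq> x\<close> same_color_comparable by (metis order.order_iff_strict)
  have only: "w = y" if "z < w" "w < x" for w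
  proof (rule ccontr)
    assume "w \<noteq> y"
    have "w \<in> I" using d that downsetD[of I x w] by auto
    then have "w \<in> I - {x} - {y} - {z}" using that \<open>w \<noteq> y\<close> by auto
    then show False using d downsetD'[of "I - {x} - {y} - {z}" w z] that by auto
  qed
  have "card {w. z < w \<and> w < x \<and> adj (\<kappa> w) (\<kappa> x)} = 2"
    using \<open>z < x\<close> only col assms by (intro two_between) auto
  moreover have "{w. z < w \<and> w < x \<and> adj (\<kappa> w) (\<kappa> x)} \<subseteq> {y}" using only by auto
  then have "card {w. z < w \<and> w < x \<and> adj (\<kappa> w) (\<kappa> x)} \<le> 1" by (metis card_mono card.empty card.insert empty_iff finite.emptyI finite.insertI One_nat_def)
  ultimately show False by simp
qed

text \<open>If \<open>y\<close> became removable only through the removal of \<open>x\<close>, it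
  would be covered by \<open>x\<close>, and (NA) would make the two colors adjacent.\<close>

lemma removable_commute:
  assumes ab: "a \<noteq> b" "\<not> adj a b" and "removable a I \<noteq> {}" "removable b (I - removable a I) \<noteq> {}"
  shows "removable b I = removable b (I - removable a I)"
    and "removable a (I - removable b I) = removable a I"
proof -
  obtain x where x: "removable a I = {x}" using assms(3) removable_cases by metis
  then obtain y where y: "removable b (I - {x}) = {y}" using assms(4) removable_cases by metis
  have x': "x \<in> removable a I" and y': "y \<in> removable b (I - {x})" using x y by auto
  note d = x'[unfolded removable_def] y'[unfolded removable_def]
  have "\<not> y < x"
  proof
    assume "y < x"
    then have "covered_by y x" using removable_after_removal(2)[OF x' y'] by (auto simp: covered_by_def)
    then have "adj (\<kappa> y) (\<kappa> x)" by (rule covered_by_adj)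
    then show False using d ab adj_sym by auto
  qed
  have "downset (I - {y})"
    unfolding downset_def
  proof (intro ballI allI impI)
    fix w t assume w: "w \<in> I - {y}" "t \<le> w"
    show "t \<in> I - {y}"
    proof (cases "w = x")
      case True
      then show ?thesis using w d \<open>\<not> y < x\<close> downsetD[of I x t] by (auto simp: order.order_iff_strict)
    next
      case False
      then have "w \<in> I - {x} - {y}" using w by auto
      then show ?thesis using w d downsetD[of "I - {x} - {y}" w t] by auto
    qed
  qed
  then have "y \<in> removable b I" using d by (auto simp: removable_def)
  then have yI: "removable b I = {y}" by (rule removable_unique)
  then show "removable b I = removable b (I - removable a I)" using x y by simp
  have "I - {y} - {x} = I - {x} - {y}" by auto
  then have "x \<in> removable a (I - {y})" using d ab \<open>downset (I - {y})\<close> by (auto simp: removable_def)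
  then show "removable a (I - removable b I) = removable a I"
    using removable_unique x yI by metis
qed

lemma loc_commute:
  assumes "a \<noteq> b" "\<not> adj a b"
  shows "loc a (loc b g) I = loc b (loc a g) I"
proof -
  have "\<not> adj b a" using assms adj_sym by blast
  then have "(removable a I \<noteq> {} \<and> removable b (I - removable a I) \<noteq> {}) \<longleftrightarrow>
        (removable b I \<noteq> {} \<and> removable a (I - removable b I) \<noteq> {})"
    using removable_commute[of a b I] removable_commute[of b a I] assms by metis
  moreover have "I - removable a I - removable b (I - removable a I) = I - removable b I - removable a (I - removable b I)"
    if "removable a I \<noteq> {}" "removable b (I - removable a I) \<noteq> {}"
    using removable_commute[of a b I] that assms by auto
  ultimately show ?thesis unfolding loc_def by auto
qed

end

section \<open>Linear operators on complex functions\<close>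

definition fscale :: "complex \<Rightarrow> ('t \<Rightarrow> complex) \<Rightarrow> 't \<Rightarrow> complex" where
  "fscale r f = (\<lambda>T. r * f T)"

lemma fscale_apply [simp]: "fscale r f T = r * f T"
  by (simp add: fscale_def)

interpretation fv: vector_space fscale
  by unfold_locales (auto simp: fscale_def algebra_simps)

lemma minus_fun_apply' [simp]: "(f - g) x = f x - (g x :: complex)"
  by (simp add: fun_diff_def)

lemma sum_fun_apply [simp]: "(\<Sum>a\<in>A. f a) x = (\<Sum>a\<in>A. (f a x :: complex))"
  by (induction A rule: infinite_finite_induct) auto

definition flinear :: "(('t \<Rightarrow> complex) \<Rightarrow> 's \<Rightarrow> complex) \<Rightarrow> bool" where
  "flinear F \<longleftrightarrow> (\<forall>f g. F (f + g) = F f + F g) \<and> (\<forall>r f. F (fscale r f) = fscale r (F f))"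

lemma flinear_add: "flinear F \<Longrightarrow> F (f + g) = F f + F g"
  and flinear_scale: "flinear F \<Longrightarrow> F (fscale r f) = fscale r (F f)"
  by (auto simp: flinear_def)

lemma flinear_0: "flinear F \<Longrightarrow> F 0 = 0"
  using flinear_scale[of F 0 0] by (simp add: fscale_def fun_eq_iff zero_fun_def)

lemma flinear_diff: "flinear F \<Longrightarrow> F (f - g) = F f - F g"
  using flinear_add[of F "f - g" g] by (simp add: algebra_simps)

lemma flinear_sum: "flinear F \<Longrightarrow> F (\<Sum>a\<in>A. f a) = (\<Sum>a\<in>A. F (f a))"
proof (induction A rule: infinite_finite_induct)
  case (insert x A)
  then show ?case using flinear_add[of F] sum.insert by metis
next
  case (infinite A)
  then show ?case using flinear_0[of F] sum.infinite by metis
next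
  case empty
  then show ?case using flinear_0[of F] sum.empty by metis
qed

lemma flinear_funpow:
  fixes F :: "('t \<Rightarrow> complex) \<Rightarrow> 't \<Rightarrow> complex"
  shows "flinear F \<Longrightarrow> flinear (F ^^ n)"
  by (induction n) (auto simp: flinear_def)

lemma flinear_span:
  assumes "flinear F" "fv.subspace V" "\<And>g. g \<in> G \<Longrightarrow> F g \<in> V" "f \<in> fv.span G"
  shows "F f \<in> V"
  using assms(4)
proof (induction rule: fv.span_induct_alt)
  case base
  then show ?case using assms(2) flinear_0[OF assms(1)] fv.subspace_0 by metis
next
  case (step c x y)
  then have "fscale c (F x) + F y \<in> V"
    using assms(2,3) by (intro fv.subspace_add fv.subspace_scale)
  then show ?case using flinear_add[OF assms(1)] flinear_scale[OF assms(1)] by metis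
qed

text \<open>The coefficients are indexed by \<open>A\<close> and not by the image, so that
  \<open>g\<close> need not be injective.\<close>

lemma span_image_sum:
  assumes "finite A" "f \<in> fv.span (g ` A)"
  obtains r where "f = (\<Sum>a\<in>A. fscale (r a) (g a))"
proof -
  let ?V = "{\<Sum>a\<in>A. fscale (r a) (g a) | r. True}"
  have "fv.subspace ?V"
  proof (rule fv.subspaceI)
    show "0 \<in> ?V" by (auto intro!: exI[of _ "\<lambda>_. 0"])
    show "x + y \<in> ?V" if "x \<in> ?V" "y \<in> ?V" for x y
    proof -
      from that obtain r s where "x = (\<Sum>a\<in>A. fscale (r a) (g a))" "y = (\<Sum>a\<in>A. fscale (s a) (g a))" by auto
      then show ?thesis
        by (auto intro!: exI[of _ "\<lambda>a. r a + s a"] simp: fv.scale_left_distrib sum.distrib)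
    qed
    show "fscale c x \<in> ?V" if "x \<in> ?V" for c x
    proof -
      from that obtain r where "x = (\<Sum>a\<in>A. fscale (r a) (g a))" by auto
      then show ?thesis
        by (auto intro!: exI[of _ "\<lambda>a. c * r a"] simp: fv.scale_sum_right)
    qed
  qed
  moreover have "g ` A \<subseteq> ?V"
  proof
    fix x assume "x \<in> g ` A"
    then obtain b where b: "b \<in> A" "x = g b" by auto
    have "(\<Sum>a\<in>A. fscale (if a = b then 1 else 0) (g a)) = (\<Sum>a\<in>A. if a = b then g a else 0)"
      by (intro sum.cong) auto
    then show "x \<in> ?V" using b assms(1) by (auto intro!: exI[of _ "\<lambda>a. if a = b then 1 else 0"])
  qed
  ultimately have "f \<in> ?V" using fv.span_minimal assms(2) by blast
  with that show ?thesis by blast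
qed

lemma funpow_commute:
  assumes "\<And>f. F (G f) = G (F f)"
  shows "(F ^^ i) ((G ^^ j) f) = (G ^^ j) ((F ^^ i) f)"
proof -
  have "F ((G ^^ j) f) = (G ^^ j) (F f)" for f
    by (induction j) (auto simp: assms)
  then show ?thesis by (induction i) auto
qed

section \<open>Two operators subject to the Serre relations of type \<open>A\<^sub>2\<close>\<close>

text \<open>\<open>E\<close> is the commutator of \<open>C\<close> and \<open>B\<close>; that it
  commutes with both is the pair of Serre relations for adjacent colors.\<close>

locale serre_pair =
  fixes B C E :: "('t \<Rightarrow> complex) \<Rightarrow> 't \<Rightarrow> complex"
  assumes lin_B: "flinear B" and lin_C: "flinear C" and lin_E: "flinear E"
    and comm: "\<And>f. C (B f) = B (C f) + E f"
    and CE: "\<And>f. C (E f) = E (C f)" and BE: "\<And>f. B (E f) = E (B f)"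
begin

lemma C_B_power: "C ((B ^^ Suc n) f) = (B ^^ Suc n) (C f) + fscale (of_nat (Suc n)) ((B ^^ n) (E f))"
proof (induction n)
  case 0
  then show ?case by (simp add: comm)
next
  case (Suc n)
  have "E ((B ^^ Suc n) f) = (B ^^ Suc n) (E f)"
    using funpow_commute[of E B 1 "Suc n" f] BE by simp
  then have "C ((B ^^ Suc (Suc n)) f) = B (C ((B ^^ Suc n) f)) + (B ^^ Suc n) (E f)"
    using comm[of "(B ^^ Suc n) f"] by simp
  also have "\<dots> = (B ^^ Suc (Suc n)) (C f) + fscale (of_nat (Suc n)) ((B ^^ Suc n) (E f)) + (B ^^ Suc n) (E f)"
    by (subst Suc.IH) (simp add: flinear_add[OF lin_B] flinear_scale[OF lin_B])
  finally show ?case by (simp add: fun_eq_iff algebra_simps)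
qed

text \<open>The relations are symmetric up to the sign of the commutator, so
  \<open>C_B_power\<close> also yields its mirror image \<open>B_C_power\<close>.\<close>

lemma swapped: "serre_pair C B (\<lambda>f. - E f)"
proof
  show "flinear (\<lambda>f. - E f)" using lin_E by (auto simp: flinear_def fun_eq_iff)
  have neg: "flinear F \<Longrightarrow> F (- f) = - F f" for F :: "('t \<Rightarrow> complex) \<Rightarrow> 't \<Rightarrow> complex" and f
    using flinear_diff[of F 0 f] flinear_0[of F] by simp
  show "B (- E f) = - E (B f)" "C (- E f) = - E (C f)" for f
    using neg[OF lin_B] neg[OF lin_C] BE CE by auto
qed (use lin_B lin_C comm in \<open>auto\<close>)

lemma B_C_power: "B ((C ^^ Suc n) f) = (C ^^ Suc n) (B f) - fscale (of_nat (Suc n)) ((C ^^ n) (E f))"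
proof -
  have "flinear (C ^^ n)" using lin_C by (rule flinear_funpow)
  then have "(C ^^ n) (- E f) = - (C ^^ n) (E f)"
    using flinear_diff[of "C ^^ n" 0 "E f"] flinear_0[of "C ^^ n"] by simp
  then show ?thesis using serre_pair.C_B_power[OF swapped, of n f] by simp
qed

text \<open>This exchange relation expresses that the products \<open>b\<^sup>i c\<^sup>N b\<^sup>l\<close> span the positive part of the
  enveloping algebra of type \<open>A\<^sub>2\<close>.\<close>

lemma C_B_C_exchange:
  "fscale (of_nat (Suc j)) (C ((B ^^ Suc n) ((C ^^ j) g))) =
     fscale (of_nat (Suc j) - of_nat (Suc n)) ((B ^^ Suc n) ((C ^^ Suc j) g)) +
     fscale (of_nat (Suc n)) ((B ^^ n) ((C ^^ Suc j) (B g)))"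
proof -
  have 1: "C ((B ^^ Suc n) ((C ^^ j) g)) =
      (B ^^ Suc n) ((C ^^ Suc j) g) + fscale (of_nat (Suc n)) ((B ^^ n) (E ((C ^^ j) g)))"
    using C_B_power[of n "(C ^^ j) g"] by simp
  have 2: "E ((C ^^ j) g) = (C ^^ j) (E g)"
    using funpow_commute[of E C 1 j g] CE by simp
  have lin: "flinear (B ^^ n)" using lin_B by (rule flinear_funpow)
  \<comment> \<open>The commutator is eliminated by solving \<open>B_C_power\<close> for it; this is
    what raises the exponent of \<open>C\<close> to \<open>Suc j\<close> in both remaining
    terms.\<close>
  have "fscale (of_nat (Suc j)) ((C ^^ j) (E g)) = (C ^^ Suc j) (B g) - B ((C ^^ Suc j) g)"
    using B_C_power[of j g] by (simp add: algebra_simps)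
  then have "fscale (of_nat (Suc j)) ((B ^^ n) ((C ^^ j) (E g))) =
      (B ^^ n) ((C ^^ Suc j) (B g)) - (B ^^ n) (B ((C ^^ Suc j) g))"
    using flinear_scale[OF lin] flinear_diff[OF lin] by metis
  then have 3: "of_nat (Suc j) * (B ^^ n) ((C ^^ j) (E g)) T =
      (B ^^ n) ((C ^^ Suc j) (B g)) T - (B ^^ Suc n) ((C ^^ Suc j) g) T" for T
    by (simp only: fun_eq_iff fscale_apply minus_fun_apply' funpow_Suc_right o_apply)
  show ?thesis
  proof
    fix T
    have "of_nat (Suc j) * C ((B ^^ Suc n) ((C ^^ j) g)) T =
       of_nat (Suc j) * (B ^^ Suc n) ((C ^^ Suc j) g) T
        + of_nat (Suc n) * (of_nat (Suc j) * (B ^^ n) ((C ^^ j) (E g)) T)"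
      by (simp only: 1 2 plus_fun_apply fscale_apply) (simp only: distrib_left mult.assoc mult.left_commute)
    then show "fscale (of_nat (Suc j)) (C ((B ^^ Suc n) ((C ^^ j) g))) T =
      (fscale (of_nat (Suc j) - of_nat (Suc n)) ((B ^^ Suc n) ((C ^^ Suc j) g)) +
       fscale (of_nat (Suc n)) ((B ^^ n) ((C ^^ Suc j) (B g)))) T"
      unfolding 3 by (simp only: plus_fun_apply fscale_apply ring_distribs) simp
  qed
qed

text \<open>With \<open>e = [c, b]\<close>, the span of the vectors \<open>b\<^bsup>r-i\<^esup> e\<^sup>i g\<close> for \<open>i \<le> r\<close> is stable under \<open>c\<close>, and by
  induction on \<open>i\<close> it lies in the span on the right.\<close>

lemma C_power_B_power:
  assumes V: "fv.subspace V" "\<And>g. g \<in> V \<Longrightarrow> C g \<in> V" and g: "g \<in> V"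
  shows "(C ^^ q) ((B ^^ r) g) \<in> fv.span {(C ^^ s) ((B ^^ r) h) | s h. s \<le> r \<and> h \<in> V}"
proof -
  define Z where "Z i = fv.span {(C ^^ s) ((B ^^ r) h) | s h. s \<le> i \<and> h \<in> V}" for i
  have Zmono: "Z i \<subseteq> Z j" if "i \<le> j" for i j
    unfolding Z_def by (rule fv.span_mono) (use that in force)
  have CZ: "C f \<in> Z (Suc i)" if "f \<in> Z i" for f i
  proof (rule flinear_span[OF lin_C _ _ that[unfolded Z_def]])
    show "fv.subspace (Z (Suc i))" by (simp add: Z_def)
    show "C f \<in> Z (Suc i)" if f: "f \<in> {(C ^^ s) ((B ^^ r) h) | s h. s \<le> i \<and> h \<in> V}" for f
    proof -
      from f obtain s h where "f = (C ^^ s) ((B ^^ r) h)" "s \<le> i" "h \<in> V" by auto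
      then have "C f = (C ^^ Suc s) ((B ^^ r) h)" "Suc s \<le> Suc i" by auto
      then show ?thesis unfolding Z_def using \<open>h \<in> V\<close> by (intro fv.span_base) blast
    qed
  qed
  have CEi: "C ((E ^^ i) g) = (E ^^ i) (C g)" for i g
    using funpow_commute[of C E 1 i g] CE by simp
  have a: "(B ^^ (r - i)) ((E ^^ i) g) \<in> Z i" if "i \<le> r" "g \<in> V" for i g
    using that
  proof (induction i arbitrary: g)
    case 0
    then have "(B ^^ r) g = (C ^^ 0) ((B ^^ r) g)" by simp
    with 0 show ?case unfolding Z_def by (intro fv.span_base) (auto intro!: exI[of _ "0::nat"])
  next
    case (Suc i)
    define k where "k = r - Suc i"
    have k: "r - i = Suc k" using Suc.prems k_def by simp
    have IH: "(B ^^ Suc k) ((E ^^ i) g) \<in> Z i" if "g \<in> V" for g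
      using Suc.IH[OF _ that] Suc.prems k by simp
    have "C ((B ^^ Suc k) ((E ^^ i) g)) =
        (B ^^ Suc k) ((E ^^ i) (C g)) + fscale (of_nat (Suc k)) ((B ^^ k) ((E ^^ Suc i) g))"
      using C_B_power[of k "(E ^^ i) g"] CEi by simp
    then have eq: "fscale (of_nat (Suc k)) ((B ^^ k) ((E ^^ Suc i) g)) =
        C ((B ^^ Suc k) ((E ^^ i) g)) - (B ^^ Suc k) ((E ^^ i) (C g))"
      by (simp add: algebra_simps)
    have "fscale (of_nat (Suc k)) ((B ^^ k) ((E ^^ Suc i) g)) \<in> Z (Suc i)"
      unfolding eq using CZ[OF IH[OF Suc.prems(2)]] IH[OF V(2)[OF Suc.prems(2)]] Zmono[of i "Suc i"]
      unfolding Z_def by (intro fv.span_diff) auto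
    then have "fscale (1 / of_nat (Suc k)) (fscale (of_nat (Suc k)) ((B ^^ k) ((E ^^ Suc i) g))) \<in> Z (Suc i)"
      unfolding Z_def by (rule fv.span_scale)
    then show ?case by (simp only: fv.scale_scale k_def[symmetric]) (simp del: of_nat_Suc)
  qed
  \<comment> \<open>By \<open>C_B_power\<close>, \<open>C\<close> maps the generator with index
    \<open>i\<close> to generators with indices \<open>i\<close> and \<open>i + 1\<close>; at
    \<open>i = r\<close> no \<open>B\<close> is left and \<open>C\<close> passes through to
    \<open>g\<close>.\<close>
  define Y where "Y = fv.span {(B ^^ (r - i)) ((E ^^ i) g) | i g. i \<le> r \<and> g \<in> V}"
  have CY: "C f \<in> Y" if "f \<in> Y" for f
  proof (rule flinear_span[OF lin_C _ _ that[unfolded Y_def]])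
    show "fv.subspace Y" by (simp add: Y_def)
    show "C f \<in> Y" if f: "f \<in> {(B ^^ (r - i)) ((E ^^ i) g) | i g. i \<le> r \<and> g \<in> V}" for f
    proof -
      from f obtain i g where ig: "f = (B ^^ (r - i)) ((E ^^ i) g)" "i \<le> r" "g \<in> V" by auto
      have base: "(B ^^ (r - i)) ((E ^^ i) g) \<in> Y" if "i \<le> r" "g \<in> V" for i g
        unfolding Y_def using that by (intro fv.span_base) auto
      show ?thesis
      proof (cases "r - i")
        case 0
        then show ?thesis using ig base[of i "C g"] V by (simp add: CEi)
      next
        case (Suc k)
        have "r - Suc i = k" "Suc i \<le> r" using Suc by auto
        then have "fscale (of_nat (Suc k)) ((B ^^ k) ((E ^^ Suc i) g)) \<in> Y"
          using base[of "Suc i" g] ig unfolding Y_def by (intro fv.span_scale) auto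
        moreover have "(B ^^ Suc k) ((E ^^ i) (C g)) \<in> Y" using base[of i "C g"] ig V Suc by simp
        ultimately have "(B ^^ Suc k) ((E ^^ i) (C g)) + fscale (of_nat (Suc k)) ((B ^^ k) ((E ^^ Suc i) g)) \<in> Y"
          unfolding Y_def by (intro fv.span_add)
        then show ?thesis using C_B_power[of k "(E ^^ i) g"] CEi ig Suc by simp
      qed
    qed
  qed
  have "(B ^^ r) g \<in> Y"
    unfolding Y_def using g by (intro fv.span_base) (auto intro!: exI[of _ "0::nat"])
  then have "(C ^^ q) ((B ^^ r) g) \<in> Y" by (induction q) (auto simp: CY)
  moreover have "Y \<subseteq> Z r"
    unfolding Y_def
  proof (rule fv.span_minimal)
    show "{(B ^^ (r - i)) ((E ^^ i) g) | i g. i \<le> r \<and> g \<in> V} \<subseteq> Z r"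
      using a Zmono by blast
    show "fv.subspace (Z r)" by (simp add: Z_def)
  qed
  ultimately show ?thesis unfolding Z_def by auto
qed

end

context colored_dc
begin

section \<open>The operators on functions of tuples of ideals\<close>

definition slot :: "nat \<Rightarrow> 'c \<Rightarrow> ((nat \<Rightarrow> 'p set) \<Rightarrow> complex) \<Rightarrow> (nat \<Rightarrow> 'p set) \<Rightarrow> complex" where
  "slot j a f T = loc a (\<lambda>I. f (T(j := I))) (T j)"

definition tX :: "'c \<Rightarrow> ((nat \<Rightarrow> 'p set) \<Rightarrow> complex) \<Rightarrow> (nat \<Rightarrow> 'p set) \<Rightarrow> complex" where
  "tX a f = (\<Sum>j<m. slot j a f)"

lemma flinear_slot: "flinear (slot j a)"
  by (auto simp: flinear_def slot_def loc_def fun_eq_iff)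

lemma flinear_tX: "flinear (tX a)"
  unfolding flinear_def tX_def
  using flinear_add[OF flinear_slot] flinear_scale[OF flinear_slot]
  by (simp add: sum.distrib fv.scale_sum_right)

lemma slot_slot: "slot j a (slot j b f) T = loc a (loc b (\<lambda>I. f (T(j := I)))) (T j)"
  by (simp add: slot_def loc_def)

lemma slot_slot_slot: "slot j a (slot j b (slot j c f)) T = loc a (loc b (loc c (\<lambda>I. f (T(j := I))))) (T j)"
  by (simp add: slot_def loc_def)

lemma slot_commute: "i \<noteq> j \<Longrightarrow> slot i a (slot j b f) = slot j b (slot i a f)"
  by (auto simp: slot_def loc_def fun_eq_iff fun_upd_twist)

lemma tX_tX: "tX a (tX b f) = (\<Sum>i<m. \<Sum>j<m. slot i a (slot j b f))"
  by (simp only: tX_def flinear_sum[OF flinear_slot])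

lemma tX_commute:
  assumes "a \<noteq> b" "\<not> adj a b"
  shows "tX a (tX b f) = tX b (tX a f)"
proof -
  have "slot i a (slot j b f) = slot j b (slot i a f)" for i j
    by (cases "i = j") (auto simp: slot_commute slot_slot loc_commute[OF assms] fun_eq_iff)
  then show ?thesis
    by (simp only: tX_tX) (subst sum.swap, simp)
qed

definition bracket_slot where
  "bracket_slot c b j f = slot j c (slot j b f) - slot j b (slot j c f)"

definition tE where
  "tE c b f = (\<Sum>j<m. bracket_slot c b j f)"

lemma flinear_bracket_slot: "flinear (bracket_slot c b j)"
  unfolding flinear_def bracket_slot_def
  using flinear_add[OF flinear_slot] flinear_scale[OF flinear_slot]
  by (simp add: algebra_simps fv.scale_right_diff_distrib)

lemma flinear_tE: "flinear (tE c b)"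
  unfolding flinear_def tE_def
  using flinear_add[OF flinear_bracket_slot] flinear_scale[OF flinear_bracket_slot]
  by (simp add: sum.distrib fv.scale_sum_right)

text \<open>Operators in different slots commute, so only the diagonal of the two double sums
  survives in the difference.\<close>

lemma tX_tX_bracket: "tX c (tX b f) = tX b (tX c f) + tE c b f"
proof -
  have "tX c (tX b f) - tX b (tX c f) = (\<Sum>i<m. \<Sum>j<m. slot i c (slot j b f) - slot j b (slot i c f))"
    by (simp only: tX_tX sum_subtractf) (subst (2) sum.swap, rule refl)
  also have "\<dots> = (\<Sum>i<m. \<Sum>j<m. if j = i then bracket_slot c b i f else 0)"
    by (intro sum.cong refl) (auto simp: bracket_slot_def slot_commute)
  also have "\<dots> = tE c b f"
    unfolding tE_def by (intro sum.cong refl, subst sum.delta) auto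
  finally show ?thesis by (simp add: algebra_simps)
qed

text \<open>Within one slot both sides vanish: expanding the commutator leaves only products that
  repeat a color side by side or alternate as \<open>c b c\<close> or \<open>b c b\<close>.\<close>

lemma slot_bracket_slot_commute:
  assumes "adj c b" "d = c \<or> d = b"
  shows "slot i d (bracket_slot c b j f) = bracket_slot c b j (slot i d f)"
proof (cases "i = j")
  case False
  then have "slot i d (slot j x (slot j y f)) = slot j x (slot j y (slot i d f))" for x y
    using slot_commute[OF False] by metis
  then show ?thesis by (simp only: bracket_slot_def flinear_diff[OF flinear_slot])
next
  case [simp]: True
  have sq: "slot j x (slot j x g) = 0" for x g
    by (simp add: fun_eq_iff slot_slot loc_loc_same)
  have "slot j c (slot j b (slot j c f)) = 0" "slot j b (slot j c (slot j b f)) = 0" for f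
    using assms(1) adj_sym[OF assms(1)] by (simp_all add: fun_eq_iff slot_slot_slot loc_loc_loc_adj)
  then show ?thesis
    using assms(2) by (elim disjE)
      (simp_all only: True bracket_slot_def flinear_diff[OF flinear_slot] sq flinear_0[OF flinear_slot])
qed

lemma tX_tE_commute:
  assumes "adj c b" "d = c \<or> d = b"
  shows "tX d (tE c b f) = tE c b (tX d f)"
proof -
  have "tX d (tE c b f) = (\<Sum>i<m. \<Sum>j<m. slot i d (bracket_slot c b j f))"
    by (simp only: tX_def tE_def flinear_sum[OF flinear_slot])
  also have "\<dots> = (\<Sum>i<m. \<Sum>j<m. bracket_slot c b j (slot i d f))"
    by (simp only: slot_bracket_slot_commute[OF assms])
  also have "\<dots> = tE c b (tX d f)"
    by (subst sum.swap) (simp only: tX_def tE_def flinear_sum[OF flinear_bracket_slot])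
  finally show ?thesis .
qed

lemma serre_pair_tX: "adj c b \<Longrightarrow> serre_pair (tX b) (tX c) (tE c b)"
  by unfold_locales (rule flinear_tX flinear_tE tX_tX_bracket tX_tE_commute; simp)+

section \<open>Powers of the operators\<close>

definition slots :: "'c \<Rightarrow> (nat \<Rightarrow> 'p set) \<Rightarrow> nat set" where
  "slots a T = {j. j < m \<and> removable a (T j) \<noteq> {}}"

definition strip :: "'c \<Rightarrow> nat set \<Rightarrow> (nat \<Rightarrow> 'p set) \<Rightarrow> nat \<Rightarrow> 'p set" where
  "strip a S T = (\<lambda>j. if j \<in> S then T j - removable a (T j) else T j)"

lemma finite_slots [simp]: "finite (slots a T)"
  by (simp add: slots_def)

lemma strip_empty [simp]: "strip a {} T = T"
  by (simp add: strip_def)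

lemma removable_again: "removable a (I - removable a I) = {}"
  using loc_loc_same[of a "\<lambda>_. 1" I] by (auto simp: loc_def split: if_splits)

lemma slots_strip: "slots a (strip a {j} T) = slots a T - {j}"
  by (auto simp: slots_def strip_def removable_again)

lemma strip_strip: "j \<notin> S \<Longrightarrow> strip a S (strip a {j} T) = strip a (insert j S) T"
  by (auto simp: strip_def fun_eq_iff)

lemma tX_apply: "tX a f T = (\<Sum>j\<in>slots a T. f (strip a {j} T))"
proof -
  have "tX a f T = (\<Sum>j<m. if removable a (T j) = {} then 0 else f (T(j := T j - removable a (T j))))"
    by (simp add: tX_def slot_def loc_def)
  also have "\<dots> = (\<Sum>j\<in>slots a T. f (T(j := T j - removable a (T j))))"
    unfolding slots_def by (intro sum.mono_neutral_cong_right) auto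
  also have "\<dots> = (\<Sum>j\<in>slots a T. f (strip a {j} T))"
    by (intro sum.cong refl arg_cong[of _ _ f]) (auto simp: strip_def fun_eq_iff)
  finally show ?thesis .
qed

text \<open>The pairs \<open>(S, j)\<close> with \<open>j \<in> S\<close> are counted in two ways;
  the factor is the cardinality of \<open>S\<close>.\<close>

lemma sum_insert_subsets:
  fixes g :: "'a set \<Rightarrow> complex"
  assumes "finite R"
  shows "(\<Sum>j\<in>R. \<Sum>S | S \<subseteq> R - {j} \<and> card S = k. g (insert j S)) =
     of_nat (Suc k) * (\<Sum>S | S \<subseteq> R \<and> card S = Suc k. g S)"
proof -
  have "(\<Sum>j\<in>R. \<Sum>S | S \<subseteq> R - {j} \<and> card S = k. g (insert j S)) =
      (\<Sum>(j, S)\<in>(SIGMA j:R. {S. S \<subseteq> R - {j} \<and> card S = k}). g (insert j S))"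
    using assms by (subst sum.Sigma) auto
  also have "\<dots> = (\<Sum>(S, j)\<in>(SIGMA S:{S. S \<subseteq> R \<and> card S = Suc k}. S). g S)"
  proof (rule sum.reindex_bij_witness[where i = "\<lambda>(S, j). (j, S - {j})" and j = "\<lambda>(j, S). (insert j S, j)"])
    fix p assume p: "p \<in> (SIGMA j:R. {S. S \<subseteq> R - {j} \<and> card S = k})"
    obtain j S where jS: "p = (j, S)" by (cases p)
    then have S: "j \<in> R" "S \<subseteq> R" "j \<notin> S" "card S = k" using p by auto
    then have "card (insert j S) = Suc k" using finite_subset[OF _ assms] by simp
    with S jS show "(case (case p of (j, S) \<Rightarrow> (insert j S, j)) of (S, j) \<Rightarrow> (j, S - {j})) = p"
      "(case p of (j, S) \<Rightarrow> (insert j S, j)) \<in> (SIGMA S:{S. S \<subseteq> R \<and> card S = Suc k}. S)"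
      "(case (case p of (j, S) \<Rightarrow> (insert j S, j)) of (S, j) \<Rightarrow> g S) = (case p of (j, S) \<Rightarrow> g (insert j S))"
      by auto
  next
    fix p assume p: "p \<in> (SIGMA S:{S. S \<subseteq> R \<and> card S = Suc k}. S)"
    obtain S j where jS: "p = (S, j)" by (cases p)
    then have S: "j \<in> S" "S \<subseteq> R" "card S = Suc k" using p by auto
    then have "card (S - {j}) = k" by simp
    with S jS show "(case (case p of (S, j) \<Rightarrow> (j, S - {j})) of (j, S) \<Rightarrow> (insert j S, j)) = p"
      "(case p of (S, j) \<Rightarrow> (j, S - {j})) \<in> (SIGMA j:R. {S. S \<subseteq> R - {j} \<and> card S = k})"
      by auto
  qed
  also have "\<dots> = (\<Sum>S | S \<subseteq> R \<and> card S = Suc k. \<Sum>j\<in>S. g S)"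
    using assms finite_subset by (subst sum.Sigma) auto
  also have "\<dots> = of_nat (Suc k) * (\<Sum>S | S \<subseteq> R \<and> card S = Suc k. g S)"
    by (simp add: sum_distrib_left)
  finally show ?thesis .
qed

text \<open>A slot stripped once has nothing of color \<open>a\<close> left to strip
  (\<open>removable_again\<close>), so the \<open>k\<close> applications use \<open>k\<close>
  distinct slots, in \<open>fact k\<close> orders. Dividing by \<open>fact k\<close> therefore
  leaves integer coefficients.\<close>

lemma tX_power_apply:
  "(tX a ^^ k) f T = fact k * (\<Sum>S | S \<subseteq> slots a T \<and> card S = k. f (strip a S T))"
proof (induction k arbitrary: T)
  case 0
  have "S = {}" if "S \<subseteq> slots a T" "card S = 0" for S
    using that finite_subset[OF that(1)] by simp
  then have "{S. S \<subseteq> slots a T \<and> card S = 0} = {{}}" by auto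
  then show ?case by simp
next
  case (Suc k)
  have "(tX a ^^ Suc k) f T = (\<Sum>j\<in>slots a T. fact k *
      (\<Sum>S | S \<subseteq> slots a T - {j} \<and> card S = k. f (strip a S (strip a {j} T))))"
    by (simp add: tX_apply Suc.IH slots_strip)
  also have "\<dots> = (\<Sum>j\<in>slots a T. fact k *
      (\<Sum>S | S \<subseteq> slots a T - {j} \<and> card S = k. f (strip a (insert j S) T)))"
    by (intro sum.cong arg_cong2[of _ _ _ _ "(*)"] refl) (subst strip_strip, auto)
  also have "\<dots> = fact k * (of_nat (Suc k) * (\<Sum>S | S \<subseteq> slots a T \<and> card S = Suc k. f (strip a S T)))"
    using sum_insert_subsets[of "slots a T" "\<lambda>S. f (strip a S T)" k]
    by (simp only: sum_distrib_left[symmetric] finite_slots)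
  finally show ?case by simp
qed

lemma card_slots_le: "card (slots a T) \<le> m"
  using card_mono[of "{..<m}" "slots a T"] by (auto simp: slots_def)

lemma tX_power_eq_0: "k > m \<Longrightarrow> (tX a ^^ k) f = 0"
proof
  fix T assume "k > m"
  have "card S \<noteq> k" if "S \<subseteq> slots a T" for S
    using card_mono[OF finite_slots that] card_slots_le[of a T] \<open>k > m\<close> by linarith
  then have "{S. S \<subseteq> slots a T \<and> card S = k} = {}" by blast
  then show "(tX a ^^ k) f T = 0 T" by (simp only: tX_power_apply sum.empty mult_zero_right zero_fun_apply)
qed

lemma tX_power_nonzeroE:
  assumes "(tX a ^^ k) f T \<noteq> 0"
  obtains S where "S \<subseteq> slots a T" "card S = k" "f (strip a S T) \<noteq> 0"
proof -
  have "(\<Sum>S | S \<subseteq> slots a T \<and> card S = k. f (strip a S T)) \<noteq> 0"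
    using assms by (simp add: tX_power_apply)
  then obtain S where "S \<in> {S. S \<subseteq> slots a T \<and> card S = k}" "f (strip a S T) \<noteq> 0"
    by (rule sum.not_neutral_contains_not_neutral)
  then show ?thesis using that by blast
qed

lemma strip_slotE:
  assumes "j \<in> S" "S \<subseteq> slots a T"
  obtains x where "removable a (T j) = {x}" "T j = insert x (strip a S T j)" "x \<notin> strip a S T j"
    "\<kappa> x = a" "downset (T j)" "downset (strip a S T j)"
proof -
  have "removable a (T j) \<noteq> {}" using assms by (auto simp: slots_def)
  then obtain x where x: "removable a (T j) = {x}" using removable_cases by metis
  then have x': "x \<in> T j" "\<kappa> x = a" "downset (T j)" "downset (T j - {x})"
    unfolding removable_def by blast+
  have eq: "strip a S T j = T j - {x}" using assms x by (simp add: strip_def)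
  have ins: "T j = insert x (T j - {x})" "x \<notin> T j - {x}" using x' by auto
  show ?thesis using that[OF x, unfolded eq, OF ins x'(2-4)] .
qed

section \<open>Words attached to ideals\<close>

text \<open>Coordinates from \<open>m\<close> on are left free, since no operator looks at
  them.\<close>

definition vac :: "(nat \<Rightarrow> 'p set) \<Rightarrow> complex" where
  "vac T = (if \<forall>j<m. T j = {} then 1 else 0)"

text \<open>The powers are not divided here. This changes each word by a nonzero factor only, hence
  not the complex spans.\<close>

definition ideal_word :: "'p set \<Rightarrow> ('p \<Rightarrow> nat) \<Rightarrow> (nat \<Rightarrow> 'p set) \<Rightarrow> complex" where
  "ideal_word I n = fold (\<lambda>x. tX (\<kappa> x) ^^ n x) (filter (\<lambda>x. x \<in> I) ext) vac"

lemma ext_distinct: "distinct ext" and ext_set: "set ext = UNIV"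
  using ext by (auto simp: linear_extension_def total_enum_def)

lemma ext_sorted: "sorted_wrt (\<lambda>x y. \<not> y < x) ext"
  unfolding sorted_wrt_iff_nth_less
proof (intro allI impI notI)
  fix i j assume ij: "i < j" "j < length ext" "ext ! j < ext ! i"
  then have "(ext ! j, ext ! i) \<in> enum_less ext" using ext by (auto simp: linear_extension_def)
  then obtain k l where "ext ! k = ext ! j" "ext ! l = ext ! i" "k < l" "l < length ext"
    by (auto simp: enum_less_def)
  then have "k = j" "l = i" using ij nth_eq_iff_index_eq[OF ext_distinct] by simp_all
  then show False using ij \<open>k < l\<close> by simp
qed

lemma ext_order: "ext = xs @ y # ys \<Longrightarrow> z \<in> set ys \<Longrightarrow> \<not> z < y"
  using ext_sorted by (auto simp: sorted_wrt_append)

lemma ideal_word_empty: "ideal_word {} n = vac"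
  by (simp add: ideal_word_def)

lemma ideal_word_cong: "(\<And>x. x \<in> I \<Longrightarrow> n x = n' x) \<Longrightarrow> ideal_word I n = ideal_word I n'"
  unfolding ideal_word_def by (intro fold_cong refl) auto

lemma incomparable_tX_commute:
  assumes "\<not> x \<le> y" "\<not> y \<le> x"
  shows "(tX (\<kappa> x) ^^ i) ((tX (\<kappa> y) ^^ j) f) = (tX (\<kappa> y) ^^ j) ((tX (\<kappa> x) ^^ i) f)"
proof (rule funpow_commute, rule tX_commute)
  show "\<kappa> x \<noteq> \<kappa> y" using same_color_comparable assms by blast
  show "\<not> adj (\<kappa> x) (\<kappa> y)" using adj_color_comparable assms by (auto simp: less_le)
qed

text \<open>Any maximal element may be moved to the end of the word, so the word does not depend on the
  linear extension.\<close>

lemma ideal_word_remove: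
  assumes y: "y \<in> I" "\<forall>x\<in>I. \<not> y < x"
  shows "ideal_word I n = (tX (\<kappa> y) ^^ n y) (ideal_word (I - {y}) n)"
proof -
  obtain xs ys where ext_eq: "ext = xs @ y # ys"
    using ext_set by (metis UNIV_I split_list)
  have y_nin: "y \<notin> set xs" "y \<notin> set ys" using ext_distinct ext_eq by auto
  let ?F = "\<lambda>x. tX (\<kappa> x) ^^ n x"
  have "fold ?F zs (?F y f) = ?F y (fold ?F zs f)" if "\<forall>z\<in>set zs. z \<in> I \<and> z \<in> set ys" for zs f
    using that
  proof (induction zs arbitrary: f)
    case (Cons z zs)
    then have "\<not> z < y" "\<not> y < z" "z \<noteq> y" using ext_order[OF ext_eq] y y_nin by auto
    then have "?F z (?F y f) = ?F y (?F z f)" by (intro incomparable_tX_commute) auto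
    then show ?case using Cons by simp
  qed simp
  then have move: "fold ?F (filter (\<lambda>x. x \<in> I) ys) (?F y f) = ?F y (fold ?F (filter (\<lambda>x. x \<in> I) ys) f)" for f
    by simp
  have "filter (\<lambda>x. x \<in> I - {y}) zs = filter (\<lambda>x. x \<in> I) zs" if "y \<notin> set zs" for zs
    using that by (intro filter_cong) auto
  then have "filter (\<lambda>x. x \<in> I - {y}) ext = filter (\<lambda>x. x \<in> I) xs @ filter (\<lambda>x. x \<in> I) ys"
    using y_nin by (simp only: ext_eq filter_append filter.simps) simp
  moreover have "filter (\<lambda>x. x \<in> I) ext = filter (\<lambda>x. x \<in> I) xs @ y # filter (\<lambda>x. x \<in> I) ys"
    using y(1) by (simp only: ext_eq filter_append filter.simps) simp
  ultimately show ?thesis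
    by (simp only: ideal_word_def fold_append fold_simps o_apply move)
qed

lemma ideal_word_remove_update:
  assumes "y \<in> I" "\<forall>x\<in>I. \<not> y < x"
  shows "(tX (\<kappa> y) ^^ k) (ideal_word (I - {y}) n) = ideal_word I (n(y := k))"
proof -
  have "ideal_word (I - {y}) (n(y := k)) = ideal_word (I - {y}) n" by (rule ideal_word_cong) auto
  then show ?thesis by (simp add: ideal_word_remove[OF assms])
qed

lemma ideal_word_support:
  assumes "downset I" "ideal_word I n T \<noteq> 0" "j < m"
  shows "T j \<subseteq> I"
  using finite[of I] assms
proof (induction "card I" arbitrary: I T)
  case 0
  then show ?case by (auto simp: ideal_word_empty vac_def split: if_splits)
next
  case (Suc k)
  then obtain x where "x \<in> I" by (metis card.empty ex_in_conv nat.distinct(1))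
  then obtain u where u: "u \<in> I" "\<forall>z\<in>I. \<not> u < z" using finite_order_maximal_above by metis
  from Suc.prems ideal_word_remove[OF u] obtain S where
    S: "S \<subseteq> slots (\<kappa> u) T" "ideal_word (I - {u}) n (strip (\<kappa> u) S T) \<noteq> 0"
    using tX_power_nonzeroE by metis
  have down: "downset (I - {u})" using downset_remove_maximal Suc.prems(2) u(2) .
  have sub: "strip (\<kappa> u) S T j \<subseteq> I - {u}"
    using Suc.hyps(1)[OF _ _ down S(2) Suc.prems(4)] Suc.hyps(2) u by simp
  show ?case
  proof (cases "j \<in> S")
    case True
    then obtain x where x: "T j = insert x (strip (\<kappa> u) S T j)" "\<kappa> x = \<kappa> u" "downset (T j)"
      using S(1) by (rule strip_slotE)
    \<comment> \<open>If \<open>x\<close> lay above \<open>u\<close>, the ideal \<open>T j\<close>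
      would contain \<open>u\<close> already before \<open>x\<close> is added, but that smaller
      ideal lies in \<open>I - {u}\<close>.\<close>
    have "u < x \<Longrightarrow> False"
      using x sub downsetD'[of "T j" x u] by auto
    then have "x \<le> u" using same_color_comparable[OF x(2)] by (auto simp: less_le)
    then have "x \<in> I" using Suc.prems(2) u downsetD by blast
    then show ?thesis using x sub by auto
  next
    case False
    then show ?thesis using sub by (auto simp: strip_def)
  qed
qed

definition demazure :: "'p set \<Rightarrow> ((nat \<Rightarrow> 'p set) \<Rightarrow> complex) set" where
  "demazure I = fv.span (range (ideal_word I))"

lemma subspace_demazure [simp]: "fv.subspace (demazure I)"
  by (simp add: demazure_def)

lemma ideal_word_in_demazure: "ideal_word I n \<in> demazure I"
  by (auto simp: demazure_def intro: fv.span_base)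

lemma demazure_power:
  assumes "y \<in> I" "\<forall>x\<in>I. \<not> y < x" "f \<in> demazure (I - {y})"
  shows "(tX (\<kappa> y) ^^ k) f \<in> demazure I"
proof (rule flinear_span[OF flinear_funpow[OF flinear_tX] subspace_demazure])
  show "f \<in> fv.span (range (ideal_word (I - {y})))" using assms by (simp add: demazure_def)
  show "(tX (\<kappa> y) ^^ k) g \<in> demazure I" if "g \<in> range (ideal_word (I - {y}))" for g
    using that ideal_word_remove_update[OF assms(1,2)] ideal_word_in_demazure by auto
qed

text \<open>Vanishing at the fixed tuple \<open>T\<close> is a linear condition, so it suffices to
  test the generating words.\<close>

lemma demazure_support:
  assumes "downset I" "f \<in> demazure I" "f T \<noteq> 0" "j < m"
  shows "T j \<subseteq> I"
proof (rule ccontr)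
  assume "\<not> T j \<subseteq> I"
  let ?V = "{f. f T = (0 :: complex)}"
  have "fv.subspace ?V" by (rule fv.subspaceI) auto
  moreover have "range (ideal_word I) \<subseteq> ?V"
    using ideal_word_support[OF assms(1) _ assms(4)] \<open>\<not> T j \<subseteq> I\<close> by blast
  ultimately have "demazure I \<subseteq> ?V" unfolding demazure_def using fv.span_minimal by blast
  then show False using assms by auto
qed

text \<open>A nonzero coefficient exhibits an ideal obtained from a subset of \<open>I\<close> by
  adding some \<open>x\<close> of color \<open>c\<close>. Everything below \<open>x\<close> is then
  in \<open>I\<close>, so \<open>x\<close> could be added to \<open>I\<close> as well.\<close>

lemma tX_eq_0_if_color_absent:
  assumes I: "downset I" "addable \<kappa> c I = {}" "c \<notin> \<kappa> ` I" and f: "f \<in> demazure I"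
  shows "tX c f = 0"
proof (rule ccontr)
  assume "tX c f \<noteq> 0"
  then obtain T where "tX c f T \<noteq> 0" by (auto simp: fun_eq_iff)
  then have "(tX c ^^ 1) f T \<noteq> 0" by simp
  then obtain S where S: "S \<subseteq> slots c T" "card S = 1" "f (strip c S T) \<noteq> 0"
    by (rule tX_power_nonzeroE)
  then obtain j where "j \<in> S" by (metis card.empty ex_in_conv zero_neq_one)
  then obtain x where x: "T j = insert x (strip c S T j)" "x \<notin> strip c S T j" "\<kappa> x = c" "downset (T j)"
    using S(1) by (rule strip_slotE)
  have "j < m" using \<open>j \<in> S\<close> S(1) by (auto simp: slots_def)
  then have "strip c S T j \<subseteq> I" using demazure_support[OF I(1) f S(3)] by simp
  moreover have "y \<in> strip c S T j" if "y < x" for y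
    using that x downsetD'[of "T j" x y] by auto
  moreover have "x \<notin> I" using I x by auto
  ultimately have "x \<in> addable \<kappa> c I" using x by (auto simp: addable_def)
  then show False using I by simp
qed

section \<open>Stability of the word spaces\<close>

lemma addable_downset_below:
  assumes "downset I" "y \<notin> I" "\<And>u. covered_by u y \<Longrightarrow> u \<in> I"
  shows "y \<in> addable \<kappa> (\<kappa> y) I"
proof -
  have "t \<in> I" if "t < y" for t
  proof -
    obtain u where "covered_by u y" "t \<le> u" using covered_by_below[OF \<open>t < y\<close>] .
    then show ?thesis using assms(3) downsetD[OF assms(1)] by blast
  qed
  then show ?thesis using assms(2) by (simp add: addable_def)
qed

lemma addable_remove:
  assumes "addable \<kappa> c I = {}" "\<kappa> u \<noteq> c"
  shows "addable \<kappa> c (I - {u}) = {}"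
  using assms by (auto simp: addable_def)

text \<open>Two adjacent elements above the last element of color \<open>c\<close> in an ideal would make the next
  element of color \<open>c\<close> addable.\<close>

lemma adj_above_unique:
  assumes I: "downset I" and no: "addable \<kappa> (\<kappa> y) I = {}"
    and y: "y \<in> I" "\<And>x. x \<in> I \<Longrightarrow> \<kappa> x = \<kappa> y \<Longrightarrow> \<not> y < x"
    and u: "u \<in> I" "y < u" "adj (\<kappa> u) (\<kappa> y)"
    and v: "v \<in> I" "y < v" "adj (\<kappa> v) (\<kappa> y)"
  shows "u = v"
proof (rule ccontr)
  assume "u \<noteq> v"
  show False
  proof (cases "\<exists>x>y. \<kappa> x = \<kappa> y")
    case False
    then have "card {w. y < w \<and> adj (\<kappa> w) (\<kappa> y)} \<le> 1" by (intro at_most_one_above) auto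
    moreover have "card {u, v} \<le> card {w. y < w \<and> adj (\<kappa> w) (\<kappa> y)}"
      using u v by (intro card_mono) auto
    ultimately show False using \<open>u \<noteq> v\<close> by simp
  next
    case True
    then obtain z where z: "y < z" "\<kappa> z = \<kappa> y" "\<forall>w. y < w \<and> w < z \<longrightarrow> \<kappa> w \<noteq> \<kappa> y"
      using next_same_color by metis
    then have "z \<notin> I" using y by auto
    have below: "w < z" if "w \<in> I" "adj (\<kappa> w) (\<kappa> y)" for w
      using that adj_color_comparable[of w z] z \<open>z \<notin> I\<close> downsetD'[OF I, of w z] by auto
    have "card {w. y < w \<and> w < z \<and> adj (\<kappa> w) (\<kappa> z)} = 2"
      using z by (intro two_between) auto
    moreover have "{u, v} \<subseteq> {w. y < w \<and> w < z \<and> adj (\<kappa> w) (\<kappa> z)}"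
      using u v below z by auto
    moreover have "card {u, v} = 2" using \<open>u \<noteq> v\<close> by simp
    ultimately have eq: "{u, v} = {w. y < w \<and> w < z \<and> adj (\<kappa> w) (\<kappa> z)}"
      by (intro card_subset_eq) auto
    \<comment> \<open>An element covered by \<open>z\<close> has a color adjacent to that of
      \<open>y\<close>, so it lies above \<open>y\<close> and must be \<open>u\<close> or
      \<open>v\<close>.\<close>
    have "z \<in> addable \<kappa> (\<kappa> z) I"
    proof (rule addable_downset_below[OF I \<open>z \<notin> I\<close>])
      fix t assume t: "covered_by t z"
      then have tz: "adj (\<kappa> t) (\<kappa> z)" "t < z" by (auto simp: covered_by_adj covered_by_def)
      then have "t < y \<or> y < t" using adj_color_comparable[of t y] z by simp
      moreover have "\<not> t < y" using t z by (auto simp: covered_by_def)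
      ultimately have "t \<in> {u, v}" using eq tz by auto
      then show "t \<in> I" using u v by auto
    qed
    then show False using no z by simp
  qed
qed

text \<open>A maximal \<open>u\<close> is split off. If its color is \<open>c\<close>, its exponent
  grows; if its color is neither \<open>c\<close> nor adjacent to \<open>c\<close>, the operator
  passes through it. In the adjacent case the last element \<open>y\<close> of color
  \<open>c\<close> becomes maximal once \<open>u\<close> is gone, and the exchange relation puts
  \<open>c\<close> back to the place of \<open>y\<close>, at the cost of applying the color of
  \<open>u\<close> to the word space of \<open>I - {u, y}\<close>, where the induction hypothesis
  holds.\<close>

lemma demazure_stable:
  assumes "downset I" "addable \<kappa> c I = {}" "f \<in> demazure I"
  shows "tX c f \<in> demazure I"
  using assms
proof (induction "card I" arbitrary: I c f rule: less_induct)
  case less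
  show ?case
  proof (cases "c \<in> \<kappa> ` I")
    case False
    then have "tX c f = 0" using tX_eq_0_if_color_absent less.prems by blast
    then show ?thesis by (simp add: demazure_def fv.span_zero)
  next
    case True
    then obtain x where "x \<in> I" "\<kappa> x = c" by auto
    then obtain u where u: "u \<in> I" "\<forall>z\<in>I. \<not> u < z" using finite_order_maximal_above by metis
    define I' where "I' = I - {u}"
    have I': "downset I'" "card I' < card I"
      using downset_remove_maximal[OF less.prems(1) u(2)] card_Diff1_less[of I u] u by (auto simp: I'_def)
    have "tX c (ideal_word I n) \<in> demazure I" for n
    proof -
      have word: "ideal_word I n = (tX (\<kappa> u) ^^ n u) (ideal_word I' n)"
        unfolding I'_def by (rule ideal_word_remove[OF u])
      have step: "(tX (\<kappa> u) ^^ k) g \<in> demazure I" if "g \<in> demazure I'" for g k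
        using demazure_power[OF u] that by (simp add: I'_def)
      consider "c = \<kappa> u" | "c \<noteq> \<kappa> u" "\<not> adj c (\<kappa> u)" | "adj c (\<kappa> u)" by blast
      then show ?thesis
      proof cases
        case 1
        then have "tX c (ideal_word I n) = (tX (\<kappa> u) ^^ Suc (n u)) (ideal_word I' n)"
          by (simp add: word)
        also have "\<dots> \<in> demazure I"
          by (rule step[OF ideal_word_in_demazure])
        finally show ?thesis .
      next
        case 2
        have "addable \<kappa> c I' = {}" unfolding I'_def using 2 less.prems by (intro addable_remove) auto
        then have "tX c (ideal_word I' n) \<in> demazure I'"
          using less.hyps I' ideal_word_in_demazure by blast
        moreover have "tX c (ideal_word I n) = (tX (\<kappa> u) ^^ n u) (tX c (ideal_word I' n))"
          unfolding word using funpow_commute[of "tX c" "tX (\<kappa> u)" 1 "n u"] tX_commute[OF 2] by simp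
        ultimately show ?thesis using step by simp
      next
        case 3
        then have cu: "c \<noteq> \<kappa> u" by auto
        let ?A = "{x \<in> I. \<kappa> x = c}"
        obtain y where y: "y \<in> ?A" "\<forall>z\<in>?A. \<not> y < z"
          using finite_order_maximal_above[of x ?A] \<open>x \<in> I\<close> \<open>\<kappa> x = c\<close> by auto
        then have [simp]: "\<kappa> y = c" and yI: "y \<in> I" by auto
        have "y < u" using adj_color_comparable[of y u] 3 u yI by auto
        \<comment> \<open>Any other element above \<open>y\<close> would sit over a cover
          \<open>v\<close> of \<open>y\<close>. By \<open>adj_above_unique\<close> this
          \<open>v\<close> is \<open>u\<close>, which has nothing above it in
          \<open>I\<close>.\<close>
        have y_max: "\<not> y < w" if w: "w \<in> I'" for w
        proof
          assume "y < w"
          then obtain v where v: "covered_by y v" "v \<le> w" by (rule covered_by_above)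
          have "w \<in> I" "w \<noteq> u" using w by (auto simp: I'_def)
          then have "v \<in> I" using v less.prems(1) downsetD by blast
          moreover have "adj (\<kappa> v) (\<kappa> y)" "y < v"
            using adj_sym[OF covered_by_adj[OF v(1)]] v(1) by (auto simp: covered_by_def)
          ultimately have "u = v"
            using less.prems y yI u 3 \<open>y < u\<close> adj_sym by (intro adj_above_unique[of I y u v]) auto
          then show False using u \<open>w \<in> I\<close> \<open>w \<noteq> u\<close> v(2) by (auto simp: less_le)
        qed
        define J where "J = I' - {y}"
        have yI': "y \<in> I'" "\<forall>x\<in>I'. \<not> y < x"
          using y_max yI \<open>y < u\<close> by (auto simp: I'_def)
        have J: "downset J" "card J < card I"
          using downset_remove_maximal[OF I'(1) yI'(2)] card_Diff1_less[of I' y] yI' I'(2) by (auto simp: J_def)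
        \<comment> \<open>\<open>u\<close> itself needs \<open>y\<close>, an element of its color
          above \<open>u\<close> needs \<open>u\<close>, and one below \<open>u\<close> is already
          in \<open>J\<close>.\<close>
        have noJ: "addable \<kappa> (\<kappa> u) J = {}"
        proof (rule ccontr)
          assume "addable \<kappa> (\<kappa> u) J \<noteq> {}"
          then obtain w where w: "w \<notin> J" "\<kappa> w = \<kappa> u" "\<And>t. t < w \<Longrightarrow> t \<in> J"
            by (auto simp: addable_def)
          have "w \<noteq> u" using w(3)[of y] \<open>y < u\<close> by (auto simp: J_def)
          moreover have "\<not> w < u"
          proof
            assume "w < u"
            then have "w \<in> I" using u less.prems(1) downsetD' by blast
            then show False using w cu \<open>w \<noteq> u\<close> by (auto simp: J_def I'_def)
          qed
          moreover have "\<not> u < w" using w(3)[of u] by (auto simp: J_def I'_def)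
          ultimately show False using same_color_comparable[OF w(2)] by (auto simp: less_le)
        qed
        have stepJ: "(tX (\<kappa> u) ^^ k) ((tX c ^^ l) g) \<in> demazure I" if "g \<in> demazure J" for g k l
          using step demazure_power[OF yI', of g l] that by (simp add: J_def)
        define g where "g = ideal_word J n"
        have g: "g \<in> demazure J" "tX (\<kappa> u) g \<in> demazure J"
          using less.hyps[OF J(2) J(1) noJ] ideal_word_in_demazure by (auto simp: g_def)
        have word': "ideal_word I n = (tX (\<kappa> u) ^^ n u) ((tX c ^^ n y) g)"
          unfolding word g_def J_def using ideal_word_remove[OF yI', of n] by simp
        show ?thesis
        proof (cases "n u")
          case 0
          then have "tX c (ideal_word I n) = (tX (\<kappa> u) ^^ 0) ((tX c ^^ Suc (n y)) g)"
            by (simp add: word')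
          then show ?thesis using stepJ[OF g(1)] by metis
        next
          case (Suc k)
          let ?j = "of_nat (Suc (n y)) :: complex" and ?k = "of_nat (Suc k) :: complex"
          have "fscale ?j (tX c (ideal_word I n)) =
              fscale (?j - ?k) ((tX (\<kappa> u) ^^ Suc k) ((tX c ^^ Suc (n y)) g)) +
              fscale ?k ((tX (\<kappa> u) ^^ k) ((tX c ^^ Suc (n y)) (tX (\<kappa> u) g)))"
            unfolding word' Suc by (rule serre_pair.C_B_C_exchange[OF serre_pair_tX[OF 3]])
          moreover have "\<dots> \<in> demazure I"
            by (intro fv.subspace_add fv.subspace_scale stepJ g subspace_demazure)
          ultimately have "fscale ?j (tX c (ideal_word I n)) \<in> demazure I" by metis
          \<comment> \<open>This division, like the one in \<open>C_power_B_power\<close>, is why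
            spanning is obtained over the complex numbers only.\<close>
          then have "fscale (1 / ?j) (fscale ?j (tX c (ideal_word I n))) \<in> demazure I"
            using fv.subspace_scale[OF subspace_demazure] by blast
          moreover have "fscale (1 / ?j) (fscale ?j (tX c (ideal_word I n))) = tX c (ideal_word I n)"
            unfolding fv.scale_scale by (simp del: of_nat_Suc)
          ultimately show ?thesis by metis
        qed
      qed
    qed
    then show ?thesis
      using flinear_span[OF flinear_tX subspace_demazure[of I], of "range (ideal_word I)" c f] less.prems(3)
      by (auto simp: demazure_def)
  qed
qed

section \<open>Stackwise words span\<close>

definition stackwise_on :: "'p set \<Rightarrow> ('p \<Rightarrow> nat) \<Rightarrow> bool" where
  "stackwise_on I \<psi> \<longleftrightarrow> (\<forall>x\<in>I. \<psi> x \<le> m) \<and> (\<forall>x\<in>I. \<forall>y\<in>I. x < y \<longrightarrow> \<psi> y \<le> \<psi> x)"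

definition stack_span :: "'p set \<Rightarrow> ((nat \<Rightarrow> 'p set) \<Rightarrow> complex) set" where
  "stack_span I = fv.span (ideal_word I ` {\<psi>. stackwise_on I \<psi>})"

text \<open>If the exponent at \<open>z\<close> exceeds the one at an element \<open>u\<close> covered by \<open>z\<close>, then part of the power
  at \<open>z\<close> can be moved to the right of \<open>u\<close>, where it is absorbed.\<close>

lemma power_excess_reduces:
  assumes I: "downset I" and z: "z \<in> addable \<kappa> c I" and u: "covered_by u z" and q: "q > n u"
  shows "(tX c ^^ q) (ideal_word I n) \<in> fv.span {(tX c ^^ s) g | s g. s < q \<and> g \<in> demazure I}"
proof -
  \<comment> \<open>\<open>R\<close> is the largest ideal inside \<open>I\<close> without
    \<open>u\<close>. No element of color \<open>c\<close> can be added to it: such an element would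
    lie strictly between \<open>u\<close> and \<open>z\<close>. So the word space of
    \<open>R\<close> is stable under \<open>c\<close>, and \<open>C_power_B_power\<close> bounds the
    exponent of \<open>c\<close> by \<open>n u\<close>. The elements of \<open>I\<close> above
    \<open>u\<close> are peeled off first.\<close>
  define R where "R = {x \<in> I. \<not> u \<le> x}"
  have zc: "\<kappa> z = c" "z \<notin> I" "\<And>y. y < z \<Longrightarrow> y \<in> I" using z by (auto simp: addable_def)
  have uz: "u < z" "adj c (\<kappa> u)" using u covered_by_adj[OF u] zc adj_sym by (auto simp: covered_by_def)
  have uI: "u \<in> I" using uz zc by auto
  have R: "downset R" using I unfolding downset_def R_def by (auto intro: order_trans)
  have noR: "addable \<kappa> c R = {}"
  proof (rule ccontr)
    assume "addable \<kappa> c R \<noteq> {}"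
    then obtain w where w: "w \<notin> R" "\<kappa> w = c" "\<And>t. t < w \<Longrightarrow> t \<in> R" by (auto simp: addable_def)
    have "w \<noteq> z" using w(3)[of u] uz by (auto simp: R_def)
    moreover have "\<not> z < w" using w(3)[of z] zc by (auto simp: R_def)
    ultimately have "w < z" using same_color_comparable[of w z] w zc by (auto simp: less_le)
    then have "w \<in> I" using zc by auto
    then have "u \<le> w" using w by (auto simp: R_def)
    moreover have "u \<noteq> w" using uz w by auto
    ultimately show False using \<open>w < z\<close> u by (auto simp: covered_by_def less_le)
  qed
  let ?Z = "\<lambda>K. fv.span {(tX c ^^ s) g | s g. s < q \<and> g \<in> demazure K}"
  have "(tX c ^^ q) (ideal_word K n) \<in> ?Z K" if "downset K" "insert u R \<subseteq> K" "K \<subseteq> I" for K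
    using that
  proof (induction "card K" arbitrary: K rule: less_induct)
    case less
    show ?case
    proof (cases "K = insert u R")
      case True
      have "u \<notin> R" by (simp add: R_def)
      have max: "u \<in> K" "\<forall>x\<in>K. \<not> u < x" using True by (auto simp: R_def)
      have KR: "K - {u} = R" using True \<open>u \<notin> R\<close> by auto
      have "(tX c ^^ q) ((tX (\<kappa> u) ^^ n u) (ideal_word R n)) \<in>
          fv.span {(tX c ^^ s) ((tX (\<kappa> u) ^^ n u) h) | s h. s \<le> n u \<and> h \<in> demazure R}"
        by (rule serre_pair.C_power_B_power[OF serre_pair_tX[OF uz(2)] subspace_demazure
              demazure_stable[OF R noR] ideal_word_in_demazure])
      also have "\<dots> \<subseteq> ?Z K"
      proof (rule fv.span_mono)
        have "(tX (\<kappa> u) ^^ n u) h \<in> demazure K" if "h \<in> demazure R" for h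
          using demazure_power[OF max] that KR by simp
        then show "{(tX c ^^ s) ((tX (\<kappa> u) ^^ n u) h) | s h. s \<le> n u \<and> h \<in> demazure R}
            \<subseteq> {(tX c ^^ s) g | s g. s < q \<and> g \<in> demazure K}"
          using q by (force intro: le_less_trans)
      qed
      finally show ?thesis using ideal_word_remove[OF max, of n] KR by simp
    next
      case False
      then obtain w where w: "w \<in> K" "w \<notin> R" "w \<noteq> u" using less.prems(2) by blast
      then obtain v where v: "v \<in> K" "w \<le> v" "\<forall>t\<in>K. \<not> v < t" using finite_order_maximal_above by metis
      have "u < w" using w less.prems(3) by (auto simp: R_def less_le)
      then have "u < v" using v by auto
      have vI: "v \<in> I" using v less.prems by auto
      \<comment> \<open>Since \<open>v\<close> lies above \<open>u\<close> and \<open>z\<close>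
        covers \<open>u\<close>, the elements \<open>v\<close> and \<open>z\<close> are
        incomparable. Hence the color of \<open>v\<close> is neither \<open>c\<close> nor adjacent
        to \<open>c\<close>, and its power commutes with \<open>tX c\<close>.\<close>
      have nv: "\<not> v < z" using u \<open>u < v\<close> by (auto simp: covered_by_def)
      have zv: "\<not> z \<le> v" using vI zc I downsetD by blast
      have c1: "\<kappa> v \<noteq> c" using same_color_comparable[of v z] zc nv zv by (auto simp: less_le)
      have c2: "\<not> adj (\<kappa> v) c" using adj_color_comparable[of v z] zc nv zv by auto
      define K' where "K' = K - {v}"
      have K': "downset K'" "card K' < card K" "insert u R \<subseteq> K'" "K' \<subseteq> I"
        using downset_remove_maximal[OF less.prems(1) v(3)] card_Diff1_less[of K v] v less.prems \<open>u < v\<close>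
        by (auto simp: K'_def R_def)
      have comm: "(tX c ^^ i) ((tX (\<kappa> v) ^^ j) f) = (tX (\<kappa> v) ^^ j) ((tX c ^^ i) f)" for i j f
        using funpow_commute[of "tX c" "tX (\<kappa> v)"] tX_commute[of c "\<kappa> v"] c1 c2 adj_sym by metis
      have "(tX (\<kappa> v) ^^ n v) ((tX c ^^ q) (ideal_word K' n)) \<in> ?Z K"
      proof (rule flinear_span[OF flinear_funpow[OF flinear_tX] fv.subspace_span _ less.hyps[OF K'(2,1,3,4)]])
        fix f assume "f \<in> {(tX c ^^ s) g | s g. s < q \<and> g \<in> demazure K'}"
        then obtain s g where sg: "f = (tX c ^^ s) g" "s < q" "g \<in> demazure K'" by auto
        have "(tX (\<kappa> v) ^^ n v) g \<in> demazure K"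
          using demazure_power[OF v(1,3)] sg by (simp add: K'_def)
        moreover have "(tX (\<kappa> v) ^^ n v) f = (tX c ^^ s) ((tX (\<kappa> v) ^^ n v) g)" using sg comm by simp
        ultimately show "(tX (\<kappa> v) ^^ n v) f \<in> ?Z K" using sg by (intro fv.span_base) blast
      qed
      then show ?thesis using ideal_word_remove[OF v(1,3), of n] comm by (simp add: K'_def)
    qed
  qed
  from this[OF I] show ?thesis using uI by (auto simp: R_def)
qed

text \<open>An exponent \<open>q\<close> at a maximal \<open>z\<close> is either admissible, or
  exceeds \<open>m\<close> and gives zero, or exceeds the exponent at an element covered by
  \<open>z\<close> and can be lowered.\<close>

lemma demazure_subset_stack_span:
  assumes "downset I"
  shows "demazure I \<subseteq> stack_span I"
  using assms
proof (induction "card I" arbitrary: I rule: less_induct)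
  case less
  have sub: "fv.subspace (stack_span I)" by (simp add: stack_span_def)
  show ?case
  proof (cases "I = {}")
    case True
    have "range (ideal_word {}) \<subseteq> ideal_word {} ` {\<psi>. stackwise_on {} \<psi>}"
      by (auto simp: stackwise_on_def)
    then show ?thesis unfolding True demazure_def stack_span_def by (rule fv.span_mono)
  next
    case False
    then obtain x where "x \<in> I" by auto
    then obtain z where z: "z \<in> I" "\<forall>t\<in>I. \<not> z < t" using finite_order_maximal_above by metis
    define J where "J = I - {z}"
    have J: "downset J" "card J < card I"
      using downset_remove_maximal[OF less.prems z(2)] card_Diff1_less[of I z] z by (auto simp: J_def)
    have JI: "I = insert z J" "z \<notin> J" using z by (auto simp: J_def)
    have IH: "demazure J \<subseteq> stack_span J" using less.hyps J by blast
    have zJ: "z \<in> addable \<kappa> (\<kappa> z) J"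
      using z downsetD'[OF less.prems] by (auto simp: J_def addable_def)
    \<comment> \<open>This is stated for all of \<open>demazure J\<close>, because lowering the
      exponent replaces the stackwise word on \<open>J\<close> by an arbitrary element of that
      space.\<close>
    have power: "(tX (\<kappa> z) ^^ q) f \<in> stack_span I" if "f \<in> demazure J" for q f
      using that
    proof (induction q arbitrary: f rule: less_induct)
      case (less q)
      have "(tX (\<kappa> z) ^^ q) g \<in> stack_span I" if g: "g \<in> ideal_word J ` {\<psi>. stackwise_on J \<psi>}" for g
      proof -
        from g obtain \<psi> where \<psi>: "g = ideal_word J \<psi>" "stackwise_on J \<psi>" by auto
        consider "\<exists>u. covered_by u z \<and> q > \<psi> u" | "q > m" | "q \<le> m" "\<forall>u. covered_by u z \<longrightarrow> q \<le> \<psi> u"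
          by (meson not_less)
        then show ?thesis
        proof cases
          case 1
          then obtain u where u: "covered_by u z" "q > \<psi> u" by blast
          have "(tX (\<kappa> z) ^^ q) g \<in> fv.span {(tX (\<kappa> z) ^^ s) g | s g. s < q \<and> g \<in> demazure J}"
            unfolding \<psi>(1) by (rule power_excess_reduces[where n = \<psi>, OF J(1) zJ u])
          also have "\<dots> \<subseteq> stack_span I"
            by (rule fv.span_minimal[OF _ sub]) (use less.IH in blast)
          finally show ?thesis .
        next
          case 2
          then show ?thesis using tX_power_eq_0 sub by (simp add: fv.subspace_0)
        next
          case 3
          have "stackwise_on I (\<psi>(z := q))"
          proof -
            have "q \<le> \<psi> x" if "x < z" "x \<in> J" for x
            proof -
              obtain u where u: "covered_by u z" "x \<le> u" using covered_by_below[OF \<open>x < z\<close>] .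
              then have "u \<in> J" using zJ by (auto simp: addable_def covered_by_def)
              then have "\<psi> u \<le> \<psi> x" using \<psi>(2) u(2) that by (auto simp: stackwise_on_def less_le)
              then show ?thesis using 3 u by force
            qed
            then show ?thesis
              using \<psi>(2) 3(1) z by (auto simp: stackwise_on_def JI(1))
          qed
          moreover have "(tX (\<kappa> z) ^^ q) g = ideal_word I (\<psi>(z := q))"
            unfolding \<psi>(1) J_def by (rule ideal_word_remove_update[OF z])
          ultimately show ?thesis by (auto simp: stack_span_def intro: fv.span_base)
        qed
      qed
      then show ?case
        by (rule flinear_span[OF flinear_funpow[OF flinear_tX] sub])
           (use less.prems IH in \<open>auto simp: stack_span_def\<close>)
    qed
    have "range (ideal_word I) \<subseteq> stack_span I"
      using ideal_word_remove[OF z] power ideal_word_in_demazure by (auto simp: J_def)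
    then show ?thesis unfolding demazure_def by (rule fv.span_minimal[OF _ sub])
  qed
qed

text \<open>No element can be added to the whole poset, so its word space is stable under every
  color.\<close>

lemma tX_power_in_stack_span: "(tX c ^^ q) (ideal_word UNIV n) \<in> stack_span UNIV"
proof -
  have "addable \<kappa> c UNIV = {}" for c by (auto simp: addable_def)
  then have "(tX c ^^ q) (ideal_word UNIV n) \<in> demazure UNIV"
    by (induction q) (auto simp: ideal_word_in_demazure demazure_stable)
  then show ?thesis using demazure_subset_stack_span[of UNIV] by auto
qed

section \<open>Unitriangularity of the stackwise vectors\<close>

definition divided_tX :: "'c \<Rightarrow> nat \<Rightarrow> ((nat \<Rightarrow> 'p set) \<Rightarrow> complex) \<Rightarrow> (nat \<Rightarrow> 'p set) \<Rightarrow> complex" where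
  "divided_tX a k f = fscale (1 / fact k) ((tX a ^^ k) f)"

fun tblock :: "'c blocks \<Rightarrow> (nat \<Rightarrow> 'p set) \<Rightarrow> complex" where
  "tblock [] = vac"
| "tblock ((b, n) # bs) = divided_tX b n (tblock bs)"

definition prefix_blocks :: "('p \<Rightarrow> nat) \<Rightarrow> 'p list \<Rightarrow> 'c blocks" where
  "prefix_blocks \<psi> xs = rev (map (\<lambda>x. (\<kappa> x, \<psi> x)) (filter (\<lambda>x. \<psi> x > 0) xs))"

abbreviation stack_vec :: "('p \<Rightarrow> nat) \<Rightarrow> (nat \<Rightarrow> 'p set) \<Rightarrow> complex" where
  "stack_vec \<psi> \<equiv> tblock (prefix_blocks \<psi> ext)"

lemma stackwise_blocks_of_eq: "stackwise_blocks_of \<kappa> ext \<psi> = prefix_blocks \<psi> ext"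
  by (simp add: stackwise_blocks_of_def prefix_blocks_def)

lemma divided_tX_apply:
  "divided_tX a k f T = (\<Sum>S | S \<subseteq> slots a T \<and> card S = k. f (strip a S T))"
  by (simp add: divided_tX_def tX_power_apply)

lemma divided_tX_0 [simp]: "divided_tX a 0 f = f"
  by (simp add: divided_tX_def fun_eq_iff)

lemma divided_tX_nonzeroE:
  assumes "divided_tX a k f T \<noteq> 0"
  obtains S where "S \<subseteq> slots a T" "card S = k" "f (strip a S T) \<noteq> 0"
proof -
  have "(tX a ^^ k) f T \<noteq> 0" using assms by (simp add: divided_tX_def)
  then show ?thesis using that by (rule tX_power_nonzeroE)
qed

lemma prefix_blocks_Nil [simp]: "prefix_blocks \<psi> [] = []"
  by (simp add: prefix_blocks_def)

lemma tblock_prefix_snoc: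
  "tblock (prefix_blocks \<psi> (xs @ [x])) = divided_tX (\<kappa> x) (\<psi> x) (tblock (prefix_blocks \<psi> xs))"
  by (simp add: prefix_blocks_def)

lemma tblock_Ints: "tblock bs T \<in> \<int>"
proof (induction bs arbitrary: T rule: tblock.induct)
  case 1
  then show ?case by (simp add: vac_def)
next
  case (2 b n bs)
  then show ?case by (auto simp: divided_tX_apply intro!: Ints_sum)
qed

lemma fold_power_eq_tblock:
  "fold (\<lambda>x. tX (\<kappa> x) ^^ \<psi> x) xs vac = fscale (prod_list (map (\<lambda>x. fact (\<psi> x)) xs)) (tblock (prefix_blocks \<psi> xs))"
proof (induction xs rule: rev_induct)
  case Nil
  then show ?case by (simp add: fun_eq_iff)
next
  case (snoc x xs)
  have lin: "flinear (tX (\<kappa> x) ^^ \<psi> x)" by (rule flinear_funpow[OF flinear_tX])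
  have "fold (\<lambda>x. tX (\<kappa> x) ^^ \<psi> x) (xs @ [x]) vac =
     (tX (\<kappa> x) ^^ \<psi> x) (fscale (prod_list (map (\<lambda>x. fact (\<psi> x)) xs)) (tblock (prefix_blocks \<psi> xs)))"
    by (simp only: fold_append o_apply snoc.IH fold_simps)
  also have "\<dots> = fscale (prod_list (map (\<lambda>x. fact (\<psi> x)) xs)) ((tX (\<kappa> x) ^^ \<psi> x) (tblock (prefix_blocks \<psi> xs)))"
    by (rule flinear_scale[OF lin])
  finally show ?case
    unfolding tblock_prefix_snoc divided_tX_def by (simp add: fun_eq_iff)
qed

lemma prod_list_fact_nonzero: "prod_list (map (\<lambda>x. fact (n x)) xs) \<noteq> (0 :: complex)"
  by (induction xs) auto

lemma filter_prefix: "ext = xs @ ys \<Longrightarrow> filter (\<lambda>x. x \<in> set xs) ext = xs"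
  using ext_distinct by (auto simp: filter_empty_conv)

lemma downset_prefix:
  assumes "ext = xs @ ys"
  shows "downset (set xs)"
  unfolding downset_def
proof (intro ballI allI impI)
  fix x y assume x: "x \<in> set xs" and "y \<le> x"
  show "y \<in> set xs"
  proof (rule ccontr)
    assume "y \<notin> set xs"
    then have y: "y \<in> set ys" "y < x" using ext_set assms x \<open>y \<le> x\<close> by (auto simp: less_le)
    obtain us vs where "xs = us @ x # vs" using x split_list by metis
    then show False using ext_order[of us x "vs @ ys" y] assms y by simp
  qed
qed

lemma tblock_prefix_support:
  assumes "ext = xs @ ys" "tblock (prefix_blocks \<psi> xs) T \<noteq> 0" "j < m"
  shows "T j \<subseteq> set xs"
proof (rule ideal_word_support[OF downset_prefix[OF assms(1)] _ assms(3)])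
  show "ideal_word (set xs) \<psi> T \<noteq> 0"
    unfolding ideal_word_def filter_prefix[OF assms(1)] fold_power_eq_tblock
    using assms prod_list_fact_nonzero by simp
qed

lemma tblock_downset:
  assumes "tblock bs T \<noteq> 0" "j < m"
  shows "downset (T j)"
  using assms
proof (induction bs arbitrary: T rule: tblock.induct)
  case 1
  then show ?case by (auto simp: vac_def split: if_splits)
next
  case (2 b n bs)
  from 2(2) have "divided_tX b n (tblock bs) T \<noteq> 0" by simp
  then obtain S where S: "S \<subseteq> slots b T" "tblock bs (strip b S T) \<noteq> 0"
    by (rule divided_tX_nonzeroE)
  show ?case
  proof (cases "j \<in> S")
    case True
    then show ?thesis using S(1) by (rule strip_slotE)
  next
    case False
    then show ?thesis using 2(1)[OF S(2) 2(3)] by (simp add: strip_def)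
  qed
qed

section \<open>Weights and occupation numbers of tuples\<close>

definition occ :: "(nat \<Rightarrow> 'p set) \<Rightarrow> 'p \<Rightarrow> nat" where
  "occ T x = card {j. j < m \<and> x \<in> T j}"

text \<open>The predicate on colors serves two purposes: the constant one gives the total size, and
  equality with a color gives the weight in that color.\<close>

definition color_weight :: "('c \<Rightarrow> bool) \<Rightarrow> (nat \<Rightarrow> 'p set) \<Rightarrow> nat" where
  "color_weight Q T = (\<Sum>j<m. card {x \<in> T j. Q (\<kappa> x)})"

lemma occ_strip_le: "occ (strip a S T) x \<le> occ T x"
  unfolding occ_def by (rule card_mono) (auto simp: strip_def split: if_splits)

lemma color_weight_strip:
  assumes S: "S \<subseteq> slots a T"
  shows "color_weight Q T = color_weight Q (strip a S T) + (if Q a then card S else 0)"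
proof -
  have "card {x \<in> T j. Q (\<kappa> x)} =
      card {x \<in> strip a S T j. Q (\<kappa> x)} + (if j \<in> S \<and> Q a then 1 else 0)" for j
  proof (cases "j \<in> S")
    case True
    then obtain x where x: "T j = insert x (strip a S T j)" "x \<notin> strip a S T j" "\<kappa> x = a"
      using S by (rule strip_slotE)
    have "{y \<in> T j. Q (\<kappa> y)} = (if Q a then insert x {y \<in> strip a S T j. Q (\<kappa> y)} else {y \<in> strip a S T j. Q (\<kappa> y)})"
      using x by auto
    then show ?thesis using x(2) True by simp
  next
    case False
    then show ?thesis by (simp add: strip_def)
  qed
  then have "color_weight Q T = color_weight Q (strip a S T) + (\<Sum>j<m. if j \<in> S \<and> Q a then 1 else 0)"
    by (simp add: color_weight_def sum.distrib)
  also have "(\<Sum>j<m. if j \<in> S \<and> Q a then 1 else 0) = (if Q a then card S else 0)"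
  proof -
    have "S \<subseteq> {..<m}" using S by (auto simp: slots_def)
    then have "{..<m} \<inter> S = S" by auto
    then show ?thesis by (simp flip: sum.inter_restrict)
  qed
  finally show ?thesis .
qed

lemma sum_occ: "(\<Sum>x | Q (\<kappa> x). occ T x) = color_weight Q T"
proof -
  have "(\<Sum>x | Q (\<kappa> x). occ T x) = (\<Sum>x | Q (\<kappa> x). \<Sum>j<m. if x \<in> T j then 1 else 0)"
    by (intro sum.cong refl) (simp add: occ_def flip: sum.inter_filter)
  also have "\<dots> = (\<Sum>j<m. \<Sum>x | Q (\<kappa> x). if x \<in> T j then 1 else 0)"
    by (rule sum.swap)
  also have "\<dots> = color_weight Q T"
    unfolding color_weight_def
    by (intro sum.cong refl) (simp add: conj_commute flip: sum.inter_filter)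
  finally show ?thesis .
qed

lemma tblock_color_weight:
  assumes "tblock bs T \<noteq> 0"
  shows "color_weight Q T = sum_list (map snd (filter (\<lambda>p. Q (fst p)) bs))"
  using assms
proof (induction bs arbitrary: T rule: tblock.induct)
  case 1
  then show ?case by (auto simp: vac_def color_weight_def split: if_splits)
next
  case (2 b n bs)
  from 2(2) have "divided_tX b n (tblock bs) T \<noteq> 0" by simp
  then obtain S where S: "S \<subseteq> slots b T" "card S = n" "tblock bs (strip b S T) \<noteq> 0"
    by (rule divided_tX_nonzeroE)
  then show ?case using color_weight_strip[where Q = Q, OF S(1)] 2(1) by simp
qed

lemma sum_list_prefix_blocks:
  "distinct xs \<Longrightarrow>
    sum_list (map snd (filter (\<lambda>p. Q (fst p)) (prefix_blocks \<psi> xs))) = (\<Sum>x\<in>{x \<in> set xs. Q (\<kappa> x)}. \<psi> x)"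
proof (induction xs rule: rev_induct)
  case (snoc x xs)
  have "{y \<in> set (xs @ [x]). Q (\<kappa> y)} = (if Q (\<kappa> x) then insert x {y \<in> set xs. Q (\<kappa> y)} else {y \<in> set xs. Q (\<kappa> y)})"
    by auto
  then show ?case using snoc by (auto simp: prefix_blocks_def)
qed simp

text \<open>Once the prefix \<open>us\<close> has been processed, the tuple lies inside
  \<open>set us\<close> and its size is the sum of the exponents there. Later letters only add
  elements.\<close>

lemma tblock_prefix_dominates:
  assumes "ext = xs @ ys" "tblock (prefix_blocks \<psi> xs) T \<noteq> 0" "xs = us @ vs"
  shows "(\<Sum>x\<in>set us. \<psi> x) \<le> (\<Sum>x\<in>set us. occ T x)"
  using assms
proof (induction xs arbitrary: ys T us vs rule: rev_induct)
  case Nil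
  then show ?case by simp
next
  case (snoc x xs)
  have dx: "distinct (xs @ [x])" using snoc.prems(1) ext_distinct by simp
  show ?case
  proof (cases "vs = []")
    case True
    have "(\<Sum>y\<in>set us. \<psi> y) = color_weight (\<lambda>_. True) T"
      using tblock_color_weight[where Q = "\<lambda>_. True", OF snoc.prems(2)] sum_list_prefix_blocks[where Q = "\<lambda>_. True" and \<psi> = \<psi>, OF dx]
        snoc.prems(3) True by (simp del: set_append)
    also have "\<dots> = (\<Sum>y\<in>UNIV. occ T y)" using sum_occ[where Q = "\<lambda>_. True" and T = T] by simp
    also have "\<dots> = (\<Sum>y\<in>set us. occ T y)"
    proof (rule sum.mono_neutral_right)
      have "{j. j < m \<and> y \<in> T j} = {}" if "y \<notin> set us" for y
        using tblock_prefix_support[OF snoc.prems(1,2)] snoc.prems(3) True that by auto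
      then show "\<forall>y\<in>UNIV - set us. occ T y = 0" by (auto simp: occ_def)
    qed auto
    finally show ?thesis by simp
  next
    case False
    then obtain vs' where vs: "xs = us @ vs'" using snoc.prems(3)
      by (metis append_butlast_last_id append_assoc butlast_snoc)
    obtain S where S: "tblock (prefix_blocks \<psi> xs) (strip (\<kappa> x) S T) \<noteq> 0"
      using snoc.prems(2) unfolding tblock_prefix_snoc by (rule divided_tX_nonzeroE)
    have "(\<Sum>y\<in>set us. \<psi> y) \<le> (\<Sum>y\<in>set us. occ (strip (\<kappa> x) S T) y)"
      using snoc.IH[of "x # ys", OF _ S vs] snoc.prems(1) by simp
    also have "\<dots> \<le> (\<Sum>y\<in>set us. occ T y)" by (intro sum_mono occ_strip_le)
    finally show ?thesis .
  qed
qed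

definition stack_tuple :: "('p \<Rightarrow> nat) \<Rightarrow> 'p set \<Rightarrow> nat \<Rightarrow> 'p set" where
  "stack_tuple \<psi> I = (\<lambda>j. {x \<in> I. j < \<psi> x})"

lemma occ_stack_tuple: "stackwise_on UNIV \<psi> \<Longrightarrow> occ (stack_tuple \<psi> UNIV) x = \<psi> x"
proof -
  assume "stackwise_on UNIV \<psi>"
  then have "\<psi> x \<le> m" by (simp add: stackwise_on_def)
  then have "{j. j < m \<and> x \<in> stack_tuple \<psi> UNIV j} = {..<\<psi> x}" by (auto simp: stack_tuple_def)
  then show ?thesis by (simp add: occ_def)
qed

lemma downset_stack_tuple:
  assumes "stackwise_on UNIV \<psi>" "downset I"
  shows "downset (stack_tuple \<psi> I j)"
  unfolding downset_def
proof (intro ballI allI impI)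
  fix x y assume x: "x \<in> stack_tuple \<psi> I j" "y \<le> x"
  then have "\<psi> x \<le> \<psi> y" using assms(1) by (auto simp: stackwise_on_def le_less)
  then show "y \<in> stack_tuple \<psi> I j" using x downsetD[OF assms(2)] by (auto simp: stack_tuple_def)
qed

lemma tblock_prefix_stack_tuple:
  assumes "stackwise_on UNIV \<psi>" "ext = xs @ ys"
  shows "tblock (prefix_blocks \<psi> xs) (stack_tuple \<psi> (set xs)) = 1"
  using assms(2)
proof (induction xs arbitrary: ys rule: rev_induct)
  case Nil
  then show ?case by (simp add: vac_def stack_tuple_def)
next
  case (snoc x xs)
  let ?T = "stack_tuple \<psi> (set (xs @ [x]))"
  have x: "x \<notin> set xs" using snoc.prems ext_distinct by auto
  have dd: "downset (set (xs @ [x]))" "downset (set xs)"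
    using downset_prefix[of "xs @ [x]" ys] downset_prefix[of xs "x # ys"] snoc.prems by auto
  have rem: "removable (\<kappa> x) (?T j) = {x}" if "j < \<psi> x" for j
  proof (rule removable_unique)
    have "?T j - {x} = stack_tuple \<psi> (set xs) j" using x by (auto simp: stack_tuple_def)
    then show "x \<in> removable (\<kappa> x) (?T j)"
      using downset_stack_tuple[OF assms(1) dd(1), of j] downset_stack_tuple[OF assms(1) dd(2), of j] that
      by (auto simp: removable_def stack_tuple_def)
  qed
  have le: "\<psi> x \<le> m" using assms(1) by (simp add: stackwise_on_def)
  have sub: "{..<\<psi> x} \<subseteq> slots (\<kappa> x) ?T" using rem le by (auto simp: slots_def)
  have str: "strip (\<kappa> x) {..<\<psi> x} ?T = stack_tuple \<psi> (set xs)"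
  proof
    fix j
    show "strip (\<kappa> x) {..<\<psi> x} ?T j = stack_tuple \<psi> (set xs) j"
      using rem[of j] x by (cases "j < \<psi> x") (auto simp: strip_def stack_tuple_def)
  qed
  \<comment> \<open>Any other choice of \<open>\<psi> x\<close> slots leaves \<open>x\<close> in
    some slot below \<open>\<psi> x\<close>, but words on \<open>xs\<close> are supported on subsets
    of \<open>set xs\<close>.\<close>
  have other: "tblock (prefix_blocks \<psi> xs) (strip (\<kappa> x) S ?T) = 0"
    if S: "S \<subseteq> slots (\<kappa> x) ?T" "card S = \<psi> x" "S \<noteq> {..<\<psi> x}" for S
  proof (rule ccontr)
    assume nz: "tblock (prefix_blocks \<psi> xs) (strip (\<kappa> x) S ?T) \<noteq> 0"
    have "j \<in> S" if "j < \<psi> x" for j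
    proof (rule ccontr)
      assume "j \<notin> S"
      then have "x \<in> strip (\<kappa> x) S ?T j" using that by (auto simp: strip_def stack_tuple_def)
      moreover have "strip (\<kappa> x) S ?T j \<subseteq> set xs"
        using tblock_prefix_support[of xs "x # ys", OF _ nz] snoc.prems that le by simp
      ultimately show False using x by auto
    qed
    then have "{..<\<psi> x} \<subseteq> S" by auto
    moreover have "finite S" using S(1) finite_slots by (rule finite_subset)
    ultimately show False using S card_subset_eq[of S "{..<\<psi> x}"] by auto
  qed
  have "tblock (prefix_blocks \<psi> (xs @ [x])) ?T =
      (\<Sum>S | S \<subseteq> slots (\<kappa> x) ?T \<and> card S = \<psi> x. tblock (prefix_blocks \<psi> xs) (strip (\<kappa> x) S ?T))"
    unfolding tblock_prefix_snoc divided_tX_apply ..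
  also have "\<dots> = (\<Sum>S\<in>{{..<\<psi> x}}. tblock (prefix_blocks \<psi> xs) (strip (\<kappa> x) S ?T))"
    by (rule sum.mono_neutral_right) (use sub other in auto)
  also have "\<dots> = 1"
  proof -
    have "tblock (prefix_blocks \<psi> xs) (strip (\<kappa> x) {..<\<psi> x} ?T) = 1"
      unfolding str using snoc.IH[of "x # ys"] snoc.prems by simp
    then show ?thesis by (simp del: set_append)
  qed
  finally show ?case .
qed

section \<open>Dominance of exponent functions and integrality\<close>

definition dominates :: "('p \<Rightarrow> nat) \<Rightarrow> ('p \<Rightarrow> nat) \<Rightarrow> bool" where
  "dominates \<phi> \<psi> \<longleftrightarrow> (\<forall>xs ys. ext = xs @ ys \<longrightarrow> (\<Sum>x\<in>set xs. \<psi> x) \<le> (\<Sum>x\<in>set xs. \<phi> x))"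

lemma dominates_trans:
  assumes "dominates \<chi> \<phi>" "dominates \<phi> \<psi>"
  shows "dominates \<chi> \<psi>"
  unfolding dominates_def
proof (intro allI impI)
  fix xs ys assume e: "ext = xs @ ys"
  have "sum \<psi> (set xs) \<le> sum \<phi> (set xs)" using assms(2) e unfolding dominates_def by blast
  also have "\<dots> \<le> sum \<chi> (set xs)" using assms(1) e unfolding dominates_def by blast
  finally show "sum \<psi> (set xs) \<le> sum \<chi> (set xs)" .
qed

text \<open>Summing all partial sums turns dominance into a number that strictly increases; it is
  the measure for solving the triangular system.\<close>

definition prefix_total :: "('p \<Rightarrow> nat) \<Rightarrow> nat" where
  "prefix_total \<psi> = (\<Sum>k\<le>length ext. \<Sum>x\<in>set (take k ext). \<psi> x)"

lemma prefix_total_less: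
  assumes "dominates \<phi> \<psi>" "\<phi> \<noteq> \<psi>"
  shows "prefix_total \<psi> < prefix_total \<phi>"
  unfolding prefix_total_def
proof (rule sum_strict_mono_ex1)
  have le: "(\<Sum>x\<in>set (take k ext). \<psi> x) \<le> (\<Sum>x\<in>set (take k ext). \<phi> x)" for k
    using assms(1) append_take_drop_id[of k ext] unfolding dominates_def by metis
  then show "\<forall>k\<in>{..length ext}. (\<Sum>x\<in>set (take k ext). \<psi> x) \<le> (\<Sum>x\<in>set (take k ext). \<phi> x)" by simp
  show "\<exists>k\<in>{..length ext}. (\<Sum>x\<in>set (take k ext). \<psi> x) < (\<Sum>x\<in>set (take k ext). \<phi> x)"
  proof (rule ccontr)
    assume "\<not> ?thesis"
    then have eq: "(\<Sum>x\<in>set (take k ext). \<psi> x) = (\<Sum>x\<in>set (take k ext). \<phi> x)" if "k \<le> length ext" for k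
      using le that by (metis atMost_iff le_less)
    have "\<phi> x = \<psi> x" for x
    proof -
      obtain k where k: "k < length ext" "ext ! k = x" using ext_set by (metis UNIV_I in_set_conv_nth)
      have "x \<notin> set (take k ext)" using ext_distinct k
        by (metis distinct_take in_set_conv_nth length_take less_not_refl min.absorb4 nth_eq_iff_index_eq nth_take less_trans)
      moreover have "set (take (Suc k) ext) = insert x (set (take k ext))"
        using k by (simp add: take_Suc_conv_app_nth)
      ultimately show ?thesis using eq[of k] eq[of "Suc k"] k by simp
    qed
    then show False using assms(2) by auto
  qed
qed simp

lemma stack_vec_coeff:
  assumes "stackwise_on UNIV \<phi>" "stack_vec \<psi> (stack_tuple \<phi> UNIV) \<noteq> 0"
  shows "dominates \<phi> \<psi>"
    and "(\<Sum>x | Q (\<kappa> x). \<phi> x) = (\<Sum>x | Q (\<kappa> x). \<psi> x)"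
proof -
  show "dominates \<phi> \<psi>"
    unfolding dominates_def
  proof (intro allI impI)
    fix xs ys assume "ext = xs @ ys"
    then show "(\<Sum>x\<in>set xs. \<psi> x) \<le> (\<Sum>x\<in>set xs. \<phi> x)"
      using tblock_prefix_dominates[of ext "[]", OF _ assms(2)] occ_stack_tuple[OF assms(1)] by simp
  qed
  have "(\<Sum>x | Q (\<kappa> x). \<phi> x) = color_weight Q (stack_tuple \<phi> UNIV)"
    by (simp flip: sum_occ add: occ_stack_tuple[OF assms(1)])
  also have "\<dots> = (\<Sum>x | Q (\<kappa> x). \<psi> x)"
    using tblock_color_weight[OF assms(2)] sum_list_prefix_blocks[where Q = Q and \<psi> = \<psi>, OF ext_distinct] by (simp add: ext_set)
  finally show "(\<Sum>x | Q (\<kappa> x). \<phi> x) = (\<Sum>x | Q (\<kappa> x). \<psi> x)" .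
qed

lemma stack_vec_coeff_self: "stackwise_on UNIV \<psi> \<Longrightarrow> stack_vec \<psi> (stack_tuple \<psi> UNIV) = 1"
  using tblock_prefix_stack_tuple[of \<psi> ext "[]"] by (simp add: ext_set)

text \<open>Quantifying over all \<open>Q\<close> says that \<open>\<phi>\<close> has the color
  weight of \<open>\<psi>\<close> plus \<open>q\<close> in color \<open>c\<close>. These are the
  exponent functions that may occur in the expansion of the augmented vector.\<close>

definition above :: "('p \<Rightarrow> nat) \<Rightarrow> 'c \<Rightarrow> nat \<Rightarrow> ('p \<Rightarrow> nat) set" where
  "above \<psi> c q = {\<phi>. stackwise_on UNIV \<phi> \<and> dominates \<phi> \<psi> \<and>
     (\<forall>Q. (\<Sum>x | Q (\<kappa> x). \<phi> x) = (\<Sum>x | Q (\<kappa> x). \<psi> x) + (if Q c then q else 0))}"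

lemma finite_stackwise: "finite {\<phi>. stackwise_on UNIV \<phi>}"
proof (rule finite_subset)
  show "{\<phi>. stackwise_on UNIV \<phi>} \<subseteq> PiE UNIV (\<lambda>_. {..m})" by (auto simp: stackwise_on_def)
  show "finite (PiE UNIV (\<lambda>_ :: 'p. {..m}))" by (rule finite_PiE) auto
qed

lemma augmented_coeff_above:
  assumes \<phi>: "stackwise_on UNIV \<phi>" and nz: "divided_tX c q (stack_vec \<psi>) (stack_tuple \<phi> UNIV) \<noteq> 0"
  shows "\<phi> \<in> above \<psi> c q"
proof -
  let ?T = "stack_tuple \<phi> UNIV"
  obtain S where S: "S \<subseteq> slots c ?T" "card S = q" "stack_vec \<psi> (strip c S ?T) \<noteq> 0"
    using nz by (rule divided_tX_nonzeroE)
  have "dominates \<phi> \<psi>"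
    unfolding dominates_def
  proof (intro allI impI)
    fix xs ys assume "ext = xs @ ys"
    then have "(\<Sum>x\<in>set xs. \<psi> x) \<le> (\<Sum>x\<in>set xs. occ (strip c S ?T) x)"
      using tblock_prefix_dominates[of ext "[]", OF _ S(3)] by simp
    also have "\<dots> \<le> (\<Sum>x\<in>set xs. occ ?T x)" by (intro sum_mono occ_strip_le)
    finally show "(\<Sum>x\<in>set xs. \<psi> x) \<le> (\<Sum>x\<in>set xs. \<phi> x)" by (simp add: occ_stack_tuple[OF \<phi>])
  qed
  moreover have "(\<Sum>x | Q (\<kappa> x). \<phi> x) = (\<Sum>x | Q (\<kappa> x). \<psi> x) + (if Q c then q else 0)" for Q
  proof -
    have "(\<Sum>x | Q (\<kappa> x). \<phi> x) = color_weight Q ?T"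
      by (simp flip: sum_occ add: occ_stack_tuple[OF \<phi>])
    also have "\<dots> = color_weight Q (strip c S ?T) + (if Q c then q else 0)"
      using color_weight_strip[OF S(1)] S(2) by simp
    also have "color_weight Q (strip c S ?T) = (\<Sum>x | Q (\<kappa> x). \<psi> x)"
      using tblock_color_weight[OF S(3)] sum_list_prefix_blocks[where Q = Q and \<psi> = \<psi>, OF ext_distinct] by (simp add: ext_set)
    finally show ?thesis .
  qed
  ultimately show ?thesis using \<phi> by (simp add: above_def)
qed

lemma augmented_stack_combination:
  assumes \<psi>: "stackwise_on UNIV \<psi>"
  obtains r :: "('p \<Rightarrow> nat) \<Rightarrow> int" where
    "divided_tX c q (stack_vec \<psi>) = (\<Sum>\<phi>\<in>above \<psi> c q. fscale (of_int (r \<phi>)) (stack_vec \<phi>))"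
proof -
  let ?A = "{\<phi>. stackwise_on UNIV \<phi>}"
  define v where "v = divided_tX c q (stack_vec \<psi>)"
  let ?fp = "\<lambda>\<phi>. prod_list (map (\<lambda>x. fact (\<phi> x)) ext) :: complex"
  have iw: "ideal_word UNIV \<phi> = fscale (?fp \<phi>) (stack_vec \<phi>)" for \<phi>
    using fold_power_eq_tblock[of \<phi> ext] by (simp add: ideal_word_def del: fscale_apply)
  then have "stack_vec \<phi> = fscale (1 / ?fp \<phi>) (ideal_word UNIV \<phi>)" for \<phi>
    using prod_list_fact_nonzero[of \<phi> ext] by (simp add: fun_eq_iff)
  then have "v = fscale (1 / fact q) (fscale (1 / ?fp \<psi>) ((tX c ^^ q) (ideal_word UNIV \<psi>)))"
    unfolding v_def divided_tX_def by (metis flinear_scale[OF flinear_funpow[OF flinear_tX]])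
  also have "\<dots> \<in> stack_span UNIV"
    using tX_power_in_stack_span unfolding stack_span_def by (intro fv.span_scale) auto
  also have "\<dots> \<subseteq> fv.span (stack_vec ` ?A)"
    unfolding stack_span_def
  proof (rule fv.span_minimal)
    show "ideal_word UNIV ` ?A \<subseteq> fv.span (stack_vec ` ?A)"
      unfolding iw by (intro image_subsetI fv.span_scale fv.span_base imageI)
  qed simp
  finally obtain s where s: "v = (\<Sum>\<phi>\<in>?A. fscale (s \<phi>) (stack_vec \<phi>))"
    using span_image_sum[OF finite_stackwise] by metis
  \<comment> \<open>Evaluated at the stack of \<open>\<phi>\<close>, the expansion contains
    \<open>s \<phi>\<close> with coefficient 1 and otherwise only functions that
    \<open>\<phi>\<close> dominates, which have smaller measure. So a nonzero
    \<open>s \<phi>\<close> stems from \<open>v\<close> itself or from some \<open>\<chi>\<close> in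
    \<open>above\<close>, and dominance is transitive.\<close>
  have claim: "s \<phi> \<in> \<int> \<and> (s \<phi> \<noteq> 0 \<longrightarrow> \<phi> \<in> above \<psi> c q)" if "\<phi> \<in> ?A" for \<phi>
    using that
  proof (induction "prefix_total \<phi>" arbitrary: \<phi> rule: less_induct)
    case less
    let ?T = "stack_tuple \<phi> UNIV"
    have \<phi>: "stackwise_on UNIV \<phi>" using less.prems by simp
    have "v ?T = (\<Sum>\<chi>\<in>?A. s \<chi> * stack_vec \<chi> ?T)" using s by simp
    also have "\<dots> = s \<phi> * stack_vec \<phi> ?T + (\<Sum>\<chi>\<in>?A - {\<phi>}. s \<chi> * stack_vec \<chi> ?T)"
      using finite_stackwise less.prems by (subst sum.remove) auto
    finally have eq: "s \<phi> = v ?T - (\<Sum>\<chi>\<in>?A - {\<phi>}. s \<chi> * stack_vec \<chi> ?T)"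
      using stack_vec_coeff_self[OF \<phi>] by simp
    have lower: "s \<chi> \<in> \<int> \<and> (s \<chi> \<noteq> 0 \<longrightarrow> \<chi> \<in> above \<psi> c q)"
      if "\<chi> \<in> ?A - {\<phi>}" "stack_vec \<chi> ?T \<noteq> 0" for \<chi>
      using less.hyps[of \<chi>] prefix_total_less[of \<phi> \<chi>] stack_vec_coeff(1)[OF \<phi> that(2)] that(1) by auto
    have "v ?T \<in> \<int>"
      using tblock_Ints[of "(c, q) # prefix_blocks \<psi> ext" ?T] by (simp add: v_def)
    moreover have "s \<chi> * stack_vec \<chi> ?T \<in> \<int>" if "\<chi> \<in> ?A - {\<phi>}" for \<chi>
      using lower[OF that] tblock_Ints by (cases "stack_vec \<chi> ?T = 0") auto
    ultimately have "s \<phi> \<in> \<int>" unfolding eq by (intro Ints_diff Ints_sum)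
    moreover have "\<phi> \<in> above \<psi> c q" if "s \<phi> \<noteq> 0"
    proof (cases "v ?T = 0")
      case False
      then show ?thesis using augmented_coeff_above[OF \<phi>] by (simp add: v_def)
    next
      case True
      then have "(\<Sum>\<chi>\<in>?A - {\<phi>}. s \<chi> * stack_vec \<chi> ?T) \<noteq> 0" using eq that by auto
      then obtain \<chi> where "\<chi> \<in> ?A - {\<phi>}" "s \<chi> * stack_vec \<chi> ?T \<noteq> 0"
        by (rule sum.not_neutral_contains_not_neutral)
      then have \<chi>: "\<chi> \<in> above \<psi> c q" "stack_vec \<chi> ?T \<noteq> 0" using lower[of \<chi>] by auto
      then show ?thesis
        using stack_vec_coeff[OF \<phi> \<chi>(2)] \<phi> dominates_trans[of \<phi> \<chi> \<psi>] by (simp add: above_def)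
    qed
    ultimately show ?case by blast
  qed
  then have "\<forall>\<phi>\<in>?A. \<exists>k::int. s \<phi> = of_int k" by (metis Ints_cases)
  then obtain r :: "('p \<Rightarrow> nat) \<Rightarrow> int" where r: "\<And>\<phi>. \<phi> \<in> ?A \<Longrightarrow> s \<phi> = of_int (r \<phi>)" by metis
  have "v = (\<Sum>\<phi>\<in>?A. fscale (of_int (r \<phi>)) (stack_vec \<phi>))"
    unfolding s by (intro sum.cong refl) (simp add: r)
  also have "\<dots> = (\<Sum>\<phi>\<in>above \<psi> c q. fscale (of_int (r \<phi>)) (stack_vec \<phi>))"
  proof (rule sum.mono_neutral_right[OF finite_stackwise])
    show "above \<psi> c q \<subseteq> ?A" by (auto simp: above_def)
    show "\<forall>\<phi>\<in>?A - above \<psi> c q. fscale (of_int (r \<phi>)) (stack_vec \<phi>) = 0"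
      using claim r by (auto simp: fun_eq_iff)
  qed
  finally show ?thesis using that by (simp add: v_def)
qed

end

section \<open>Words\<close>

lemma word_of_Nil [simp]: "word_of [] = []"
  and word_of_Cons [simp]: "word_of ((b, n) # bs) = replicate n b @ word_of bs"
  by (simp_all add: word_of_def)

text \<open>Run-length encodings. They recover the blocks, on which the operators depend, from the
  sequence of colors, on which being a stackwise word depends.\<close>

definition reduced_blocks :: "'c blocks \<Rightarrow> bool" where
  "reduced_blocks bs \<longleftrightarrow> (\<forall>p\<in>set bs. snd p > 0) \<and> successively (\<lambda>p r. fst p \<noteq> fst r) bs"

lemma word_of_inject:
  assumes "reduced_blocks as" "reduced_blocks bs" "word_of as = word_of bs"
  shows "as = bs"
  using assms
proof (induction as arbitrary: bs)
  case Nil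
  then show ?case by (cases bs) (auto simp: reduced_blocks_def)
next
  case (Cons p as)
  obtain b n where p: "p = (b, n)" by (cases p)
  have "n > 0" using Cons.prems(1) p by (simp add: reduced_blocks_def)
  then obtain b' n' bs' where bs: "bs = (b', n') # bs'"
    using Cons.prems(3) p by (cases bs) auto
  have "n' > 0" using Cons.prems(2) bs by (simp add: reduced_blocks_def)
  have eq: "replicate n b @ word_of as = replicate n' b' @ word_of bs'"
    using Cons.prems(3) p bs by simp
  then have "b = b'" using \<open>n > 0\<close> \<open>n' > 0\<close> by (cases n; cases n') auto
  have red: "reduced_blocks as" "reduced_blocks bs'"
    using Cons.prems(1,2) bs by (auto simp: reduced_blocks_def successively_Cons)
  have run: "takeWhile (\<lambda>x. x = d) (replicate k d @ word_of cs) = replicate k d"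
    if red_cs: "reduced_blocks ((d, k) # cs)" for d k and cs :: "'a blocks"
  proof -
    have "takeWhile (\<lambda>x. x = d) (word_of cs) = []"
    proof (cases cs)
      case (Cons r cs')
      then obtain e l where "cs = (e, l) # cs'" "e \<noteq> d" "l > 0"
        using red_cs by (cases r) (auto simp: reduced_blocks_def successively_Cons)
      then show ?thesis by (cases l) auto
    qed simp
    then show ?thesis by (induction k) auto
  qed
  have "replicate n b = replicate n' b'"
    using run[of b n as] run[of b' n' bs'] Cons.prems(1,2) eq p bs \<open>b = b'\<close> by simp
  then have "n = n'" by (metis length_replicate)
  then have "word_of as = word_of bs'" using eq \<open>b = b'\<close> by simp
  then show ?case using Cons.IH[OF red] p bs \<open>b = b'\<close> \<open>n = n'\<close> by simp
qed

lemma growth_append: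
  assumes "growth \<kappa> ext m (u @ w) = Some (zs, M')" "growth \<kappa> ext m w = Some (xs, M)"
  obtains B where "zs = B @ xs" "length B = length u"
  using assms
proof (induction u arbitrary: zs M' thesis)
  case Nil
  then show ?case by simp
next
  case (Cons a u)
  then obtain x ys N where ys: "growth \<kappa> ext m (u @ w) = Some (ys, N)" "zs = x # ys"
    by (auto split: option.splits)
  obtain B where "ys = B @ xs" "length B = length u"
    using Cons.IH[OF _ ys(1) Cons.prems(3)] by blast
  then show ?case using Cons.prems(1)[of "x # B"] ys(2) by simp
qed

text \<open>The maximal right part that grows well contains \<open>w\<close>, so the right end of
  the bracket is the growth of \<open>w\<close>, whatever happens in \<open>u\<close>.\<close>

lemma bracket_append:
  assumes "growth \<kappa> ext m w = Some (xs, M)"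
  obtains B where "bracket \<kappa> ext m (u @ w) = B @ map Inr xs" "length B = length u"
proof -
  let ?P = "\<lambda>h. h \<le> length (u @ w) \<and> grows_well \<kappa> ext m (right_part h (u @ w))"
  define l where "l = growth_length \<kappa> ext m (u @ w)"
  have P: "?P (length w)" using assms by (simp add: grows_well_def right_part_def)
  have "?P l" unfolding l_def growth_length_def by (rule GreatestI_nat[of ?P, OF P]) auto
  moreover have "length w \<le> l"
    unfolding l_def growth_length_def by (rule Greatest_le_nat[of ?P, OF P]) auto
  ultimately obtain zs N where zs: "growth \<kappa> ext m (right_part l (u @ w)) = Some (zs, N)"
      and l: "length w \<le> l" "l \<le> length u + length w"
    by (auto simp: grows_well_def)
  have rp: "right_part l (u @ w) = drop (length u + length w - l) u @ w"
    using l by (simp add: right_part_def)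
  then obtain B where B: "zs = B @ xs" "length B = length (drop (length u + length w - l) u)"
    using growth_append[OF _ assms] zs by metis
  have "bracket \<kappa> ext m (u @ w) = map Inl (take (length (u @ w) - l) (u @ w)) @ map Inr (B @ xs)"
    using zs B(1) by (simp add: bracket_def l_def[symmetric] Let_def)
  moreover have "length (map Inl (take (length (u @ w) - l) (u @ w)) @ map Inr B) = length u"
    using B(2) l by simp
  ultimately show ?thesis using that by (metis append_assoc map_append)
qed

context colored_dc
begin

lemma stackwise_blocks_iff:
  "stackwise_blocks \<kappa> ext m bs \<longleftrightarrow> (\<exists>\<psi>. stackwise_on UNIV \<psi> \<and> bs = prefix_blocks \<psi> ext)"
proof -
  have "antimono \<psi> \<and> (\<forall>x. \<psi> x \<le> m) \<longleftrightarrow> stackwise_on UNIV \<psi>" for \<psi>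
    unfolding stackwise_on_def
    by (metis UNIV_I antimonoD antimonoI order.order_iff_strict order_refl)
  then show ?thesis by (auto simp: stackwise_blocks_def stackwise_blocks_of_eq)
qed

text \<open>Between two elements of the same color lies some \<open>w\<close>; its exponent is at
  least that of the upper one, hence positive, and the linear extension lists \<open>w\<close>
  between them.\<close>

lemma reduced_prefix_blocks:
  assumes \<psi>: "stackwise_on UNIV \<psi>"
  shows "reduced_blocks (prefix_blocks \<psi> ext)"
proof -
  define F where "F = filter (\<lambda>x. \<psi> x > 0) ext"
  have F: "distinct F" "sorted_wrt (\<lambda>x y. \<not> y < x) F"
    using ext_distinct ext_sorted by (auto simp: F_def intro: sorted_wrt_filter)
  have F_set: "x \<in> set F \<longleftrightarrow> \<psi> x > 0" for x
    by (simp add: F_def ext_set)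
  have "\<kappa> (F ! Suc i) \<noteq> \<kappa> (F ! i)" if i: "Suc i < length F" for i
  proof
    assume col: "\<kappa> (F ! Suc i) = \<kappa> (F ! i)"
    have "\<not> F ! Suc i < F ! i" using sorted_wrt_nth_less[OF F(2)] i by blast
    moreover have "F ! i \<noteq> F ! Suc i" using nth_eq_iff_index_eq[OF F(1)] i by auto
    ultimately have less: "F ! i < F ! Suc i" using same_color_comparable[OF col] by (auto simp: less_le)
    obtain w where w: "F ! i < w" "w < F ! Suc i" using adj_between[OF less col] by blast
    have "0 < \<psi> (F ! Suc i)" using F_set nth_mem[OF i] by blast
    also have "\<dots> \<le> \<psi> w" using \<psi> w by (simp add: stackwise_on_def)
    finally have "w \<in> set F" using F_set by blast
    then obtain k where k: "k < length F" "F ! k = w" by (auto simp: in_set_conv_nth)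
    have "\<not> k < i" using sorted_wrt_nth_less[OF F(2), of k i] k(2) i w(1) by auto
    moreover have "\<not> Suc i < k" using sorted_wrt_nth_less[OF F(2), of "Suc i" k] k w(2) by auto
    moreover have "k \<noteq> i" "k \<noteq> Suc i" using k(2) w by auto
    ultimately show False by simp
  qed
  then have "successively (\<lambda>x y. \<kappa> y \<noteq> \<kappa> x) F" by (simp add: successively_conv_nth)
  then show ?thesis
    by (auto simp: reduced_blocks_def prefix_blocks_def successively_rev successively_map F_def[symmetric] F_set)
qed

text \<open>The elements behind the letters of a stackwise word, in order of application and thus in
  the direction in which brackets are compared.\<close>

definition letters :: "('p \<Rightarrow> nat) \<Rightarrow> 'p list \<Rightarrow> 'p list" where
  "letters \<psi> xs = concat (map (\<lambda>x. replicate (\<psi> x) x) xs)"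

lemma letters_append: "letters \<psi> (xs @ ys) = letters \<psi> xs @ letters \<psi> ys"
  and letters_Cons: "letters \<psi> (x # xs) = replicate (\<psi> x) x @ letters \<psi> xs"
  and letters_Nil [simp]: "letters \<psi> [] = []"
  by (simp_all add: letters_def)

lemma letters_cong: "(\<And>x. x \<in> set xs \<Longrightarrow> \<phi> x = \<psi> x) \<Longrightarrow> letters \<phi> xs = letters \<psi> xs"
  unfolding letters_def by (intro arg_cong[of _ _ concat] map_cong) auto

lemma length_letters: "distinct xs \<Longrightarrow> length (letters \<psi> xs) = (\<Sum>x\<in>set xs. \<psi> x)"
  by (induction xs) (auto simp: letters_Cons)

lemma word_of_prefix_blocks: "word_of (prefix_blocks \<psi> xs) = map \<kappa> (rev (letters \<psi> xs))"
proof (induction xs rule: rev_induct)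
  case (snoc x xs)
  then show ?case by (simp add: prefix_blocks_def letters_append letters_Cons)
qed simp

section \<open>Stackwise words grow well\<close>

definition ideals_mset :: "(nat \<Rightarrow> 'p set) \<Rightarrow> 'p set multiset" where
  "ideals_mset T = image_mset T (mset_set {..<m})"

lemma ideals_mset_update:
  assumes "i < m"
  shows "ideals_mset (T(i := I)) = add_mset I (ideals_mset T - {#T i#})"
proof -
  have "mset_set {..<m} = add_mset i (mset_set ({..<m} - {i}))"
    using assms by (subst mset_set.remove) auto
  moreover have "image_mset (T(i := I)) (mset_set ({..<m} - {i})) = image_mset T (mset_set ({..<m} - {i}))"
    by (intro image_mset_cong) auto
  ultimately show ?thesis by (simp add: ideals_mset_def)
qed

definition partial_stack :: "('p \<Rightarrow> nat) \<Rightarrow> 'p list \<Rightarrow> 'p \<Rightarrow> nat \<Rightarrow> nat \<Rightarrow> 'p set" where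
  "partial_stack \<psi> xs x i = (\<lambda>j. stack_tuple \<psi> (set xs) j \<union> (if j < i then {x} else {}))"

text \<open>The stack is decreasing, so the first slot that admits a new element of color \<open>\<kappa> x\<close> holds the
  largest such ideal; comparing cardinalities suffices.\<close>

lemma X_min_partial_stack:
  assumes \<psi>: "stackwise_on UNIV \<psi>" and split: "ext = xs @ x # ys" and i: "i < \<psi> x"
  shows "X_min \<kappa> ext (\<kappa> x) (ideals_mset (partial_stack \<psi> xs x i)) =
           Some (x, ideals_mset (partial_stack \<psi> xs x (Suc i)))"
proof -
  let ?N = "partial_stack \<psi> xs x i"
  have "i < m" using i \<psi> by (auto simp: stackwise_on_def intro: less_le_trans)
  have x: "x \<notin> set xs" using split ext_distinct by auto
  have below: "y \<in> set xs" if "y < x" for y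
  proof -
    have "y \<in> set (xs @ [x])"
      using downset_prefix[of "xs @ [x]" ys] split that downsetD'[of "set (xs @ [x])" x y] by auto
    then show ?thesis using that by auto
  qed
  have in_stack: "y \<in> stack_tuple \<psi> (set xs) j" if "y < x" "j < \<psi> x" for y j
    using below that \<psi> by (auto simp: stack_tuple_def stackwise_on_def intro: less_le_trans)
  have add_i: "addable \<kappa> (\<kappa> x) (?N i) = {x}"
  proof (rule addable_unique)
    show "x \<in> addable \<kappa> (\<kappa> x) (?N i)"
      using x in_stack i by (auto simp: addable_def partial_stack_def stack_tuple_def)
  qed
  \<comment> \<open>A slot that already holds \<open>x\<close> admits nothing more of this color: an
    element below \<open>x\<close> is already there, and one above \<open>x\<close> needs an element
    strictly between them, which the prefix does not contain.\<close>
  have add_low: "addable \<kappa> (\<kappa> x) (?N j) = {}" if "j < i" for j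
  proof (rule ccontr)
    assume "addable \<kappa> (\<kappa> x) (?N j) \<noteq> {}"
    then obtain y where y: "y \<notin> ?N j" "\<kappa> y = \<kappa> x" "\<And>t. t < y \<Longrightarrow> t \<in> ?N j"
      by (auto simp: addable_def)
    have "y \<noteq> x" using y that by (auto simp: partial_stack_def)
    moreover have "\<not> y < x" using y in_stack that i by (auto simp: partial_stack_def)
    ultimately have "x < y" using same_color_comparable[OF y(2)] by (auto simp: less_le)
    then obtain w where w: "x < w" "w < y" using adj_between y(2) by metis
    then have "w \<in> set xs" using y(3)[of w] by (auto simp: partial_stack_def stack_tuple_def split: if_splits)
    then show False using downset_prefix[OF split] downsetD' w x by blast
  qed
  have dec: "?N j \<subseteq> ?N i" if "i \<le> j" for j
    using that by (auto simp: partial_stack_def stack_tuple_def)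
  let ?G = "{I. I \<in># ideals_mset ?N \<and> addable \<kappa> (\<kappa> x) I \<noteq> {}}"
  have iG: "?N i \<in> ?G" using \<open>i < m\<close> add_i by (auto simp: ideals_mset_def)
  have G_less: "card J < card (?N i)" if "J \<in> ?G" "J \<noteq> ?N i" for J
  proof -
    from that obtain j where j: "j < m" "J = ?N j" "addable \<kappa> (\<kappa> x) (?N j) \<noteq> {}"
      by (auto simp: ideals_mset_def)
    then have "i \<le> j" using add_low by (meson not_less)
    then show ?thesis using dec j that(2) by (intro psubset_card_mono) auto
  qed
  have the_I: "(THE I. I \<in> ?G \<and> (\<forall>J\<in>?G. J \<noteq> I \<longrightarrow> gravity_less ext I J)) = ?N i"
  proof (rule the_equality)
    show "?N i \<in> ?G \<and> (\<forall>J\<in>?G. J \<noteq> ?N i \<longrightarrow> gravity_less ext (?N i) J)"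
      using iG G_less by (auto simp: gravity_less_def)
    fix I assume I: "I \<in> ?G \<and> (\<forall>J\<in>?G. J \<noteq> I \<longrightarrow> gravity_less ext I J)"
    show "I = ?N i"
    proof (rule ccontr)
      assume "I \<noteq> ?N i"
      then have "gravity_less ext I (?N i)" "card I < card (?N i)" using I iG G_less by auto
      then show False by (simp add: gravity_less_def)
    qed
  qed
  have "?N(i := ?N i \<union> {x}) = partial_stack \<psi> xs x (Suc i)"
    by (auto simp: partial_stack_def fun_eq_iff)
  then have upd: "add_mset (?N i \<union> {x}) (ideals_mset ?N - {#?N i#}) = ideals_mset (partial_stack \<psi> xs x (Suc i))"
    using ideals_mset_update[OF \<open>i < m\<close>, of ?N "?N i \<union> {x}"] by simp
  have "?G \<noteq> {}" using iG by blast
  then have "X_min \<kappa> ext (\<kappa> x) (ideals_mset ?N) =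
      Some (x, add_mset (?N i \<union> {x}) (ideals_mset ?N - {#?N i#}))"
    unfolding X_min_def Let_def the_I add_i by simp
  then show ?thesis unfolding upd .
qed

lemma growth_letters:
  assumes \<psi>: "stackwise_on UNIV \<psi>" and "ext = xs @ ys"
  shows "growth \<kappa> ext m (map \<kappa> (rev (letters \<psi> xs))) =
           Some (rev (letters \<psi> xs), ideals_mset (stack_tuple \<psi> (set xs)))"
  using assms(2)
proof (induction xs arbitrary: ys rule: rev_induct)
  case Nil
  have "ideals_mset (stack_tuple \<psi> {}) = empty_ideals m"
    by (simp add: ideals_mset_def stack_tuple_def empty_ideals_def image_mset_const_eq)
  then show ?case by simp
next
  case (snoc x xs)
  have IH: "growth \<kappa> ext m (map \<kappa> (rev (letters \<psi> xs))) =
      Some (rev (letters \<psi> xs), ideals_mset (stack_tuple \<psi> (set xs)))"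
    using snoc by simp
  have "growth \<kappa> ext m (replicate i (\<kappa> x) @ map \<kappa> (rev (letters \<psi> xs))) =
      Some (replicate i x @ rev (letters \<psi> xs), ideals_mset (partial_stack \<psi> xs x i))"
    if "i \<le> \<psi> x" for i
    using that
  proof (induction i)
    case 0
    then show ?case using IH by (simp add: partial_stack_def)
  next
    case (Suc i)
    then show ?case using X_min_partial_stack[OF \<psi>, of xs x ys i] snoc.prems by simp
  qed
  moreover have "partial_stack \<psi> xs x (\<psi> x) = stack_tuple \<psi> (set (xs @ [x]))"
    by (auto simp: partial_stack_def stack_tuple_def fun_eq_iff)
  ultimately show ?case by (simp add: letters_append letters_Cons)
qed

lemma bracket_stackwise:
  assumes "stackwise_on UNIV \<psi>"
  obtains B where "bracket \<kappa> ext m (u @ word_of (prefix_blocks \<psi> ext)) = B @ map Inr (rev (letters \<psi> ext))"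
    "length B = length u"
  using bracket_append growth_letters[OF assms, of ext "[]"] unfolding word_of_prefix_blocks
  by (metis append_Nil2)

text \<open>Let \<open>x\<close> be the first element where the exponents differ; dominance makes
  \<open>\<phi>\<close> larger there. Read from the right, the brackets agree up to the last
  \<open>x\<close> of \<open>\<psi>\<close>; then \<open>\<phi>\<close> has another \<open>x\<close>
  while \<open>\<psi>\<close> goes on with a later element. The letters of \<open>c\<close> are not
  reached.\<close>

lemma above_word_less:
  assumes \<psi>: "stackwise_on UNIV \<psi>" and \<phi>: "\<phi> \<in> above \<psi> c q" and "q \<ge> 1"
    and ns: "\<not> stackwise_word \<kappa> ext m (replicate q c @ word_of (prefix_blocks \<psi> ext))"
  shows "word_less \<kappa> ext gext m (word_of (prefix_blocks \<phi> ext)) (replicate q c @ word_of (prefix_blocks \<psi> ext))"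
proof -
  have \<phi>s: "stackwise_on UNIV \<phi>" and dom: "dominates \<phi> \<psi>"
    and wt: "\<And>Q. (\<Sum>x | Q (\<kappa> x). \<phi> x) = (\<Sum>x | Q (\<kappa> x). \<psi> x) + (if Q c then q else 0)"
    using \<phi> by (auto simp: above_def)
  have total: "(\<Sum>x\<in>UNIV. \<phi> x) = (\<Sum>x\<in>UNIV. \<psi> x) + q" using wt[of "\<lambda>_. True"] by simp
  then have "\<phi> \<noteq> \<psi>" using \<open>q \<ge> 1\<close> by auto
  then obtain x0 where "\<phi> x0 \<noteq> \<psi> x0" by auto
  then obtain xs x ys where split: "ext = xs @ x # ys" and x: "\<phi> x \<noteq> \<psi> x"
      and xs: "\<forall>y\<in>set xs. \<phi> y = \<psi> y"
    using split_list_first_prop[of ext "\<lambda>x. \<phi> x \<noteq> \<psi> x"] ext_set by auto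
  have xnin: "x \<notin> set xs" "x \<notin> set ys" using split ext_distinct by auto
  have "(\<Sum>y\<in>set (xs @ [x]). \<psi> y) \<le> (\<Sum>y\<in>set (xs @ [x]). \<phi> y)"
    using dom split unfolding dominates_def by (metis append.assoc append_Cons append_Nil)
  then have "\<psi> x < \<phi> x" using xs xnin x by simp
  then obtain d where d: "\<phi> x = \<psi> x + Suc d" using less_imp_Suc_add by force
  have L\<phi>: "letters \<phi> ext = (letters \<psi> xs @ replicate (\<psi> x) x) @ x # replicate d x @ letters \<phi> ys"
    using letters_cong[of xs \<phi> \<psi>] xs by (simp add: split letters_append letters_Cons d replicate_add replicate_app_Cons_same)
  have L\<psi>: "letters \<psi> ext = (letters \<psi> xs @ replicate (\<psi> x) x) @ letters \<psi> ys"
    by (simp add: split letters_append letters_Cons)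
  have len: "length (letters \<phi> ext) = length (letters \<psi> ext) + q"
    using total by (simp add: length_letters ext_distinct ext_set)
  \<comment> \<open>Otherwise \<open>\<phi>\<close> is nowhere smaller than \<open>\<psi>\<close>,
    so by weights the excess has color \<open>c\<close> only and sits entirely at \<open>x\<close>.
    The augmented word would then be the word of \<open>\<phi>\<close>, contrary to
    \<open>ns\<close>.\<close>
  have "letters \<psi> ys \<noteq> []"
  proof
    assume empty: "letters \<psi> ys = []"
    then have ys0: "\<psi> y = 0" if "y \<in> set ys" for y using that by (auto simp: letters_def)
    have ge: "\<psi> y \<le> \<phi> y" for y
      using ys0 xs \<open>\<psi> x < \<phi> x\<close> split ext_set by (metis UNIV_I Un_iff le_less less_eq_nat.simps(1) set_ConsD set_append)
    have col: "\<kappa> y = c" if "\<psi> y < \<phi> y" for y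
    proof (rule ccontr)
      assume "\<kappa> y \<noteq> c"
      then have "(\<Sum>t | \<kappa> t = \<kappa> y. \<phi> t) = (\<Sum>t | \<kappa> t = \<kappa> y. \<psi> t)" using wt[of "\<lambda>b. b = \<kappa> y"] by auto
      moreover have "(\<Sum>t | \<kappa> t = \<kappa> y. \<psi> t) < (\<Sum>t | \<kappa> t = \<kappa> y. \<phi> t)"
        using ge that by (intro sum_strict_mono_ex1) auto
      ultimately show False by simp
    qed
    \<comment> \<open>A positive value beyond \<open>x\<close> would have color \<open>c\<close> and
      force a positive value at some \<open>w\<close> of an adjacent color, where all excess must
      again have color \<open>c\<close>.\<close>
    have \<phi>ys: "\<phi> y = 0" if "y \<in> set ys" for y
    proof (rule ccontr)
      assume "\<phi> y \<noteq> 0"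
      then have "\<psi> y < \<phi> y" using ys0 that by simp
      then have "\<kappa> y = \<kappa> x" using col \<open>\<psi> x < \<phi> x\<close> by metis
      moreover have "\<not> y < x" "y \<noteq> x" using ext_order[OF split that] that xnin by auto
      ultimately have "x < y" using same_color_comparable by (auto simp: less_le)
      then obtain w where w: "x < w" "w < y" "adj (\<kappa> w) (\<kappa> x)" using adj_between \<open>\<kappa> y = \<kappa> x\<close> by metis
      have "w \<notin> set xs" using downset_prefix[OF split] downsetD' w(1) xnin by blast
      then have "w \<in> set ys" using split ext_set w(1) by auto
      moreover have "\<phi> y \<le> \<phi> w" using \<phi>s w by (simp add: stackwise_on_def)
      ultimately have "\<psi> w < \<phi> w" using ys0 \<open>\<phi> y \<noteq> 0\<close> by simp
      then have "\<kappa> w = \<kappa> x" using col \<open>\<psi> x < \<phi> x\<close> by metis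
      then show False using w(3) by simp
    qed
    then have "letters \<phi> ys = []" by (auto simp: letters_def)
    then have eq: "letters \<phi> ext = letters \<psi> ext @ replicate (Suc d) x" using L\<phi> L\<psi> empty by simp
    then have "Suc d = q" using len by simp
    moreover have "\<kappa> x = c" using col \<open>\<psi> x < \<phi> x\<close> .
    ultimately have "word_of (prefix_blocks \<phi> ext) = replicate q c @ word_of (prefix_blocks \<psi> ext)"
      unfolding word_of_prefix_blocks eq by simp
    then show False using ns \<phi>s unfolding stackwise_word_def stackwise_blocks_iff by metis
  qed
  then obtain y zs where yz: "letters \<psi> ys = y # zs" by (cases "letters \<psi> ys") auto
  then have "y \<in> set (letters \<psi> ys)" by simp
  then have "y \<in> set ys" by (auto simp: letters_def split: if_splits)
  have less: "(Inr x, Inr y) \<in> letter_less ext gext"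
  proof -
    obtain us vs where "ys = us @ y # vs" using split_list[OF \<open>y \<in> set ys\<close>] by auto
    then have "map Inl gext @ map Inr ext =
        (map Inl gext @ map Inr xs) @ Inr x # map Inr us @ Inr y # map Inr vs" by (simp add: split)
    then show ?thesis unfolding letter_less_def enum_less_def
      by (intro CollectI exI[of _ "length gext + length xs"] exI[of _ "length gext + length xs + Suc (length us)"])
         (simp add: nth_append)
  qed
  obtain B1 where B1: "bracket \<kappa> ext m ([] @ word_of (prefix_blocks \<phi> ext)) = B1 @ map Inr (rev (letters \<phi> ext))"
      "length B1 = length ([] :: 'c list)"
    by (rule bracket_stackwise[OF \<phi>s])
  obtain B where B: "bracket \<kappa> ext m (replicate q c @ word_of (prefix_blocks \<psi> ext)) = B @ map Inr (rev (letters \<psi> ext))"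
      "length B = length (replicate q c)"
    by (rule bracket_stackwise[OF \<psi>])
  let ?p = "map Inr (letters \<psi> xs @ replicate (\<psi> x) x) :: ('c + 'p) list"
  have b1: "rev (bracket \<kappa> ext m (word_of (prefix_blocks \<phi> ext))) =
      ?p @ Inr x # map Inr (replicate d x @ letters \<phi> ys)"
    using B1 by (simp add: rev_map L\<phi>)
  have b2: "rev (bracket \<kappa> ext m (replicate q c @ word_of (prefix_blocks \<psi> ext))) =
      ?p @ Inr y # map Inr zs @ rev B"
    using B by (simp add: rev_map L\<psi> yz)
  have "length (?p @ Inr x # map Inr (replicate d x @ letters \<phi> ys)) = length (?p @ Inr y # map Inr zs @ rev B)"
    using len L\<phi> L\<psi> yz B by simp
  then show ?thesis
    unfolding word_less_def b1 b2 lenlex_conv lex_conv using less by blast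
qed

end

section \<open>Transfer to multisets\<close>

lemma lookup_scale [simp]: "Poly_Mapping.lookup (scale r v) M = r * Poly_Mapping.lookup v M"
  by (simp add: scale_def Poly_Mapping.map.rep_eq when_def)

lemma lookup_basis: "Poly_Mapping.lookup (basis M) N = (if M = N then 1 else 0)"
  by (simp add: basis_def lookup_single when_def)

lemma scale_add: "scale r (u + v) = scale r u + scale r v"
  and scale_scale: "scale r (scale s v) = scale (r * s) v"
  and scale_one [simp]: "scale 1 v = v"
  and scale_zero [simp]: "scale 0 v = 0"
  and scale_zero_right [simp]: "scale r 0 = 0"
  and scale_left_add: "scale (r + s) v = scale r v + scale s v"
  by (auto intro!: poly_mapping_eqI simp: lookup_add algebra_simps)

lemma scale_sum: "scale r (\<Sum>a\<in>A. f a) = (\<Sum>a\<in>A. scale r (f a))"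
  by (induction A rule: infinite_finite_induct) (auto simp: scale_add)

lemma X_superset:
  assumes "finite K" "Poly_Mapping.keys v \<subseteq> K"
  shows "X \<kappa> a v = (\<Sum>M\<in>K. scale (Poly_Mapping.lookup v M) (X_basis \<kappa> a M))"
  unfolding X_def using assms
  by (intro sum.mono_neutral_left) (auto simp: in_keys_iff)

text \<open>Supports can shrink by cancellation, so all sums run over a common finite
  superset.\<close>

lemma X_add: "X \<kappa> a (u + v) = X \<kappa> a u + X \<kappa> a v"
proof -
  let ?K = "Poly_Mapping.keys u \<union> Poly_Mapping.keys v"
  have "Poly_Mapping.keys (u + v) \<subseteq> ?K" by (rule keys_add)
  then show ?thesis
    by (simp add: X_superset[of ?K] lookup_add scale_left_add sum.distrib)
qed

lemma X_scale: "X \<kappa> a (scale r v) = scale r (X \<kappa> a v)"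
proof -
  have "Poly_Mapping.keys (scale r v) \<subseteq> Poly_Mapping.keys v" by (auto simp: in_keys_iff)
  then show ?thesis
    by (simp add: X_superset[of "Poly_Mapping.keys v"] scale_sum scale_scale)
qed

lemma X_zero [simp]: "X \<kappa> a 0 = 0"
  by (simp add: X_def)

lemma X_sum: "X \<kappa> a (\<Sum>b\<in>B. f b) = (\<Sum>b\<in>B. X \<kappa> a (f b))"
  by (induction B rule: infinite_finite_induct) (auto simp: X_add)

lemma X_of_basis: "X \<kappa> a (basis M) = X_basis \<kappa> a M"
proof -
  have "Poly_Mapping.keys (basis M) \<subseteq> {M}" by (auto simp: in_keys_iff lookup_basis split: if_splits)
  then show ?thesis by (simp add: X_superset[of "{M}"] lookup_basis)
qed

text \<open>Different indices may give the same vector, so the coefficients are collected over the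
  fibers of \<open>f\<close>.\<close>

lemma int_combination_scale_sum:
  fixes f :: "'a \<Rightarrow> 'p vec"
  assumes "finite A" "\<And>a. a \<in> A \<Longrightarrow> f a \<in> S"
  shows "int_combination S (\<Sum>a\<in>A. scale (of_int (r a)) (f a))"
proof -
  have "(\<Sum>a\<in>A. scale (of_int (r a)) (f a)) =
      (\<Sum>u\<in>f ` A. \<Sum>a | a \<in> A \<and> f a = u. scale (of_int (r a)) (f a))"
    using assms(1) by (rule sum.image_gen)
  also have "\<dots> = (\<Sum>u\<in>f ` A. scale (of_int (\<Sum>a | a \<in> A \<and> f a = u. r a)) u)"
  proof (intro sum.cong refl)
    fix u :: "'p vec"
    have "(\<Sum>a\<in>B. scale (of_int (r a)) u) = scale (of_int (\<Sum>a\<in>B. r a)) u" for B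
      by (induction B rule: infinite_finite_induct) (auto simp: scale_left_add)
    then show "(\<Sum>a | a \<in> A \<and> f a = u. scale (of_int (r a)) (f a)) =
        scale (of_int (\<Sum>a | a \<in> A \<and> f a = u. r a)) u" by simp
  qed
  finally show ?thesis
    unfolding int_combination_def using assms
    by (intro exI[of _ "f ` A"] exI[of _ "\<lambda>u. \<Sum>a | a \<in> A \<and> f a = u. r a"]) auto
qed

lemma int_combination_mono: "int_combination S v \<Longrightarrow> S \<subseteq> S' \<Longrightarrow> int_combination S' v"
  unfolding int_combination_def by blast

context colored_dc
begin

definition tuples :: "(nat \<Rightarrow> 'p set) set" where
  "tuples = PiE {..<m} (\<lambda>_. UNIV)"

text \<open>This forgets the order of the slots. Only extensional tuples are summed, so that the
  free coordinates from \<open>m\<close> on cause no repetitions.\<close>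

definition to_vec :: "((nat \<Rightarrow> 'p set) \<Rightarrow> complex) \<Rightarrow> 'p vec" where
  "to_vec f = (\<Sum>T\<in>tuples. scale (f T) (basis (ideals_mset T)))"

definition ideal_supported :: "((nat \<Rightarrow> 'p set) \<Rightarrow> complex) \<Rightarrow> bool" where
  "ideal_supported f \<longleftrightarrow> (\<forall>T j. f T \<noteq> 0 \<longrightarrow> j < m \<longrightarrow> downset (T j))"

lemma finite_tuples [simp]: "finite tuples"
  unfolding tuples_def by (rule finite_PiE) auto

lemma tuples_update: "T \<in> tuples \<Longrightarrow> j < m \<Longrightarrow> T(j := I) \<in> tuples"
  unfolding tuples_def by (auto simp: PiE_def extensional_def)

lemma to_vec_scale: "to_vec (fscale r f) = scale r (to_vec f)"
  by (simp add: to_vec_def scale_sum scale_scale)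

lemma to_vec_zero [simp]: "to_vec 0 = 0"
  by (simp add: to_vec_def)

lemma to_vec_sum: "to_vec (\<Sum>a\<in>A. f a) = (\<Sum>a\<in>A. to_vec (f a))"
proof (induction A rule: infinite_finite_induct)
  case (insert x A)
  have add: "to_vec (g + h) = to_vec g + to_vec h" for g h
    by (simp add: to_vec_def scale_left_add sum.distrib)
  show ?case unfolding sum.insert[OF insert.hyps] add insert.IH ..
next
  case (infinite A)
  show ?case unfolding sum.infinite[OF infinite] by (rule to_vec_zero)
next
  case empty
  show ?case unfolding sum.empty by (rule to_vec_zero)
qed

lemma removable_insert:
  assumes "downset I" "x \<in> addable \<kappa> a I"
  shows "removable a (insert x I) = {x}"
proof (rule removable_unique)
  have "insert x I - {x} = I" using assms by (auto simp: addable_def)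
  moreover have "downset (insert x I)"
    using assms by (auto simp: downset_def addable_def le_less)
  ultimately show "x \<in> removable a (insert x I)" using assms by (auto simp: removable_def addable_def)
qed

lemma addable_after_removal:
  assumes "removable a I = {x}"
  shows "addable \<kappa> a (I - {x}) = {x}"
proof (rule addable_unique)
  have "x \<in> removable a I" using assms by simp
  then show "x \<in> addable \<kappa> a (I - {x})"
    using downsetD'[of I x] by (auto simp: removable_def addable_def)
qed

lemma X_basis_ideals_mset:
  "X_basis \<kappa> a (ideals_mset T) = (\<Sum>j<m. \<Sum>x\<in>addable \<kappa> a (T j). basis (ideals_mset (T(j := insert x (T j)))))"
proof -
  let ?h = "\<lambda>I. \<Sum>x\<in>addable \<kappa> a I. basis (add_mset (insert x I) (ideals_mset T - {#I#}))"
  have "X_basis \<kappa> a (ideals_mset T) = (\<Sum>I\<in>#image_mset T (mset_set {..<m}). ?h I)"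
    by (simp add: X_basis_def ideals_mset_def)
  also have "\<dots> = (\<Sum>j<m. ?h (T j))"
    by (simp add: sum_unfold_sum_mset image_mset.compositionality comp_def)
  also have "\<dots> = (\<Sum>j<m. \<Sum>x\<in>addable \<kappa> a (T j). basis (ideals_mset (T(j := insert x (T j)))))"
    by (intro sum.cong refl) (simp add: ideals_mset_update)
  finally show ?thesis .
qed

text \<open>In each slot, adding and removing the unique element of color \<open>a\<close> are
  inverse bijections. The support condition matters because \<open>addable\<close> makes sense for
  arbitrary sets, whereas \<open>removable\<close> demands ideals.\<close>

lemma X_to_vec:
  assumes f: "ideal_supported f"
  shows "X \<kappa> a (to_vec f) = to_vec (tX a f)"
proof -
  have slot_sum: "(\<Sum>T\<in>tuples. \<Sum>x\<in>addable \<kappa> a (T j). scale (f T) (basis (ideals_mset (T(j := insert x (T j)))))) =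
      to_vec (slot j a f)" if "j < m" for j
  proof -
    let ?A = "{T \<in> tuples. downset (T j) \<and> addable \<kappa> a (T j) \<noteq> {}}"
    let ?B = "{T \<in> tuples. removable a (T j) \<noteq> {}}"
    let ?up = "\<lambda>T. T(j := T j \<union> addable \<kappa> a (T j))"
    let ?down = "\<lambda>T. T(j := T j - removable a (T j))"
    have up: "removable a (T j \<union> addable \<kappa> a (T j)) = addable \<kappa> a (T j)"
        "T j \<union> addable \<kappa> a (T j) - addable \<kappa> a (T j) = T j" if "T \<in> ?A" for T
    proof -
      from that obtain x where x: "x \<in> addable \<kappa> a (T j)" by blast
      then have "addable \<kappa> a (T j) = {x}" by (rule addable_unique)
      then show "removable a (T j \<union> addable \<kappa> a (T j)) = addable \<kappa> a (T j)"
        using removable_insert[of "T j" x a] x that by simp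
      show "T j \<union> addable \<kappa> a (T j) - addable \<kappa> a (T j) = T j" by (auto simp: addable_def)
    qed
    have down: "addable \<kappa> a (T j - removable a (T j)) = removable a (T j)"
        "T j - removable a (T j) \<union> removable a (T j) = T j" "downset (T j - removable a (T j))"
      if "T \<in> ?B" for T
    proof -
      from that obtain x where x: "removable a (T j) = {x}" using removable_cases by blast
      then show "addable \<kappa> a (T j - removable a (T j)) = removable a (T j)"
        using addable_after_removal by simp
      show "T j - removable a (T j) \<union> removable a (T j) = T j" by (auto simp: removable_def)
      have "x \<in> removable a (T j)" using x by simp
      then show "downset (T j - removable a (T j))" using x by (simp add: removable_def)
    qed
    have "(\<Sum>T\<in>tuples. \<Sum>x\<in>addable \<kappa> a (T j). scale (f T) (basis (ideals_mset (T(j := insert x (T j)))))) =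
        (\<Sum>T\<in>?A. scale (f T) (basis (ideals_mset (?up T))))"
    proof (rule sum.mono_neutral_cong_right)
      show "\<forall>T\<in>tuples - ?A. (\<Sum>x\<in>addable \<kappa> a (T j). scale (f T) (basis (ideals_mset (T(j := insert x (T j)))))) = 0"
      proof
        fix T assume "T \<in> tuples - ?A"
        then consider "\<not> downset (T j)" | "addable \<kappa> a (T j) = {}" by blast
        then show "(\<Sum>x\<in>addable \<kappa> a (T j). scale (f T) (basis (ideals_mset (T(j := insert x (T j)))))) = 0"
        proof cases
          case 1
          then have "f T = 0" using f \<open>j < m\<close> unfolding ideal_supported_def by blast
          then show ?thesis by simp
        next
          case 2
          then show ?thesis by simp
        qed
      qed
      show "(\<Sum>x\<in>addable \<kappa> a (T j). scale (f T) (basis (ideals_mset (T(j := insert x (T j)))))) =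
          scale (f T) (basis (ideals_mset (?up T)))" if "T \<in> ?A" for T
      proof -
        from that obtain x where "x \<in> addable \<kappa> a (T j)" by blast
        then have "addable \<kappa> a (T j) = {x}" by (rule addable_unique)
        then show ?thesis by simp
      qed
    qed auto
    also have "\<dots> = (\<Sum>T\<in>?B. scale (f (?down T)) (basis (ideals_mset T)))"
    proof (rule sum.reindex_bij_witness[where i = ?down and j = ?up])
      fix T assume T: "T \<in> ?A"
      show "?down (?up T) = T" using up[OF T] by simp
      show "?up T \<in> ?B" using T up[OF T] tuples_update[OF _ \<open>j < m\<close>] by simp
      show "scale (f (?down (?up T))) (basis (ideals_mset (?up T))) = scale (f T) (basis (ideals_mset (?up T)))"
        using up[OF T] by simp
    next
      fix T assume T: "T \<in> ?B"
      show "?up (?down T) = T" using down[OF T] by simp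
      show "?down T \<in> ?A" using T down[OF T] tuples_update[OF _ \<open>j < m\<close>] by simp
    qed
    also have "\<dots> = to_vec (slot j a f)"
      unfolding to_vec_def by (rule sum.mono_neutral_cong_left) (auto simp: slot_def loc_def)
    finally show ?thesis .
  qed
  have "X \<kappa> a (to_vec f) = (\<Sum>T\<in>tuples. \<Sum>j<m. \<Sum>x\<in>addable \<kappa> a (T j).
      scale (f T) (basis (ideals_mset (T(j := insert x (T j))))))"
    by (simp add: to_vec_def X_sum X_scale X_of_basis X_basis_ideals_mset scale_sum)
  also have "\<dots> = (\<Sum>j<m. \<Sum>T\<in>tuples. \<Sum>x\<in>addable \<kappa> a (T j).
      scale (f T) (basis (ideals_mset (T(j := insert x (T j))))))"
    by (rule sum.swap)
  also have "\<dots> = (\<Sum>j<m. to_vec (slot j a f))"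
    by (intro sum.cong refl slot_sum) simp
  also have "\<dots> = to_vec (tX a f)"
    unfolding tX_def by (rule to_vec_sum[symmetric])
  finally show ?thesis .
qed

lemma ideal_supported_tX_power:
  assumes "ideal_supported f"
  shows "ideal_supported ((tX a ^^ k) f)"
  unfolding ideal_supported_def
proof (intro allI impI)
  fix T j assume nz: "(tX a ^^ k) f T \<noteq> 0" and "j < m"
  obtain S where S: "S \<subseteq> slots a T" "f (strip a S T) \<noteq> 0"
    using nz by (rule tX_power_nonzeroE)
  show "downset (T j)"
  proof (cases "j \<in> S")
    case True
    then show ?thesis using S(1) by (rule strip_slotE)
  next
    case False
    then have "strip a S T j = T j" by (simp add: strip_def)
    then show ?thesis using assms S(2) \<open>j < m\<close> unfolding ideal_supported_def by metis
  qed
qed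

lemma X_power_to_vec:
  assumes "ideal_supported f"
  shows "(X \<kappa> a ^^ k) (to_vec f) = to_vec ((tX a ^^ k) f)"
proof (induction k)
  case (Suc k)
  then show ?case using X_to_vec[OF ideal_supported_tX_power[OF assms]] by simp
qed simp

lemma to_vec_vac: "to_vec vac = basis (empty_ideals m)"
proof -
  let ?T = "\<lambda>j\<in>{..<m}. {} :: 'p set"
  have "ideals_mset ?T = image_mset (\<lambda>_. {}) (mset_set {..<m})"
    unfolding ideals_mset_def by (intro image_mset_cong) auto
  then have T: "ideals_mset ?T = empty_ideals m"
    by (simp add: empty_ideals_def image_mset_const_eq)
  have uniq: "T = ?T" if "T \<in> tuples" "vac T \<noteq> 0" for T
    using that by (auto simp: tuples_def vac_def PiE_def extensional_def fun_eq_iff split: if_splits)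
  have "to_vec vac = (\<Sum>T\<in>{?T}. scale (vac T) (basis (ideals_mset T)))"
    unfolding to_vec_def
  proof (rule sum.mono_neutral_right)
    show "\<forall>T\<in>tuples - {?T}. scale (vac T) (basis (ideals_mset T)) = 0"
      using uniq by force
  qed (use finite_tuples in \<open>auto simp: tuples_def\<close>)
  then show ?thesis by (simp add: T vac_def)
qed

lemma tblock_ideal_supported: "ideal_supported (tblock bs)"
  unfolding ideal_supported_def using tblock_downset by blast

lemma block_vector_eq: "block_vector \<kappa> m bs = to_vec (tblock bs)"
proof -
  have "block_op \<kappa> bs (basis (empty_ideals m)) = to_vec (tblock bs)"
  proof (induction bs)
    case Nil
    then show ?case by (simp add: to_vec_vac)
  next
    case (Cons p bs)
    obtain b n where p: "p = (b, n)" by (cases p)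
    show ?case
      using Cons.IH X_power_to_vec[OF tblock_ideal_supported[of bs], where a = b and k = n]
      by (simp add: p divided_power_def divided_tX_def to_vec_scale del: fscale_apply)
  qed
  then show ?thesis by (simp add: block_vector_def)
qed

lemma divided_tX_divided_tX:
  "divided_tX a q (divided_tX a n f) = fscale (of_nat ((q + n) choose q)) (divided_tX a (q + n) f)"
proof -
  have "(tX a ^^ q) (fscale (1 / fact n) ((tX a ^^ n) f)) = fscale (1 / fact n) ((tX a ^^ (q + n)) f)"
    unfolding flinear_scale[OF flinear_funpow[OF flinear_tX]] funpow_add by simp
  moreover have "1 / fact q * (1 / fact n) = (of_nat ((q + n) choose q) * (1 / fact (q + n)) :: complex)"
    using binomial_fact[of q "q + n", where 'a = complex] by simp
  ultimately show ?thesis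
    unfolding divided_tX_def by (simp add: fv.scale_scale del: fscale_apply)
qed

lemma divided_tX_eq_0: "q > m \<Longrightarrow> divided_tX a q f = 0"
  unfolding divided_tX_def tX_power_eq_0 by (rule fv.scale_zero_right)

section \<open>The cases of the theorem\<close>

lemma no_minimal_color_vanishes:
  assumes "\<nexists>z. minimal_element z \<and> \<kappa> z = c" "q \<ge> 1"
  shows "block_vector \<kappa> m [(c, q)] = 0"
proof -
  have "addable \<kappa> c {} = {}" using assms(1) by (auto simp: addable_def minimal_element_def)
  then have "X_basis \<kappa> c (empty_ideals m) = 0"
    by (auto simp: X_basis_def empty_ideals_def in_replicate_mset intro!: sum_mset.neutral)
  then have "X \<kappa> c (basis (empty_ideals m)) = 0" by (simp add: X_of_basis)
  moreover obtain k where "q = Suc k" using assms(2) by (cases q) auto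
  moreover have "(X \<kappa> c ^^ k) 0 = 0" for k by (induction k) auto
  ultimately have "(X \<kappa> c ^^ q) (basis (empty_ideals m)) = 0" by (simp add: funpow_Suc_right del: funpow.simps)
  then show ?thesis by (simp add: block_vector_def divided_power_def)
qed

text \<open>After \<open>k\<close> steps there remain \<open>m - k\<close> empty ideals to which
  \<open>z\<close> can be added, while \<open>{z}\<close> admits no second element of its color;
  this produces the falling factorial.\<close>

lemma minimal_color_power:
  assumes z: "minimal_element z" "k \<le> m"
  shows "(X \<kappa> (\<kappa> z) ^^ k) (basis (empty_ideals m)) =
    scale (fact m / fact (m - k)) (basis (replicate_mset k {z} + replicate_mset (m - k) {}))"
  using z(2)
proof (induction k)
  case 0
  then show ?case by (simp add: empty_ideals_def)
next
  case (Suc k)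
  have add0: "addable \<kappa> (\<kappa> z) {} = {z}"
    using z(1) by (intro addable_unique) (auto simp: addable_def minimal_element_def)
  have addz: "addable \<kappa> (\<kappa> z) {z} = {}"
  proof (rule ccontr)
    assume "addable \<kappa> (\<kappa> z) {z} \<noteq> {}"
    then obtain y where y: "y \<noteq> z" "\<kappa> y = \<kappa> z" "\<And>t. t < y \<Longrightarrow> t = z" by (auto simp: addable_def)
    then have "z < y" using same_color_comparable[of y z] z(1) by (auto simp: minimal_element_def less_le)
    then show False using adj_between y by (metis order_less_irrefl)
  qed
  have sum_rep: "(\<Sum>I\<in>#replicate_mset l J. g I) = scale (of_nat l) (g J)" for g :: "'p set \<Rightarrow> 'p vec" and l J
    by (induction l) (auto simp: scale_left_add)
  obtain l where l: "m - k = Suc l" "m - Suc k = l" using Suc.prems by (metis Suc_diff_Suc Suc_le_lessD)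
  have "X_basis \<kappa> (\<kappa> z) (replicate_mset k {z} + replicate_mset (Suc l) {}) =
      scale (of_nat (Suc l)) (basis (replicate_mset (Suc k) {z} + replicate_mset l {}))"
    unfolding X_basis_def image_mset_union sum_mset.union sum_rep addz add0 by simp
  then have "(X \<kappa> (\<kappa> z) ^^ Suc k) (basis (empty_ideals m)) =
      scale (fact m / fact (Suc l) * of_nat (Suc l)) (basis (replicate_mset (Suc k) {z} + replicate_mset l {}))"
    using Suc.IH Suc.prems l(1) by (simp add: X_scale X_of_basis scale_scale)
  moreover have "fact m / fact (Suc l) * of_nat (Suc l) = (fact m / fact l :: complex)"
    by (simp add: fact_Suc field_simps del: of_nat_Suc)
  ultimately show ?case unfolding l(2) by simp
qed

lemma minimal_color_vector:
  assumes z: "minimal_element z" "\<kappa> z = c" and q: "1 \<le> q" "q \<le> m"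
  shows "block_vector \<kappa> m [(c, q)] =
      scale (of_nat (m choose q)) (basis (replicate_mset q {z} + replicate_mset (m - q) {}))"
    and "stackwise_blocks \<kappa> ext m [(c, q)]"
proof -
  have "block_vector \<kappa> m [(c, q)] = scale (1 / fact q) ((X \<kappa> (\<kappa> z) ^^ q) (basis (empty_ideals m)))"
    by (simp add: block_vector_def divided_power_def z(2))
  also have "\<dots> = scale (1 / fact q * (fact m / fact (m - q))) (basis (replicate_mset q {z} + replicate_mset (m - q) {}))"
    by (simp add: minimal_color_power[OF z(1) q(2)] scale_scale)
  also have "1 / fact q * (fact m / fact (m - q)) = (of_nat (m choose q) :: complex)"
    using binomial_fact[OF q(2), where 'a = complex] by simp
  finally show "block_vector \<kappa> m [(c, q)] =
      scale (of_nat (m choose q)) (basis (replicate_mset q {z} + replicate_mset (m - q) {}))" .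
  let ?\<psi> = "\<lambda>x. if x = z then q else 0"
  have "stackwise_on UNIV ?\<psi>" using z(1) q by (auto simp: stackwise_on_def minimal_element_def)
  moreover have "prefix_blocks ?\<psi> ext = [(c, q)]"
  proof -
    obtain xs ys where split: "ext = xs @ z # ys" using ext_set by (metis UNIV_I split_list)
    then have "z \<notin> set xs" "z \<notin> set ys" using ext_distinct by auto
    then have "filter (\<lambda>x. ?\<psi> x > 0) xs = []" "filter (\<lambda>x. ?\<psi> x > 0) ys = []"
      by (auto simp: filter_empty_conv)
    then have "filter (\<lambda>x. ?\<psi> x > 0) ext = [z]"
      using q(1) by (simp only: split filter_append filter.simps) simp
    then show ?thesis unfolding prefix_blocks_def using z(2) by simp
  qed
  ultimately show "stackwise_blocks \<kappa> ext m [(c, q)]" unfolding stackwise_blocks_iff by metis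
qed

lemma stackwise_word_blocks:
  assumes "reduced_blocks bs" "stackwise_word \<kappa> ext m (word_of bs)"
  shows "stackwise_blocks \<kappa> ext m bs"
  using assms word_of_inject reduced_prefix_blocks unfolding stackwise_word_def stackwise_blocks_iff by metis

text \<open>This also covers equal colors with exponents summing to more than \<open>m\<close>, so
  the closing claim of the theorem only has to separate stackwise from other words.\<close>

lemma augmented_nonstackwise:
  assumes as: "stackwise_blocks \<kappa> ext m as" and q: "q \<ge> 1"
    and ns: "\<not> stackwise_word \<kappa> ext m (word_of ((c, q) # as))"
  shows "int_combination (stackwise_vectors_less \<kappa> ext gext m (word_of ((c, q) # as)))
    (block_vector \<kappa> m ((c, q) # as))"
proof -
  obtain \<psi> where \<psi>: "stackwise_on UNIV \<psi>" and as_eq: "as = prefix_blocks \<psi> ext"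
    using as stackwise_blocks_iff by blast
  obtain r :: "('p \<Rightarrow> nat) \<Rightarrow> int" where
    r: "divided_tX c q (stack_vec \<psi>) = (\<Sum>\<phi>\<in>above \<psi> c q. fscale (of_int (r \<phi>)) (stack_vec \<phi>))"
    by (rule augmented_stack_combination[OF \<psi>])
  have "block_vector \<kappa> m ((c, q) # as) = to_vec (divided_tX c q (stack_vec \<psi>))"
    by (simp add: block_vector_eq as_eq)
  also have "\<dots> = (\<Sum>\<phi>\<in>above \<psi> c q. scale (of_int (r \<phi>)) (block_vector \<kappa> m (prefix_blocks \<phi> ext)))"
    unfolding r to_vec_sum to_vec_scale block_vector_eq ..
  finally have eq: "block_vector \<kappa> m ((c, q) # as) =
      (\<Sum>\<phi>\<in>above \<psi> c q. scale (of_int (r \<phi>)) (block_vector \<kappa> m (prefix_blocks \<phi> ext)))" .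
  have "block_vector \<kappa> m (prefix_blocks \<phi> ext) \<in> stackwise_vectors_less \<kappa> ext gext m (word_of ((c, q) # as))"
    if \<phi>: "\<phi> \<in> above \<psi> c q" for \<phi>
  proof -
    have "stackwise_blocks \<kappa> ext m (prefix_blocks \<phi> ext)"
      using \<phi> stackwise_blocks_iff by (auto simp: above_def)
    moreover have "(\<Sum>x\<in>UNIV. \<phi> x) = (\<Sum>x\<in>UNIV. \<psi> x) + q"
      using \<phi> by (auto simp: above_def dest!: spec[of _ "\<lambda>_. True"])
    then have "length (word_of (prefix_blocks \<phi> ext)) = length (word_of ((c, q) # as))"
      by (simp add: as_eq word_of_prefix_blocks length_letters ext_distinct ext_set)
    moreover have "word_less \<kappa> ext gext m (word_of (prefix_blocks \<phi> ext)) (word_of ((c, q) # as))"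
      using above_word_less[OF \<psi> \<phi> q] ns by (simp add: as_eq)
    ultimately show ?thesis unfolding stackwise_vectors_less_def by blast
  qed
  moreover have "finite (above \<psi> c q)"
    by (rule finite_subset[OF _ finite_stackwise]) (auto simp: above_def)
  ultimately show ?thesis unfolding eq by (intro int_combination_scale_sum)
qed

lemma same_color_merge:
  "block_vector \<kappa> m ((c, q) # (c, n) # as) =
    scale (of_nat ((q + n) choose q)) (block_vector \<kappa> m ((c, q + n) # as))"
  unfolding block_vector_eq by (simp add: divided_tX_divided_tX to_vec_scale del: fscale_apply)

lemma power_too_large: "q > m \<Longrightarrow> block_vector \<kappa> m ((c, q) # as) = 0"
  by (simp add: block_vector_eq divided_tX_eq_0)

end

lemma int_combination_scale:
  assumes "v \<in> S"
  shows "int_combination S (scale (of_int k) v)"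
  using int_combination_scale_sum[of "{()}" "\<lambda>_. v" S "\<lambda>_. k"] assms by simp

theorem theorem6p1:
  fixes adj :: "'c::finite \<Rightarrow> 'c \<Rightarrow> bool"
    and \<kappa> :: "'p::{finite,order} \<Rightarrow> 'c"
    and ext :: "'p list"
    and gext :: "'c list"
    and m q :: nat
    and c :: 'c
    and as :: "('c \<times> nat) list"
  assumes dc: "colored_d_complete adj \<kappa>"
    and conn: "connected_poset TYPE('p)"
    and m: "m \<ge> 1"
    and ext: "linear_extension ext"
    and gext: "total_enum gext"
    and q: "q \<ge> 1"
    and pos: "\<forall>(a, n)\<in>set as. n > 0"
    and stack: "stackwise_blocks \<kappa> ext m as"
  shows
    "(as = [] \<longrightarrow>
        ((\<nexists>z. minimal_element z \<and> \<kappa> z = c) \<or> q > m \<longrightarrow>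
           block_vector \<kappa> m [(c, q)] = 0) \<and>
        (\<forall>z. minimal_element z \<and> \<kappa> z = c \<and> q \<le> m \<longrightarrow>
           block_vector \<kappa> m [(c, q)] =
             scale (of_nat (m choose q)) (basis (replicate_mset q {z} + replicate_mset (m - q) {})) \<and>
           stackwise_vector \<kappa> ext m (block_vector \<kappa> m [(c, q)]))) \<and>
     (\<forall>a n as'. as = (a, n) # as' \<longrightarrow>
        (c = a \<and> q + n > m \<longrightarrow> block_vector \<kappa> m ((c, q) # as) = 0) \<and>
        (stackwise_word \<kappa> ext m (word_of ((c, q) # as)) \<longrightarrow>
           (c = a \<longrightarrow>
              block_vector \<kappa> m ((c, q) # as) =
                scale (of_nat ((q + n) choose q)) (block_vector \<kappa> m ((a, q + n) # as'))) \<and>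
           (c \<noteq> a \<longrightarrow> stackwise_vector \<kappa> ext m (block_vector \<kappa> m ((c, q) # as))) \<and>
           (\<exists>(r::int) v. stackwise_vector \<kappa> ext m v \<and>
              block_vector \<kappa> m ((c, q) # as) = scale (of_int r) v)) \<and>
        (\<not> (c = a \<and> q + n > m) \<and> \<not> stackwise_word \<kappa> ext m (word_of ((c, q) # as)) \<longrightarrow>
           int_combination (stackwise_vectors_less \<kappa> ext gext m (word_of ((c, q) # as)))
             (block_vector \<kappa> m ((c, q) # as)))) \<and>
     (block_vector \<kappa> m ((c, q) # as) = 0 \<or>
      int_combination (stackwise_vectors_le \<kappa> ext gext m (word_of ((c, q) # as)))
        (block_vector \<kappa> m ((c, q) # as)))"
proof -
  interpret colored_dc adj \<kappa> ext m
    by unfold_locales (use dc ext in auto)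
  let ?w = "word_of ((c, q) # as)"
  let ?v = "block_vector \<kappa> m ((c, q) # as)"
  have red: "reduced_blocks as"
    using stack reduced_prefix_blocks unfolding stackwise_blocks_iff by auto
  \<comment> \<open>If \<open>as\<close> begins with a block of color \<open>c\<close>, the blocks
    are not reduced and have to be merged, which contributes the binomial coefficient. Otherwise
    they are reduced already and the multiple is 1.\<close>
  have stackwise_multiple: "\<exists>bs (r::int). stackwise_blocks \<kappa> ext m bs \<and> word_of bs = ?w \<and>
      ?v = scale (of_int r) (block_vector \<kappa> m bs)" if sw: "stackwise_word \<kappa> ext m ?w"
  proof (cases "\<exists>n as'. as = (c, n) # as'")
    case True
    then obtain n as' where as: "as = (c, n) # as'" by blast
    let ?bs = "(c, q + n) # as'"
    have w: "word_of ?bs = ?w" by (simp add: as replicate_add)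
    have "reduced_blocks ?bs" using red q by (auto simp: as reduced_blocks_def successively_Cons)
    then have "stackwise_blocks \<kappa> ext m ?bs" using stackwise_word_blocks sw w by metis
    moreover have "?v = scale (of_int (int ((q + n) choose q))) (block_vector \<kappa> m ?bs)"
      unfolding as same_color_merge by simp
    ultimately show ?thesis using w by blast
  next
    case False
    have "reduced_blocks ((c, q) # as)"
      using red q False by (cases as) (auto simp: reduced_blocks_def)
    then have "stackwise_blocks \<kappa> ext m ((c, q) # as)" using stackwise_word_blocks sw by blast
    then show ?thesis by (intro exI[of _ "(c, q) # as"] exI[of _ 1]) simp
  qed
  have "?v = 0 \<or> int_combination (stackwise_vectors_le \<kappa> ext gext m ?w) ?v"
  proof (cases "stackwise_word \<kappa> ext m ?w")
    case True
    then obtain bs r where bs: "stackwise_blocks \<kappa> ext m bs" "word_of bs = ?w"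
        "?v = scale (of_int r) (block_vector \<kappa> m bs)"
      using stackwise_multiple by blast
    then have "block_vector \<kappa> m bs \<in> stackwise_vectors_le \<kappa> ext gext m ?w"
      unfolding stackwise_vectors_le_def by auto
    then show ?thesis unfolding bs(3) by (blast intro: int_combination_scale)
  next
    case False
    have "stackwise_vectors_less \<kappa> ext gext m ?w \<subseteq> stackwise_vectors_le \<kappa> ext gext m ?w"
      unfolding stackwise_vectors_less_def stackwise_vectors_le_def by blast
    then show ?thesis using augmented_nonstackwise[OF stack q False] int_combination_mono by blast
  qed
  moreover have "stackwise_vector \<kappa> ext m (block_vector \<kappa> m [(c, q)])"
    if "minimal_element z \<and> \<kappa> z = c \<and> q \<le> m" for z
    using minimal_color_vector(2) q that unfolding stackwise_vector_def by blast
  moreover have "stackwise_vector \<kappa> ext m ?v"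
    if "as = (a, n) # as'" "stackwise_word \<kappa> ext m ?w" "c \<noteq> a" for a n as'
  proof -
    have "reduced_blocks ((c, q) # as)" using red q that(1,3) by (auto simp: reduced_blocks_def)
    then show ?thesis using stackwise_word_blocks that(2) unfolding stackwise_vector_def by blast
  qed
  moreover have "\<exists>(r::int) v. stackwise_vector \<kappa> ext m v \<and> ?v = scale (of_int r) v"
    if "stackwise_word \<kappa> ext m ?w"
    using stackwise_multiple[OF that] unfolding stackwise_vector_def by blast
  moreover have "?v = scale (of_nat ((q + n) choose q)) (block_vector \<kappa> m ((a, q + n) # as'))"
    if "as = (a, n) # as'" "c = a" for a n as'
    unfolding that by (rule same_color_merge)
  \<comment> \<open>After merging, the exponent exceeds the number of slots.\<close>
  moreover have "?v = 0" if "as = (a, n) # as'" "c = a \<and> q + n > m" for a n as'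
    using that same_color_merge[of c q n as'] power_too_large[of "q + n" c as'] by simp
  moreover have "block_vector \<kappa> m [(c, q)] = 0" if "(\<nexists>z. minimal_element z \<and> \<kappa> z = c) \<or> q > m"
    using that no_minimal_color_vanishes[OF _ q] power_too_large by blast
  moreover have "block_vector \<kappa> m [(c, q)] =
      scale (of_nat (m choose q)) (basis (replicate_mset q {z} + replicate_mset (m - q) {}))"
    if "minimal_element z \<and> \<kappa> z = c \<and> q \<le> m" for z
    using minimal_color_vector(1) q that by blast
  moreover note augmented_nonstackwise[OF stack q]
  ultimately show ?thesis
    by (intro conjI allI impI) (assumption | elim conjE; assumption | metis)+
qed

end
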